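(* Let $r,s>0$, let $P=\mathcal{N}(m;\Sigma)$ be the Gaussian distribution on $\mathbb{R}^d$ with mean $m\in\mathbb{R}^d$ and (positive definite) covariance matrix $\Sigma$, and let $(\alpha_n)_{n\ge1}$ be an $L^r(P)$-optimal sequence of quantizers. (a) If $s\in(r,r+d)\cup(r+d,+\infty)$, the sequence $(\alpha_n^{\theta,m})_{n\ge1}$ is $L^s(P)$-rate-optimal if and only if $\theta\in\bigl(\sqrt{s/(d+r)},+\infty\bigr)$, and $$\theta^\star=\sqrt{(s+d)/(r+d)}\in(1,+\infty)$$ is the unique minimizer of $\theta\mapsto Q_{r,s}^{\mathrm{Sup}}(P,\theta)$ on $\bigl(\sqrt{s/(d+r)},+\infty\bigr)$. (b) If $s\in(0,r)$, the sequence $(\alpha_n^{\theta,m})_{n\ge1}$ is $L^s(P)$-rate-optimal if $\theta\in\bigl(\sqrt{s/r},+\infty\bigr)$, and $$\theta^\star=\sqrt{(s+d)/(r+d)}\in(0,1)$$ is the unique minimizer of $\theta\mapsto Q_{r,s}^{\mathrm{Sup}}(P,\theta)$ on $\bigl(\sqrt{s/r},+\infty\bigr)$.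
   Context: $\lambda_d$ is Lebesgue measure on $\mathbb{R}^d$, $|\cdot|$ is a norm on $\mathbb{R}^d$, and $d(x,\alpha)=\min_{a\in\alpha}|x-a|$ for a finite nonempty $\alpha\subset\mathbb{R}^d$. A sequence of quantizers $(\alpha_n)_{n\ge1}$ is a sequence of finite nonempty sets $\alpha_n\subset\mathbb{R}^d$ with $\mathrm{card}(\alpha_n)\le n$; it is $L^r(P)$-optimal if for all $n\ge1$, $\int d(x,\alpha_n)^r dP(x)=e_{n,r}^r(P):=\inf_{\mathrm{card}(\alpha)\le n}\int d(x,\alpha)^r dP(x)$. A sequence $(\beta_n)$ is $L^s(P)$-rate-optimal if $\limsup_n n^{s/d}\int d(x,\beta_n)^s dP(x)<+\infty$. For $\theta>0$: $\alpha_n^{\theta,m}=\{m+\theta(a-m):a\in\alpha_n\}$. $f$ denotes the density of $P$ and $f_{\theta,m}(x)=f(m+\theta(x-m))$. With $J_{r,d}=\inf_{n\ge1}n^{r/d}e_{n,r}^r(U([0,1]^d))\in(0,\infty)$ ($U([0,1]^d)$ uniform distribution) and $Q_r(P)=J_{r,d}\left(\int f^{d/(d+r)}d\lambda_d\right)^{(d+r)/d}$, set (with translating number $\mu=m$) $$Q_{r,s}^{\mathrm{Sup}}(P,\theta)=\begin{cases}\theta^{s+d}\,(Q_r(P))^{s/r}\left(\int_{\{f>0\}}f_{\theta,m}^{\frac{r}{r-s}}f^{-\frac{s}{r-s}}d\lambda_d\right)^{1-\frac sr}&\text{if }s<r,\\[1ex] \theta^{s+d}\,C(b)\int f_{\theta,m}f^{-\frac{s}{d+r}}d\lambda_d&\text{if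 }s>r,\end{cases}$$ where $C(b)>0$ is a fixed constant not depending on $\theta$ (its value is irrelevant for the minimization). *)

theory Defs
  imports "HOL-Analysis.Analysis"
begin

text \<open>
  Throughout, \<open>N\<close> is an arbitrary norm on \<open>real ^ 'd\<close>; it need not be the Euclidean one, which is
  what the type class operation \<^term>\<open>norm\<close> denotes.
\<close>

definition is_norm :: "(real ^ 'd \<Rightarrow> real) \<Rightarrow> bool" where
  "is_norm N \<longleftrightarrow>
     (\<forall>x. 0 \<le> N x) \<and>
     (\<forall>x. N x = 0 \<longleftrightarrow> x = 0) \<and>
     (\<forall>c x. N (c *\<^sub>R x) = \<bar>c\<bar> * N x) \<and>
     (\<forall>x y. N (x + y) \<le> N x + N y)"

text \<open>Powers of elements of \<open>[0, \<infinity>]\<close>; only used with exponents \<open>p > 0\<close>.\<close>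

definition ennpowr :: "ennreal \<Rightarrow> real \<Rightarrow> ennreal" where
  "ennpowr x p = (if x = \<infinity> then \<infinity> else ennreal (enn2real x powr p))"

definition quantizer :: "nat \<Rightarrow> (real ^ 'd) set \<Rightarrow> bool" where
  "quantizer n \<alpha> \<longleftrightarrow> finite \<alpha> \<and> \<alpha> \<noteq> {} \<and> card \<alpha> \<le> n"

definition set_dist :: "(real ^ 'd \<Rightarrow> real) \<Rightarrow> real ^ 'd \<Rightarrow> (real ^ 'd) set \<Rightarrow> real" where
  "set_dist N x \<alpha> = Min ((\<lambda>a. N (x - a)) ` \<alpha>)"

definition distortion ::
    "(real ^ 'd \<Rightarrow> real) \<Rightarrow> real \<Rightarrow> (real ^ 'd) measure \<Rightarrow> (real ^ 'd) set \<Rightarrow> ennreal" where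
  "distortion N r P \<alpha> = (\<integral>\<^sup>+ x. ennreal (set_dist N x \<alpha> powr r) \<partial>P)"

text \<open>The \<open>r\<close>-th power \<open>e\<^bsub>n,r\<^esub>\<^sup>r(P)\<close> of the optimal quantization error.\<close>

definition opt_distortion ::
    "(real ^ 'd \<Rightarrow> real) \<Rightarrow> real \<Rightarrow> (real ^ 'd) measure \<Rightarrow> nat \<Rightarrow> ennreal" where
  "opt_distortion N r P n = (INF \<alpha>\<in>{\<alpha>. quantizer n \<alpha>}. distortion N r P \<alpha>)"

text \<open>Sequences are indexed by \<open>n \<ge> 1\<close>; the value at \<open>0\<close> is irrelevant.\<close>

definition quantizer_seq :: "(nat \<Rightarrow> (real ^ 'd) set) \<Rightarrow> bool" where
  "quantizer_seq \<alpha> \<longleftrightarrow> (\<forall>n\<ge>1. quantizer n (\<alpha> n))"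

definition Lr_optimal ::
    "(real ^ 'd \<Rightarrow> real) \<Rightarrow> real \<Rightarrow> (real ^ 'd) measure \<Rightarrow> (nat \<Rightarrow> (real ^ 'd) set) \<Rightarrow> bool" where
  "Lr_optimal N r P \<alpha> \<longleftrightarrow>
     quantizer_seq \<alpha> \<and> (\<forall>n\<ge>1. distortion N r P (\<alpha> n) = opt_distortion N r P n)"

definition Ls_rate_optimal ::
    "(real ^ 'd \<Rightarrow> real) \<Rightarrow> real \<Rightarrow> (real ^ 'd) measure \<Rightarrow> (nat \<Rightarrow> (real ^ 'd) set) \<Rightarrow> bool" where
  "Ls_rate_optimal N s P \<beta> \<longleftrightarrow>
     limsup (\<lambda>n. ennreal (real n powr (s / real CARD('d))) * distortion N s P (\<beta> n)) < \<infinity>"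

definition dilate :: "real \<Rightarrow> real ^ 'd \<Rightarrow> (real ^ 'd) set \<Rightarrow> (real ^ 'd) set" where
  "dilate \<theta> m \<alpha> = (\<lambda>a. m + \<theta> *\<^sub>R (a - m)) ` \<alpha>"

definition J_const :: "(real ^ 'd \<Rightarrow> real) \<Rightarrow> real \<Rightarrow> ennreal" where
  "J_const N r =
     (INF n\<in>{1..}. ennreal (real n powr (r / real CARD('d))) *
        opt_distortion N r (uniform_measure lborel {x. \<forall>i. 0 \<le> x $ i \<and> x $ i \<le> 1}) n)"

text \<open>
  A distribution enters the following constants through its Lebesgue density \<open>f\<close>. They are
  \<open>[0, \<infinity>]\<close>-valued, so that no divergent integral is silently replaced by \<open>0\<close>; in particular
  \<open>/\<close> is division in \<^typ>\<open>ennreal\<close>, where \<open>a / 0 = \<infinity>\<close> for \<open>a > 0\<close>.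
\<close>

definition Q_const :: "(real ^ 'd \<Rightarrow> real) \<Rightarrow> real \<Rightarrow> (real ^ 'd \<Rightarrow> real) \<Rightarrow> ennreal" where
  "Q_const N r f =
     (let d = real CARD('d) in
      J_const N r *
      ennpowr (\<integral>\<^sup>+ x. ennreal (f x powr (d / (d + r))) \<partial>lborel) ((d + r) / d))"

definition dilate_density ::
    "real \<Rightarrow> real ^ 'd \<Rightarrow> (real ^ 'd \<Rightarrow> real) \<Rightarrow> real ^ 'd \<Rightarrow> real" where
  "dilate_density \<theta> m f x = f (m + \<theta> *\<^sub>R (x - m))"

text \<open>Only meaningful for \<open>s \<noteq> r\<close>. The parameter \<open>C\<close> is the constant of the case \<open>s > r\<close>.\<close>

definition Q_sup ::
    "(real ^ 'd \<Rightarrow> real) \<Rightarrow> real \<Rightarrow> real \<Rightarrow> real \<Rightarrow> (real ^ 'd \<Rightarrow> real) \<Rightarrow> real ^ 'd \<Rightarrow> real \<Rightarrow> ennreal"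
  where
  "Q_sup N r s C f m \<theta> =
     (let d = real CARD('d) in
      if s < r then
        ennreal (\<theta> powr (s + d)) * ennpowr (Q_const N r f) (s / r) *
        ennpowr
          (\<integral>\<^sup>+ x\<in>{x. f x > 0}.
             ennreal (dilate_density \<theta> m f x powr (r / (r - s))) /
             ennreal (f x powr (s / (r - s))) \<partial>lborel)
          (1 - s / r)
      else
        ennreal (\<theta> powr (s + d)) * ennreal C *
        (\<integral>\<^sup>+ x. ennreal (dilate_density \<theta> m f x) / ennreal (f x powr (s / (d + r))) \<partial>lborel))"

definition pos_def_matrix :: "real ^ 'd ^ 'd \<Rightarrow> bool" where
  "pos_def_matrix S \<longleftrightarrow> transpose S = S \<and> (\<forall>x. x \<noteq> 0 \<longrightarrow> x \<bullet> (S *v x) > 0)"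

definition gaussian_density :: "real ^ 'd \<Rightarrow> real ^ 'd ^ 'd \<Rightarrow> real ^ 'd \<Rightarrow> real" where
  "gaussian_density m S x =
     exp (- ((x - m) \<bullet> (matrix_inv S *v (x - m))) / 2) / sqrt ((2 * pi) ^ CARD('d) * det S)"

definition gaussian :: "real ^ 'd \<Rightarrow> real ^ 'd ^ 'd \<Rightarrow> (real ^ 'd) measure" where
  "gaussian m S = density lborel (\<lambda>x. ennreal (gaussian_density m S x))"

end

theory Submission
  imports Defs "HOL-Probability.Distributions" "HOL-Real_Asymp.Real_Asymp"
begin

text \<open>
  Write \<open>h = n powr (-1/d)\<close>, let \<open>q\<close> be the quadratic form of the inverse covariance matrix, so that
  the density is \<open>f x = c\<^sub>0 * exp (- q (x - m) / 2)\<close>, and let \<open>D n x\<close> be the distance from \<open>x\<close> to the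
  optimal quantizer \<open>\<alpha> n\<close>. The substitution \<open>x = m + \<theta> (y - m)\<close> turns the normalized distortion of the
  dilated quantizer into \<open>\<theta> powr (s+d)\<close> times the integral of
  \<open>(D n y / h)\<^sup>s * f (m + \<theta> (y - m))\<close>. Optimality forces \<open>D n y\<close> to have the order
  \<open>h * f y powr (-1/(d+r))\<close>. The integral is thus comparable with that of
  \<open>exp (- (\<theta>\<^sup>2 - s/(d+r)) * q (y - m) / 2)\<close>, which is finite exactly for \<open>\<theta>\<^sup>2 > s/(d+r)\<close>. This argument
  covers every \<open>s > 0\<close>; for \<open>s < r\<close> the threshold \<open>s/r\<close> of the theorem is larger than \<open>s/(d+r)\<close>.

  The order of \<open>D n\<close> comes from one inequality, \<open>exchange_inequality\<close>: moving a point \<open>a\<close> of an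
  optimal quantizer to any other place \<open>y\<close> does not pay, so the gain near \<open>y\<close>, which is at least of the
  order \<open>D n y powr (r+d)\<close> times the density near \<open>y\<close>, is at most the cost of giving up \<open>a\<close>.

  For the upper bound, some point is cheap (\<open>cheap_cell\<close>): the total error is of order
  \<open>h powr r\<close>, a positive proportion of the \<open>n\<close> points lies near \<open>m\<close>, a fixed proportion of these have a neighbour at
  distance of order \<open>h\<close>, and an average point among them costs at most a multiple of \<open>h powr (r+d)\<close>.
  This bounds \<open>D n y\<close> for all \<open>y\<close>, with an arbitrarily small loss in the exponent
  (\<open>D_global_bound\<close>), and without loss on bounded sets (\<open>D_local_bound\<close>). The loss is harmless for
  \<open>\<theta>\<^sup>2 > s/(d+r)\<close>, which gives \<open>dilatation_rate_optimal\<close>.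

  For the lower bound, some \<open>y\<close> near \<open>m\<close> has distance at least of order \<open>h\<close> from the \<open>n\<close> points, so
  every point is expensive (\<open>every_cell_cost\<close>). By the upper bound its Voronoi cell is small in
  diameter, so the cost can only come from volume (\<open>cell_volume\<close>). Since the cells are disjoint, there are
  too few points near any bounded set for \<open>D n\<close> to be smaller than its expected order on more than half
  of a ball (\<open>far_points_volume\<close>). For \<open>\<theta>\<^sup>2 \<le> s/(d+r)\<close> the integrals over balls of radius \<open>R\<close> are then
  at least of order \<open>R\<^sup>d\<close>, which gives \<open>dilatation_not_rate_optimal\<close>.

  As to the minimizer, \<open>exp (- t * q (x - m))\<close> has an integral proportional to \<open>t powr (-d/2)\<close>, so
  \<open>Q_sup\<close> is a positive finite constant times \<open>\<theta> powr a * (\<theta>\<^sup>2 - \<sigma>) powr -\<kappa>\<close> for suitable \<open>a\<close>, \<open>\<sigma>\<close>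
  and \<open>\<kappa>\<close>. Finiteness and positivity of the constant require those of \<open>J_const\<close>. As a function of
  \<open>w = \<sigma>/\<theta>\<^sup>2\<close> the logarithm is, up to a constant, a positive combination of \<open>- ln w\<close> and \<open>- ln (1 - w)\<close>;
  it is strictly convex, and its critical point is the asserted minimizer (\<open>profile_strict_min\<close>).
\<close>

section \<open>Norms and distances to finite sets\<close>

text \<open>
  The constants of equivalence with the Euclidean norm are parameters: volumes are computed for Euclidean
  balls only, and \<open>A\<close> and \<open>B\<close> translate them to balls of \<open>N\<close>.
\<close>

locale vector_norm =
  fixes N :: "real ^ 'd \<Rightarrow> real" and A B :: real
  assumes is_norm: "is_norm N"
    and A_pos: "0 < A"
    and norm_le_N: "A * norm x \<le> N x"
    and N_le_norm: "N x \<le> B * norm x"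
begin

lemma N_nonneg [simp]: "0 \<le> N x"
  and N_0 [simp]: "N 0 = 0"
  and N_scale: "N (c *\<^sub>R x) = \<bar>c\<bar> * N x"
  and N_triangle: "N (x + y) \<le> N x + N y"
  using is_norm unfolding is_norm_def by auto

lemma N_minus_commute: "N (x - y) = N (y - x)"
  using N_scale[of "-1" "x - y"] by simp

lemma N_triangle_diff: "N (x - z) \<le> N (x - y) + N (y - z)"
  using N_triangle[of "x - y" "y - z"] by simp

lemma A_le_B: "A \<le> B"
proof -
  obtain i :: 'd where True by simp
  have "A * norm (axis i 1 :: real ^ 'd) \<le> B * norm (axis i 1 :: real ^ 'd)"
    using norm_le_N N_le_norm order_trans by blast
  then show ?thesis by (simp add: norm_axis_1)
qed

lemma B_pos: "0 < B"
  using A_pos A_le_B by simp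

lemma norm_le_N_div: "norm x \<le> N x / A"
  using norm_le_N[of x] A_pos by (simp add: field_simps)

lemma continuous_on_N: "continuous_on S N"
proof (rule continuous_on_subset[OF _ subset_UNIV], rule lipschitz_on_continuous_on)
  show "B-lipschitz_on UNIV N"
  proof (rule lipschitz_onI)
    show "dist (N x) (N y) \<le> B * dist x y" for x y
      using N_triangle_diff[of x 0 y] N_triangle_diff[of y 0 x] N_le_norm[of "x - y"]
        N_minus_commute[of x y] by (auto simp: dist_norm abs_le_iff)
  qed (use B_pos in simp)
qed

lemma N_measurable [measurable]: "N \<in> borel_measurable borel"
  by (rule borel_measurable_continuous_onI) (rule continuous_on_N)

lemma set_dist_le: "finite \<alpha> \<Longrightarrow> a \<in> \<alpha> \<Longrightarrow> set_dist N x \<alpha> \<le> N (x - a)"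
  unfolding set_dist_def by (intro Min_le) auto

lemma set_dist_attained:
  assumes "finite \<alpha>" "\<alpha> \<noteq> {}"
  obtains a where "a \<in> \<alpha>" "set_dist N x \<alpha> = N (x - a)"
proof -
  have "Min ((\<lambda>a. N (x - a)) ` \<alpha>) \<in> (\<lambda>a. N (x - a)) ` \<alpha>"
    using assms by (intro Min_in) auto
  with that show thesis unfolding set_dist_def by blast
qed

lemma set_dist_nonneg: "finite \<alpha> \<Longrightarrow> \<alpha> \<noteq> {} \<Longrightarrow> 0 \<le> set_dist N x \<alpha>"
  by (metis set_dist_attained N_nonneg)

lemma set_dist_ge_iff:
  "finite \<alpha> \<Longrightarrow> \<alpha> \<noteq> {} \<Longrightarrow> t \<le> set_dist N x \<alpha> \<longleftrightarrow> (\<forall>a\<in>\<alpha>. t \<le> N (x - a))"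
  unfolding set_dist_def by (subst Min_ge_iff) auto

lemma less_set_dist_iff:
  "finite \<alpha> \<Longrightarrow> \<alpha> \<noteq> {} \<Longrightarrow> t < set_dist N x \<alpha> \<longleftrightarrow> (\<forall>a\<in>\<alpha>. t < N (x - a))"
  unfolding set_dist_def by (subst Min_gr_iff) auto

lemma set_dist_antimono:
  "finite \<beta> \<Longrightarrow> \<alpha> \<noteq> {} \<Longrightarrow> \<alpha> \<subseteq> \<beta> \<Longrightarrow> set_dist N x \<beta> \<le> set_dist N x \<alpha>"
  unfolding set_dist_def by (intro Min_antimono) auto

lemma set_dist_lipschitz:
  assumes "finite \<alpha>" "\<alpha> \<noteq> {}"
  shows "set_dist N x \<alpha> \<le> set_dist N y \<alpha> + N (x - y)"
proof -
  obtain a where a: "a \<in> \<alpha>" "set_dist N y \<alpha> = N (y - a)"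
    using set_dist_attained assms by blast
  then show ?thesis
    using set_dist_le[of \<alpha> a x] N_triangle_diff[of x a y] assms by simp
qed

lemma set_dist_measurable [measurable]:
  "finite \<alpha> \<Longrightarrow> \<alpha> \<noteq> {} \<Longrightarrow> (\<lambda>x. set_dist N x \<alpha>) \<in> borel_measurable borel"
  unfolding set_dist_def by measurable

lemma set_dist_dilate:
  assumes "finite \<alpha>" "\<alpha> \<noteq> {}" "0 < \<theta>"
  shows "set_dist N (m + \<theta> *\<^sub>R (y - m)) (dilate \<theta> m \<alpha>) = \<theta> * set_dist N y \<alpha>"
proof -
  have eq: "N (m + \<theta> *\<^sub>R (y - m) - (m + \<theta> *\<^sub>R (a - m))) = \<theta> * N (y - a)" for a
    using N_scale[of \<theta> "y - a"] assms by (simp add: algebra_simps)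
  have "set_dist N (m + \<theta> *\<^sub>R (y - m)) (dilate \<theta> m \<alpha>) = Min ((\<lambda>t. \<theta> * t) ` (\<lambda>a. N (y - a)) ` \<alpha>)"
    unfolding set_dist_def dilate_def image_image eq ..
  also have "\<dots> = \<theta> * set_dist N y \<alpha>"
    unfolding set_dist_def using assms
    by (intro mono_Min_commute[symmetric]) (auto simp: mono_def)
  finally show ?thesis .
qed

end

text \<open>
  \<open>N\<close> is Lipschitz continuous by the triangle inequality along the coordinate axes, so it attains a
  positive minimum on the Euclidean unit sphere.
\<close>

lemma is_norm_vector_norm:
  fixes N :: "real ^ 'd \<Rightarrow> real"
  assumes "is_norm N"
  obtains A B where "vector_norm N A B"
proof -
  have N0: "N x = 0 \<longleftrightarrow> x = 0" and Nn: "0 \<le> N x"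
    and Nsc: "N (c *\<^sub>R x) = \<bar>c\<bar> * N x" and Ntri: "N (x + y) \<le> N x + N y" for c x y
    using assms unfolding is_norm_def by auto
  define B where "B = (\<Sum>i\<in>UNIV. N (axis i 1 :: real ^ 'd))"
  have B0: "0 \<le> B" unfolding B_def by (simp add: sum_nonneg Nn)
  have N_sum: "N (\<Sum>i\<in>I. g i) \<le> (\<Sum>i\<in>I. N (g i))" if "finite I" for g and I :: "'d set"
    using that
  proof induction
    case (insert i I) then show ?case using Ntri[of "g i" "sum g I"] by simp
  qed (simp add: N0[THEN iffD2])
  have NB: "N x \<le> B * norm x" for x
  proof -
    have "N x = N (\<Sum>i\<in>UNIV. x $ i *\<^sub>R axis i 1)"
      using basis_expansion[of x] by (simp add: scalar_mult_eq_scaleR)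
    also have "\<dots> \<le> (\<Sum>i\<in>UNIV. N (x $ i *\<^sub>R axis i 1 :: real ^ 'd))" by (rule N_sum) simp
    also have "\<dots> \<le> (\<Sum>i\<in>UNIV. norm x * N (axis i 1 :: real ^ 'd))"
      unfolding Nsc by (intro sum_mono mult_right_mono component_le_norm_cart Nn)
    finally show ?thesis by (simp add: B_def sum_distrib_left mult.commute)
  qed
  have cont: "continuous_on S N" for S
  proof (rule continuous_on_subset[OF _ subset_UNIV], rule lipschitz_on_continuous_on)
    show "B-lipschitz_on UNIV N"
    proof (rule lipschitz_onI)
      show "dist (N x) (N y) \<le> B * dist x y" for x y
        using Ntri[of y "x - y"] Ntri[of x "y - x"] NB[of "x - y"] NB[of "y - x"]
        by (auto simp: dist_norm abs_le_iff norm_minus_commute)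
    qed (rule B0)
  qed
  have "compact (sphere 0 1 :: (real ^ 'd) set)" "sphere 0 1 \<noteq> ({} :: (real ^ 'd) set)"
    by simp_all
  from continuous_attains_inf[OF this cont] obtain z :: "real ^ 'd"
    where z: "z \<in> sphere 0 1" "\<And>y. y \<in> sphere 0 1 \<Longrightarrow> N z \<le> N y"
    by blast
  have "N z * norm x \<le> N x" for x
  proof (cases "x = 0")
    case False
    have "N z \<le> N ((1 / norm x) *\<^sub>R x)" using False by (intro z(2)) simp
    also have "\<dots> = N x / norm x" by (simp add: Nsc)
    finally show ?thesis using False by (simp add: field_simps)
  qed (simp add: Nn)
  moreover have "0 < N z" using z(1) N0[of z] Nn[of z] by (auto simp: less_le)
  ultimately have "vector_norm N (N z) B"
    using NB assms by unfold_locales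
  then show thesis by (rule that)
qed

section \<open>Volumes\<close>

abbreviation vol :: "(real ^ 'd) set \<Rightarrow> real" where
  "vol \<equiv> measure lborel"

abbreviation ball_vol :: "'d itself \<Rightarrow> real" where
  "ball_vol _ \<equiv> unit_ball_vol (real CARD('d))"

lemma nn_integral_lborel_dilate:
  fixes g :: "real ^ 'd \<Rightarrow> ennreal"
  assumes "\<theta> > 0" and [measurable]: "g \<in> borel_measurable borel"
  shows "(\<integral>\<^sup>+x. g x \<partial>lborel) =
    ennreal (\<theta> ^ CARD('d)) * (\<integral>\<^sup>+x. g (m + \<theta> *\<^sub>R (x - m)) \<partial>lborel)"
proof -
  have eq: "m + \<theta> *\<^sub>R (x - m) = (m - \<theta> *\<^sub>R m) + \<theta> *\<^sub>R x" for x
    by (simp add: algebra_simps)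
  show ?thesis
    unfolding eq using assms
    by (subst lborel_affine[of \<theta> "m - \<theta> *\<^sub>R m"])
       (simp_all add: nn_integral_density nn_integral_distr nn_integral_cmult)
qed

lemma emeasure_cball_cart:
  "0 \<le> \<rho> \<Longrightarrow> emeasure lborel (cball (c :: real ^ 'd) \<rho>) = ennreal (ball_vol TYPE('d) * \<rho> ^ CARD('d))"
  by (simp add: emeasure_cball)

lemma vol_cball:
  "0 \<le> \<rho> \<Longrightarrow> vol (cball (c :: real ^ 'd) \<rho>) = ball_vol TYPE('d) * \<rho> ^ CARD('d)"
  by (simp add: measure_def emeasure_cball_cart)

lemma fmeasurable_bounded_borel:
  fixes S :: "(real ^ 'd) set"
  assumes "S \<in> sets borel" "bounded S"
  shows "S \<in> fmeasurable lborel"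
  using assms emeasure_bounded_finite[of S] by (intro fmeasurableI) (auto simp: less_top)

lemma ball_vol_nonzero [simp]: "ball_vol TYPE('d::finite) \<noteq> 0"
  using unit_ball_vol_pos[of "real CARD('d)"] by linarith

lemma sum_vol_disjoint_le:
  fixes S :: "(real ^ 'd) set"
  assumes "finite I" "disjoint_family_on U I" "\<And>i. i \<in> I \<Longrightarrow> U i \<in> sets borel"
    "\<And>i. i \<in> I \<Longrightarrow> U i \<subseteq> S" "bounded S" "S \<in> sets borel"
  shows "(\<Sum>i\<in>I. vol (U i)) \<le> vol S"
proof -
  have U: "U i \<in> fmeasurable lborel" if "i \<in> I" for i
    using assms(3,4)[OF that] bounded_subset[OF assms(5)] by (intro fmeasurable_bounded_borel) auto
  have "(\<Sum>i\<in>I. vol (U i)) = vol (\<Union>i\<in>I. U i)"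
    using assms U
    by (intro measure_finite_Union[symmetric]) (auto simp: fmeasurable_def less_top[symmetric])
  also have "\<dots> \<le> vol S"
    using assms by (intro measure_mono_fmeasurable fmeasurable_bounded_borel) auto
  finally show ?thesis .
qed

text \<open>
  The part of \<open>S\<close> within distance \<open>\<tau> a\<close> of some \<open>a\<close> is covered by Euclidean balls of radius \<open>\<tau> a / A\<close>. Every
  lower bound for a quantization error below comes from this estimate.
\<close>

lemma (in vector_norm) vol_far_from_finite:
  fixes S :: "(real ^ 'd) set"
  assumes fin: "finite \<alpha>" and S: "S \<in> sets borel" "bounded S" and \<tau>: "\<And>a. a \<in> \<alpha> \<Longrightarrow> 0 \<le> \<tau> a"
  shows "vol S - (\<Sum>a\<in>\<alpha>. ball_vol TYPE('d) * (\<tau> a / A) ^ CARD('d))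
    \<le> vol {x \<in> S. \<forall>a\<in>\<alpha>. \<tau> a < N (x - a)}"
proof -
  let ?G = "{x \<in> S. \<forall>a\<in>\<alpha>. \<tau> a < N (x - a)}"
  let ?b = "\<lambda>a. cball a (\<tau> a / A)"
  have eq: "?G = S \<inter> (\<Inter>a\<in>\<alpha>. {x. \<tau> a < N (x - a)})" by auto
  have [measurable]: "{x. \<tau> a < N (x - a)} \<in> sets borel" for a
    by measurable
  have Gm: "?G \<in> sets borel"
    using fin S unfolding eq by (cases "\<alpha> = {}") (auto intro!: sets.Int sets.finite_INT)
  have G: "?G \<in> fmeasurable lborel"
    by (rule fmeasurable_bounded_borel) (use Gm S in \<open>auto intro: bounded_subset\<close>)
  have b: "?b a \<in> fmeasurable lborel" for a
    by (rule fmeasurable_bounded_borel) auto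
  have U: "(\<Union>a\<in>\<alpha>. ?b a) \<in> fmeasurable lborel"
    using fin b by (intro fmeasurable.finite_UN) auto
  have "vol S \<le> vol (?G \<union> (\<Union>a\<in>\<alpha>. ?b a))"
  proof (rule measure_mono_fmeasurable)
    show "S \<subseteq> ?G \<union> (\<Union>a\<in>\<alpha>. ?b a)"
    proof
      fix x assume "x \<in> S"
      show "x \<in> ?G \<union> (\<Union>a\<in>\<alpha>. ?b a)"
      proof (cases "\<forall>a\<in>\<alpha>. \<tau> a < N (x - a)")
        case False
        then obtain a where a: "a \<in> \<alpha>" "N (x - a) \<le> \<tau> a" by force
        have "norm (x - a) \<le> N (x - a) / A" by (rule norm_le_N_div)
        also have "\<dots> \<le> \<tau> a / A" using a A_pos by (intro divide_right_mono) auto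
        finally have "x \<in> ?b a" by (simp add: dist_norm norm_minus_commute)
        then show ?thesis using a by blast
      qed (use \<open>x \<in> S\<close> in auto)
    qed
  qed (use S G U in \<open>auto intro!: fmeasurable.Un\<close>)
  also have "\<dots> \<le> vol ?G + vol (\<Union>a\<in>\<alpha>. ?b a)"
    using G U by (intro measure_Un_le) (auto dest: fmeasurableD)
  also have "vol (\<Union>a\<in>\<alpha>. ?b a) \<le> (\<Sum>a\<in>\<alpha>. vol (?b a))"
    using fin b by (intro measure_UNION_le) (auto dest: fmeasurableD)
  also have "\<dots> = (\<Sum>a\<in>\<alpha>. ball_vol TYPE('d) * (\<tau> a / A) ^ CARD('d))"
    using \<tau> A_pos by (intro sum.cong) (auto simp: vol_cball)
  finally show ?thesis by simp
qed

text \<open>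
  The Euclidean balls of radius \<open>\<eta> / (2 * B)\<close> around the points are disjoint and lie in \<open>cball m 3\<close>.
\<close>

lemma (in vector_norm) card_separated_le:
  assumes fin: "finite T" and T: "T \<subseteq> cball m 2" and \<eta>: "0 < \<eta>" "\<eta> \<le> 2 * B"
    and sep: "\<And>a a'. a \<in> T \<Longrightarrow> a' \<in> T \<Longrightarrow> a \<noteq> a' \<Longrightarrow> \<eta> < N (a - a')"
  shows "real (card T) * \<eta> ^ CARD('d) \<le> (6 * B) ^ CARD('d)"
proof -
  let ?V = "ball_vol TYPE('d)"
  let ?\<rho> = "\<eta> / (2 * B)"
  have V: "0 < ?V" using unit_ball_vol_pos[of "real CARD('d)"] by simp
  have \<rho>: "0 \<le> ?\<rho>" "?\<rho> \<le> 1" using \<eta> B_pos by (auto simp: field_simps)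
  have "(\<Sum>a\<in>T. vol (cball a ?\<rho>)) \<le> vol (cball m 3)"
  proof (rule sum_vol_disjoint_le[OF fin])
    show "disjoint_family_on (\<lambda>a. cball a ?\<rho>) T"
    proof (unfold disjoint_family_on_def, intro ballI impI)
      fix a a' assume a: "a \<in> T" "a' \<in> T" "a \<noteq> a'"
      show "cball a ?\<rho> \<inter> cball a' ?\<rho> = {}"
      proof (rule ccontr)
        assume "cball a ?\<rho> \<inter> cball a' ?\<rho> \<noteq> {}"
        then obtain z where "dist a z \<le> ?\<rho>" "dist a' z \<le> ?\<rho>" by auto
        then have "norm (a - a') \<le> 2 * ?\<rho>"
          using dist_triangle2[of a a' z] by (simp add: dist_norm)
        then have "B * norm (a - a') \<le> B * (2 * ?\<rho>)" using B_pos by (intro mult_left_mono) auto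
        then have "N (a - a') \<le> \<eta>" using N_le_norm[of "a - a'"] B_pos by simp
        then show False using sep[OF a] by simp
      qed
    qed
    show "cball a ?\<rho> \<subseteq> cball m 3" if "a \<in> T" for a
    proof
      fix z assume "z \<in> cball a ?\<rho>"
      then have "dist a z \<le> 1" using \<rho> by simp
      moreover have "dist m a \<le> 2" using T that by auto
      ultimately show "z \<in> cball m 3" using dist_triangle[of m z a] by simp
    qed
  qed auto
  then have "?V * (real (card T) * ?\<rho> ^ CARD('d)) \<le> ?V * 3 ^ CARD('d)"
    using \<rho> by (simp add: vol_cball mult_ac)
  then have "real (card T) * ?\<rho> ^ CARD('d) \<le> 3 ^ CARD('d)" using V by (simp only: mult_le_cancel_left_pos)
  then have "(2 * B) ^ CARD('d) * (real (card T) * ?\<rho> ^ CARD('d)) \<le> (2 * B) ^ CARD('d) * 3 ^ CARD('d)"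
    using B_pos by (intro mult_left_mono) auto
  also have "(2 * B) ^ CARD('d) * (real (card T) * ?\<rho> ^ CARD('d)) = real (card T) * ((2 * B) * ?\<rho>) ^ CARD('d)"
    by (simp only: power_mult_distrib mult_ac)
  also have "(2 * B) * ?\<rho> = \<eta>" using B_pos by simp
  also have "(2 * B) ^ CARD('d) * 3 ^ CARD('d) = (6 * B) ^ CARD('d)"
    by (subst power_mult_distrib[symmetric]) (simp add: mult_ac)
  finally show ?thesis .
qed

section \<open>Quantizers with many points\<close>

text \<open>
  The spacing of a regular grid with \<open>n\<close> points in a unit cube of dimension \<open>d\<close>.
\<close>

definition mesh :: "nat \<Rightarrow> nat \<Rightarrow> real" where
  "mesh d n = real n powr (- 1 / real d)"

lemma mesh_pos: "0 < n \<Longrightarrow> 0 < mesh d n"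
  by (simp add: mesh_def)

lemma mesh_power: "0 < n \<Longrightarrow> 0 < d \<Longrightarrow> mesh d n ^ d = 1 / real n"
  unfolding mesh_def by (subst powr_power) (auto simp: powr_minus_divide)

lemma mesh_tendsto: "0 < d \<Longrightarrow> mesh d \<longlonglongrightarrow> 0"
  unfolding mesh_def
  by (rule tendsto_neg_powr) (auto intro: filterlim_real_sequentially)

lemma powr_mesh: "0 < n \<Longrightarrow> real n powr (s / real d) = mesh d n powr - s"
  by (simp add: mesh_def powr_powr)

context vector_norm
begin

lemma distortion_ge:
  assumes sets: "sets M = sets borel" and G: "G \<in> sets borel" and "0 \<le> \<rho>" "0 < r"
    and D: "\<And>x. x \<in> G \<Longrightarrow> \<rho> \<le> set_dist N x \<alpha>"
  shows "ennreal (\<rho> powr r) * emeasure M G \<le> distortion N r M \<alpha>"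
proof -
  have "ennreal (\<rho> powr r) * emeasure M G = (\<integral>\<^sup>+x. ennreal (\<rho> powr r) * indicator G x \<partial>M)"
    using sets G by (subst nn_integral_cmult_indicator) auto
  also have "\<dots> \<le> distortion N r M \<alpha>"
    unfolding distortion_def using assms
    by (intro nn_integral_mono) (auto split: split_indicator intro!: ennreal_leI powr_mono2)
  finally show ?thesis .
qed

end

subsection \<open>A nonuniform grid\<close>

text \<open>
  The grid is the image of the uniform grid \<open>j / M\<close> under the bijection \<open>T u = u / (1 - \<bar>u\<bar>)\<close> from \<open>(-1, 1)\<close> to
  the line. Its derivative at the preimage of \<open>x\<close> is \<open>(1 + \<bar>x\<bar>)\<^sup>2\<close>, so finitely many points serve the whole
  line at the price of a polynomial factor, which Gaussian tails absorb.
\<close>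

lemma real_grid:
  assumes M: "0 < M"
  obtains G :: "real set" where "finite G" "G \<noteq> {}" "card G \<le> 2 * M - 1"
    "\<And>x. \<exists>g\<in>G. \<bar>x - g\<bar> \<le> (1 + \<bar>x\<bar>)\<^sup>2 / real M"
proof -
  define T where "T u = u / (1 - \<bar>u\<bar>)" for u :: real
  define G where "G = (\<lambda>j::int. T (of_int j / real M)) ` {- (int M - 1)..int M - 1}"
  have "card G \<le> card {- (int M - 1)..int M - 1}" unfolding G_def by (rule card_image_le) simp
  also have "\<dots> = 2 * M - 1" using M by simp
  finally have card: "card G \<le> 2 * M - 1" .
  have Gm: "- g \<in> G" if g: "g \<in> G" for g
  proof -
    obtain j where j: "j \<in> {- (int M - 1)..int M - 1}" "g = T (of_int j / real M)"
      using g unfolding G_def by auto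
    have "- g = T (of_int (- j) / real M)" using j by (simp add: T_def)
    moreover have "- j \<in> {- (int M - 1)..int M - 1}" using j(1) by auto
    ultimately show ?thesis unfolding G_def by (rule image_eqI)
  qed
  (* Rounding the preimage towards 0 keeps 1 / (1 - v) below 1 / (1 - u) = 1 + x. *)
  have pos: "\<exists>g\<in>G. \<bar>x - g\<bar> \<le> (1 + \<bar>x\<bar>)\<^sup>2 / real M" if x: "0 \<le> x" for x
  proof -
    define u where "u = x / (1 + x)"
    define j where "j = \<lfloor>u * real M\<rfloor>"
    define v where "v = of_int j / real M"
    have u: "0 \<le> u" "u < 1" and ux: "1 - u = 1 / (1 + x)" "x = u / (1 - u)"
      using x by (auto simp: u_def field_simps)
    have j0: "0 \<le> j" unfolding j_def using u by simp
    have "u * real M < 1 * real M" using u M by (intro mult_strict_right_mono) auto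
    then have jM: "j \<le> int M - 1" unfolding j_def by linarith
    have v: "0 \<le> v" "v \<le> u" "u - v \<le> 1 / real M"
    proof -
      show "0 \<le> v" using j0 by (simp add: v_def)
      have "of_int j \<le> u * real M" "u * real M \<le> of_int j + 1"
        unfolding j_def by linarith+
      then have "v \<le> u" "u \<le> (of_int j + 1) / real M" unfolding v_def using M
        by (auto simp: pos_divide_le_eq pos_le_divide_eq)
      then show "v \<le> u" "u - v \<le> 1 / real M" unfolding v_def
        by (auto simp: add_divide_distrib)
    qed
    have v1: "v < 1" using u v by simp
    have T: "T v = v / (1 - v)" using v by (simp add: T_def)
    have "x - T v = (u - v) * ((1 / (1 - u)) * (1 / (1 - v)))"
      using u v1 unfolding T by (subst ux(2)) (simp add: field_simps)
    moreover have "1 / (1 - v) \<le> 1 / (1 - u)" using u v by (intro divide_left_mono) auto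
    moreover have "1 / (1 - u) = 1 + x" using ux(1) by simp
    moreover have "0 \<le> 1 / (1 - v)" using v1 by simp
    ultimately have xT: "0 \<le> x - T v" "x - T v \<le> (1 / real M) * ((1 + x) * (1 + x))"
      using v x by (auto intro!: mult_mono mult_nonneg_nonneg
        simp del: times_divide_eq_left times_divide_eq_right)
    have "T v \<in> G" unfolding G_def v_def using j0 jM by (intro imageI) auto
    then show ?thesis using xT x by (intro bexI[of _ "T v"]) (auto simp: power2_eq_square)
  qed
  have "\<exists>g\<in>G. \<bar>x - g\<bar> \<le> (1 + \<bar>x\<bar>)\<^sup>2 / real M" for x
  proof (cases "0 \<le> x")
    case False
    then obtain g where "g \<in> G" "\<bar>- x - g\<bar> \<le> (1 + \<bar>- x\<bar>)\<^sup>2 / real M"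
      using pos[of "- x"] by auto
    then show ?thesis using Gm[of g] by (intro bexI[of _ "- g"]) auto
  qed (use pos in auto)
  moreover have "finite G" "G \<noteq> {}" unfolding G_def using M by auto
  ultimately show thesis using card that by blast
qed

context vector_norm
begin

text \<open>
  A product of such grids with about \<open>n powr (1/d) / 2\<close> points on each half axis.
\<close>

lemma grid_quantizer:
  obtains K where "0 < K"
    "\<And>n. 1 \<le> n \<Longrightarrow> \<exists>\<beta>. quantizer n \<beta> \<and>
      (\<forall>x. set_dist N x \<beta> \<le> K * (1 + norm x)\<^sup>2 * mesh CARD('d) n)"
proof -
  define K where "K = B * (real CARD('d) * 4)"
  have "\<exists>\<beta>. quantizer n \<beta> \<and> (\<forall>x. set_dist N x \<beta> \<le> K * (1 + norm x)\<^sup>2 * mesh CARD('d) n)"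
    if n: "1 \<le> n" for n
  proof -
    define t where "t = real n powr (1 / real CARD('d))"
    have t1: "1 \<le> t" using n unfolding t_def by (simp add: ge_one_powr_ge_zero)
    have tn: "t ^ CARD('d) = real n" using n unfolding t_def by (subst powr_power) auto
    have mt: "mesh CARD('d) n = 1 / t" unfolding mesh_def t_def
      by (simp add: powr_minus_divide)
    (* Largest M with 2 * M - 1 \<le> t, so that (2 * M - 1) ^ d \<le> n. *)
    define M where "M = nat \<lfloor>(t + 1) / 2\<rfloor>"
    have M: "real M \<le> (t + 1) / 2" "(t + 1) / 2 < real M + 1" "0 < M"
    proof -
      have "1 \<le> \<lfloor>(t + 1) / 2\<rfloor>" using t1 by (simp add: le_floor_iff)
      then show "real M \<le> (t + 1) / 2" "(t + 1) / 2 < real M + 1" "0 < M"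
        unfolding M_def by linarith+
    qed
    have Mt: "1 / real M \<le> 4 / t" 
    proof -
      have "1 \<le> real M" using M(3) by simp
      moreover have "t + 1 < 2 * real M + 2" using M(2) by (simp add: field_simps)
      ultimately have "t \<le> 4 * real M" by linarith
      then show ?thesis using t1 M(3) by (simp add: field_simps)
    qed
    obtain G :: "real set" where G: "finite G" "G \<noteq> {}" "card G \<le> 2 * M - 1"
      "\<And>x. \<exists>g\<in>G. \<bar>x - g\<bar> \<le> (1 + \<bar>x\<bar>)\<^sup>2 / real M"
      using real_grid[OF M(3)] by blast
    define \<beta> where "\<beta> = (\<lambda>g. \<chi> i. g i) ` (Pi\<^sub>E (UNIV :: 'd set) (\<lambda>_. G))"
    have fin: "finite (Pi\<^sub>E (UNIV :: 'd set) (\<lambda>_. G))" using G by (intro finite_PiE) auto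
    have "card \<beta> \<le> card (Pi\<^sub>E (UNIV :: 'd set) (\<lambda>_. G))" unfolding \<beta>_def by (rule card_image_le[OF fin])
    also have "\<dots> = card G ^ CARD('d)" by (subst card_PiE) auto
    finally have "real (card \<beta>) \<le> real (card G) ^ CARD('d)" by (metis of_nat_le_iff of_nat_power)
    also have "\<dots> \<le> t ^ CARD('d)" 
    proof (intro power_mono)
      have "card G + 1 \<le> 2 * M" using G(3) M(3) by linarith
      then have "real (card G) + 1 \<le> 2 * real M" by linarith
      also have "\<dots> \<le> t + 1" using M(1) by (simp add: field_simps)
      finally show "real (card G) \<le> t" by simp
    qed simp
    finally have "card \<beta> \<le> n" using tn by simp
    moreover have "finite \<beta>" "\<beta> \<noteq> {}" unfolding \<beta>_def using fin G by (auto simp: PiE_eq_empty_iff)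
    ultimately have q: "quantizer n \<beta>" by (simp add: quantizer_def)
    have "set_dist N x \<beta> \<le> K * (1 + norm x)\<^sup>2 * mesh CARD('d) n" for x
    proof -
      have "\<forall>i. \<exists>t. t \<in> G \<and> \<bar>x $ i - t\<bar> \<le> (1 + \<bar>x $ i\<bar>)\<^sup>2 / real M"
        using G(4) by blast
      then obtain g where g: "\<And>i. g i \<in> G" "\<And>i. \<bar>x $ i - g i\<bar> \<le> (1 + \<bar>x $ i\<bar>)\<^sup>2 / real M"
        unfolding choice_iff by blast
      have "(\<chi> i. g i) \<in> \<beta>" unfolding \<beta>_def using g by (intro imageI) auto
      then have "set_dist N x \<beta> \<le> N (x - (\<chi> i. g i))" by (intro set_dist_le \<open>finite \<beta>\<close>)
      also have "\<dots> \<le> B * norm (x - (\<chi> i. g i))" by (rule N_le_norm)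
      also have "norm (x - (\<chi> i. g i)) \<le> (\<Sum>i\<in>UNIV. \<bar>x $ i - g i\<bar>)"
        using norm_le_l1_cart[of "x - (\<chi> i. g i)"] by simp
      also have "\<dots> \<le> (\<Sum>i\<in>(UNIV :: 'd set). (1 + norm x)\<^sup>2 * (4 * mesh CARD('d) n))"
      proof (rule sum_mono)
        fix i
        have "\<bar>x $ i - g i\<bar> \<le> (1 + \<bar>x $ i\<bar>)\<^sup>2 * (1 / real M)" using g by simp
        also have "\<dots> \<le> (1 + norm x)\<^sup>2 * (4 * mesh CARD('d) n)"
          using Mt component_le_norm_cart[of x i] by (intro mult_mono power_mono) (auto simp: mt)
        finally show "\<bar>x $ i - g i\<bar> \<le> (1 + norm x)\<^sup>2 * (4 * mesh CARD('d) n)" .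
      qed
      finally show ?thesis using B_pos by (simp add: K_def mult_ac)
    qed
    then show ?thesis using q by blast
  qed
  moreover have "0 < K" using B_pos by (simp add: K_def)
  ultimately show thesis using that by blast
qed

text \<open>
  Balls of radius \<open>\<kappa> * mesh d n\<close> around \<open>n\<close> points fill at most half of the unit cube if \<open>\<kappa>\<close> is small; this
  bounds the normalized error from below. The one-point quantizer \<open>{0}\<close> shows finiteness.
\<close>

lemma J_const_pos_finite:
  assumes r: "0 < r"
  shows "0 < J_const N r" "J_const N r < \<infinity>"
proof -
  define S :: "(real ^ 'd) set" where "S = {x. \<forall>i. 0 \<le> x $ i \<and> x $ i \<le> 1}"
  have S: "S = cbox 0 1" unfolding S_def by (auto simp: mem_box_cart)
  have eS: "emeasure lborel S = 1" unfolding S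
    by (subst emeasure_lborel_cbox) (auto simp: Basis_vec_def inner_axis intro!: prod.neutral)
  have Sb[measurable]: "S \<in> sets borel" and bS: "bounded S" unfolding S by (auto intro: bounded_cbox)
  define U where "U = uniform_measure lborel S"
  have sU: "sets U = sets borel" unfolding U_def by simp
  have J: "J_const N r = (INF n\<in>{1..}. ennreal (real n powr (r / real CARD('d))) * opt_distortion N r U n)"
    unfolding J_const_def U_def S_def ..
  let ?V = "ball_vol TYPE('d)"
  define \<kappa> where "\<kappa> = A * root CARD('d) (1 / (2 * ?V))"
  have V: "0 < ?V" "?V \<noteq> 0" using unit_ball_vol_pos[of "real CARD('d)"] by (simp, linarith)
  have \<kappa>: "0 < \<kappa>" "?V * (\<kappa> / A) ^ CARD('d) = 1 / 2"
    using A_pos by (auto simp: \<kappa>_def V(2))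
  have low: "ennreal (\<kappa> powr r / 2) \<le> ennreal (real n powr (r / real CARD('d))) * opt_distortion N r U n"
    if n: "n \<in> {1..}" for n
  proof -
    have n1: "0 < n" using n by simp
    have "ennreal (real n powr (- r / real CARD('d)) * (\<kappa> powr r / 2)) \<le> opt_distortion N r U n"
      unfolding opt_distortion_def
    proof (rule INF_greatest)
      fix \<alpha> :: "(real ^ 'd) set" assume "\<alpha> \<in> {\<alpha>. quantizer n \<alpha>}"
      then have \<alpha>: "finite \<alpha>" "\<alpha> \<noteq> {}" "card \<alpha> \<le> n" by (auto simp: quantizer_def)
      let ?\<rho> = "\<kappa> * mesh CARD('d) n"
      let ?G = "{x \<in> S. \<forall>a\<in>\<alpha>. ?\<rho> < N (x - a)}"
      have \<rho>: "0 \<le> ?\<rho>" using \<kappa> mesh_pos[OF n1, of "CARD('d)"] by simp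
      have G: "?G \<in> sets borel"
      proof -
        have "?G = S \<inter> {x. ?\<rho> < set_dist N x \<alpha>}"
          using \<alpha> by (auto simp: less_set_dist_iff)
        moreover have "{x. ?\<rho> < set_dist N x \<alpha>} \<in> sets borel" using \<alpha> by measurable
        ultimately show ?thesis by auto
      qed
      have "(\<Sum>a\<in>\<alpha>. ?V * (?\<rho> / A) ^ CARD('d)) = real (card \<alpha>) * ((?V * (\<kappa> / A) ^ CARD('d)) * mesh CARD('d) n ^ CARD('d))"
        by (simp add: power_mult_distrib power_divide)
      also have "\<dots> \<le> 1 / 2" 
        unfolding \<kappa> using \<alpha> n1 by (simp add: mesh_power)
      finally have "1 / 2 \<le> vol ?G"
        using vol_far_from_finite[OF \<alpha>(1) Sb bS, of "\<lambda>_. ?\<rho>"] \<rho> eS by (simp add: measure_def)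
      then have "ennreal (1 / 2) \<le> ennreal (vol ?G)" by (rule ennreal_leI)
      moreover have "emeasure lborel ?G = ennreal (vol ?G)"
        using G bS by (intro emeasure_eq_measure2 fmeasurable_bounded_borel) (auto intro: bounded_subset)
      ultimately have "ennreal (1 / 2) \<le> emeasure lborel ?G" by (simp only:)
      also have "\<dots> = emeasure U ?G"
      proof -
        have "S \<inter> ?G = ?G" by auto
        then show ?thesis unfolding U_def using G by (subst emeasure_uniform_measure) (auto simp: eS divide_ennreal_def)
      qed
      finally have "ennreal (?\<rho> powr r) * ennreal (1 / 2) \<le> ennreal (?\<rho> powr r) * emeasure U ?G"
        by (intro mult_left_mono) auto
      also have "\<dots> \<le> distortion N r U \<alpha>"
        using \<alpha> \<rho> r G by (intro distortion_ge[OF sU]) (auto simp: set_dist_ge_iff less_imp_le)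
      also have "ennreal (?\<rho> powr r) * ennreal (1 / 2) = ennreal (real n powr (- r / real CARD('d)) * (\<kappa> powr r / 2))"
        using \<kappa> by (subst ennreal_mult[symmetric]) (auto simp: powr_mult mesh_def powr_powr mult_ac)
      finally show "ennreal (real n powr (- r / real CARD('d)) * (\<kappa> powr r / 2)) \<le> distortion N r U \<alpha>" .
    qed
    then have "ennreal (real n powr (r / real CARD('d))) * ennreal (real n powr (- r / real CARD('d)) * (\<kappa> powr r / 2))
       \<le> ennreal (real n powr (r / real CARD('d))) * opt_distortion N r U n"
      by (intro mult_left_mono) auto
    moreover have "ennreal (real n powr (r / real CARD('d))) * ennreal (real n powr (- r / real CARD('d)) * (\<kappa> powr r / 2)) = ennreal (\<kappa> powr r / 2)"
      using n1 by (subst ennreal_mult[symmetric]) (auto simp: powr_minus field_simps)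
    ultimately show ?thesis by simp
  qed
  have "0 < ennreal (\<kappa> powr r / 2)" using \<kappa> by simp
  also have "\<dots> \<le> J_const N r" unfolding J by (rule INF_greatest) (rule low)
  finally show "0 < J_const N r" .
  have "J_const N r \<le> ennreal (real 1 powr (r / real CARD('d))) * opt_distortion N r U 1"
    unfolding J by (rule INF_lower) simp
  also have "\<dots> \<le> distortion N r U {0}"
    unfolding opt_distortion_def by (auto intro!: INF_lower simp: quantizer_def)
  also have "\<dots> = (\<integral>\<^sup>+x. ennreal (N x powr r) * indicator S x \<partial>lborel)"
    unfolding distortion_def U_def by (subst nn_integral_uniform_measure) (simp_all add: eS set_dist_def divide_ennreal_def)
  also have "\<dots> \<le> (\<integral>\<^sup>+x. ennreal ((B * real CARD('d)) powr r) * indicator S x \<partial>lborel)"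
  proof (intro nn_integral_mono)
    fix x
    have "N x \<le> B * real CARD('d)" if "x \<in> S"
    proof -
      have "norm x \<le> (\<Sum>i\<in>UNIV. \<bar>x $ i\<bar>)" by (rule norm_le_l1_cart)
      also have "\<dots> \<le> (\<Sum>i\<in>(UNIV :: 'd set). 1)" using that by (intro sum_mono) (auto simp: S_def)
      finally have "B * norm x \<le> B * real CARD('d)" using B_pos by (intro mult_left_mono) auto
      with N_le_norm show ?thesis by (rule order_trans)
    qed
    then show "ennreal (N x powr r) * indicator S x \<le> ennreal ((B * real CARD('d)) powr r) * indicator S x"
      using r by (auto split: split_indicator intro!: ennreal_leI powr_mono2)
  qed
  also have "\<dots> = ennreal ((B * real CARD('d)) powr r)"
    by (subst nn_integral_cmult_indicator) (auto simp: eS)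
  also have "\<dots> < \<infinity>" by simp
  finally show "J_const N r < \<infinity>" .
qed

end

section \<open>Exchanging a point of an optimal quantizer\<close>

text \<open>
  The inequality is strict because the bisectors of a norm such as the maximum norm may have interior:
  closed Voronoi cells can overlap in positive volume, whereas strict cells are always disjoint, and outside
  its strict cell a point can be removed without changing the distance.
\<close>

definition strict_cell :: "(real ^ 'd \<Rightarrow> real) \<Rightarrow> (real ^ 'd) set \<Rightarrow> real ^ 'd \<Rightarrow> (real ^ 'd) set" where
  "strict_cell N \<alpha> a = {x. N (x - a) < set_dist N x (\<alpha> - {a})}"

text \<open>
  A bound for the increase of the distortion when \<open>a\<close> is removed, which neglects that the points of the cell
  already contribute to the distortion.
\<close>

definition cell_cost ::
    "(real ^ 'd \<Rightarrow> real) \<Rightarrow> real \<Rightarrow> (real ^ 'd) measure \<Rightarrow> (real ^ 'd) set \<Rightarrow> real ^ 'd \<Rightarrow> ennreal" where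
  "cell_cost N r P \<alpha> a =
     (\<integral>\<^sup>+x. ennreal (set_dist N x (\<alpha> - {a}) powr r) * indicator (strict_cell N \<alpha> a) x \<partial>P)"

context vector_norm
begin

lemma strict_cell_measurable [measurable]:
  assumes "finite \<alpha>" "\<alpha> - {a} \<noteq> {}"
  shows "strict_cell N \<alpha> a \<in> sets borel"
proof -
  have [measurable]: "(\<lambda>x. set_dist N x (\<alpha> - {a})) \<in> borel_measurable borel"
    using assms by (intro set_dist_measurable) auto
  show ?thesis unfolding strict_cell_def by measurable
qed

lemma set_dist_strict_cell:
  assumes "finite \<alpha>" "\<alpha> - {a} \<noteq> {}" "a \<in> \<alpha>" "x \<in> strict_cell N \<alpha> a"
  shows "set_dist N x \<alpha> = N (x - a)"
proof (rule antisym)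
  show "set_dist N x \<alpha> \<le> N (x - a)" using assms by (intro set_dist_le)
  have "N (x - a) < set_dist N x (\<alpha> - {a})" using assms by (simp add: strict_cell_def)
  then have "\<forall>a'\<in>\<alpha> - {a}. N (x - a) < N (x - a')" using assms by (subst (asm) less_set_dist_iff) auto
  then show "N (x - a) \<le> set_dist N x \<alpha>" using assms
    by (subst set_dist_ge_iff) (auto intro: less_imp_le)
qed

lemma set_dist_outside_strict_cell:
  assumes "finite \<alpha>" "\<alpha> - {a} \<noteq> {}" "a \<in> \<alpha>" "x \<notin> strict_cell N \<alpha> a"
  shows "set_dist N x (\<alpha> - {a}) = set_dist N x \<alpha>"
proof (rule antisym)
  have *: "set_dist N x (\<alpha> - {a}) \<le> N (x - a)" using assms by (simp add: strict_cell_def)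
  have "set_dist N x (\<alpha> - {a}) \<le> N (x - a')" if "a' \<in> \<alpha>" for a'
    using * set_dist_le[of "\<alpha> - {a}" a' x] assms that by (cases "a' = a") auto
  then show "set_dist N x (\<alpha> - {a}) \<le> set_dist N x \<alpha>"
    using assms by (subst set_dist_ge_iff) auto
  show "set_dist N x \<alpha> \<le> set_dist N x (\<alpha> - {a})" using assms by (intro set_dist_antimono) auto
qed

lemma strict_cells_disjoint:
  assumes "finite \<alpha>" "a \<in> \<alpha>" "a' \<in> \<alpha>" "a \<noteq> a'"
  shows "strict_cell N \<alpha> a \<inter> strict_cell N \<alpha> a' = {}"
proof -
  have False if "x \<in> strict_cell N \<alpha> a" "x \<in> strict_cell N \<alpha> a'" for x
    using that assms set_dist_le[of "\<alpha> - {a}" a' x] set_dist_le[of "\<alpha> - {a'}" a x]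
    by (simp add: strict_cell_def)
  then show ?thesis by blast
qed

text \<open>
  This confines a cell to a ball as soon as it contains no point of the bounding sphere.
\<close>

lemma strict_cell_star_shaped:
  assumes "finite \<alpha>" "\<alpha> - {a} \<noteq> {}" "x \<in> strict_cell N \<alpha> a" "0 \<le> t" "t \<le> 1"
  shows "a + t *\<^sub>R (x - a) \<in> strict_cell N \<alpha> a"
proof -
  let ?z = "a + t *\<^sub>R (x - a)"
  have za: "N (?z - a) = t * N (x - a)" using assms N_scale[of t "x - a"] by simp
  have "x - ?z = (1 - t) *\<^sub>R (x - a)" by (simp add: algebra_simps)
  then have xz: "N (x - ?z) = (1 - t) * N (x - a)" using assms N_scale[of "1 - t" "x - a"] by simp
  have "N (x - a) < set_dist N x (\<alpha> - {a})" using assms by (simp add: strict_cell_def)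
  also have "\<dots> \<le> set_dist N ?z (\<alpha> - {a}) + N (x - ?z)" using assms by (intro set_dist_lipschitz) auto
  finally have "N (?z - a) < set_dist N ?z (\<alpha> - {a})" unfolding za xz left_diff_distrib by simp
  then show ?thesis unfolding strict_cell_def by blast
qed

text \<open>
  Replace \<open>a\<close> by \<open>y\<close>. Within \<open>b * D\<close> of \<open>y\<close>, where \<open>D\<close> is the distance from \<open>y\<close> to \<open>\<alpha>\<close>, the distance drops
  from at least \<open>(1 - b) * D\<close> to at most \<open>b * D\<close>; elsewhere it grows only on the cell of \<open>a\<close>, by at most what
  \<open>cell_cost\<close> accounts for. Since \<open>\<alpha>\<close> is optimal, the gain cannot exceed the loss.
\<close>

lemma exchange_inequality:
  assumes sets: "sets P = sets borel" and "0 < r"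
    and q: "quantizer n \<alpha>" and opt: "distortion N r P \<alpha> = opt_distortion N r P n"
    and fin: "distortion N r P \<alpha> < \<infinity>"
    and a: "a \<in> \<alpha>" "\<alpha> - {a} \<noteq> {}" and b: "0 < b" "b < 1 / 2"
  shows "ennreal (((1 - b) powr r - b powr r) * set_dist N y \<alpha> powr r) *
      emeasure P {x. N (x - y) \<le> b * set_dist N y \<alpha>} \<le> cell_cost N r P \<alpha> a"
proof -
  let ?\<beta> = "insert y (\<alpha> - {a})"
  define D where "D = set_dist N y \<alpha>"
  define W where "W = {x. N (x - y) \<le> b * D}"
  let ?g = "(1 - b) powr r - b powr r"
  have fa: "finite \<alpha>" "\<alpha> \<noteq> {}" "card \<alpha> \<le> n" using q by (auto simp: quantizer_def)
  have D0: "0 \<le> D" unfolding D_def using fa by (intro set_dist_nonneg)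
  have g0: "0 \<le> ?g" using b \<open>0 < r\<close> powr_mono2[of r b "1 - b"] by simp
  have "card ?\<beta> \<le> n"
    using fa a card_insert_le_m1[of n "\<alpha> - {a}" y] card_Diff_singleton[of a \<alpha>] card_gt_0_iff[of \<alpha>]
    by (auto simp: card_insert_if)
  then have "quantizer n ?\<beta>" using fa by (auto simp: quantizer_def)
  then have le: "distortion N r P \<alpha> \<le> distortion N r P ?\<beta>"
    unfolding opt opt_distortion_def by (intro INF_lower) auto
  have W: "W \<in> sets borel" unfolding W_def by measurable
  note [measurable_cong] = sets
  have [measurable]: "W \<in> sets P" "strict_cell N \<alpha> a \<in> sets P" using W a fa sets by auto
  have mb: "(\<lambda>x. set_dist N x \<beta>) \<in> borel_measurable P" if "finite \<beta>" "\<beta> \<noteq> {}" for \<beta>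
    using set_dist_measurable[OF that] by (simp add: measurable_def sets sets_eq_imp_space_eq[OF sets])
  have [measurable]: "(\<lambda>x. set_dist N x \<alpha>) \<in> borel_measurable P"
    "(\<lambda>x. set_dist N x (\<alpha> - {a})) \<in> borel_measurable P"
    "(\<lambda>x. set_dist N x ?\<beta>) \<in> borel_measurable P"
    using fa a by (auto intro!: mb)
  have pointwise: "ennreal (set_dist N x ?\<beta> powr r) + ennreal (?g * D powr r) * indicator W x
      \<le> ennreal (set_dist N x \<alpha> powr r) +
        ennreal (set_dist N x (\<alpha> - {a}) powr r) * indicator (strict_cell N \<alpha> a) x" for x
  proof (cases "x \<in> W")
    case True
    then have xy: "N (x - y) \<le> b * D" by (simp add: W_def)
    have "set_dist N x ?\<beta> \<le> N (x - y)" using fa by (intro set_dist_le) auto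
    then have "set_dist N x ?\<beta> powr r \<le> (b * D) powr r"
      using xy fa \<open>0 < r\<close> by (intro powr_mono2 set_dist_nonneg) auto
    moreover have "D \<le> set_dist N x \<alpha> + N (x - y)"
      unfolding D_def using set_dist_lipschitz[OF fa(1,2), of y x] N_minus_commute[of x y] by simp
    then have "(1 - b) * D \<le> set_dist N x \<alpha>" using xy by (simp add: algebra_simps)
    then have "((1 - b) * D) powr r \<le> set_dist N x \<alpha> powr r"
      using D0 b \<open>0 < r\<close> by (intro powr_mono2 mult_nonneg_nonneg) auto
    moreover have "((1 - b) * D) powr r = (1 - b) powr r * D powr r" "(b * D) powr r = b powr r * D powr r"
      using b D0 by (simp_all add: powr_mult)
    ultimately have "set_dist N x ?\<beta> powr r + ?g * D powr r \<le> set_dist N x \<alpha> powr r"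
      unfolding left_diff_distrib by linarith
    moreover have "ennreal (set_dist N x ?\<beta> powr r) + ennreal (?g * D powr r)
        = ennreal (set_dist N x ?\<beta> powr r + ?g * D powr r)"
      using g0 by (intro ennreal_plus[symmetric]) auto
    ultimately have "ennreal (set_dist N x ?\<beta> powr r) + ennreal (?g * D powr r) \<le> ennreal (set_dist N x \<alpha> powr r)"
      by (simp only: ennreal_leI)
    then show ?thesis using True by (simp add: add_increasing2)
  next
    case False
    have "set_dist N x ?\<beta> \<le> set_dist N x (\<alpha> - {a})" using fa a by (intro set_dist_antimono) auto
    then have *: "ennreal (set_dist N x ?\<beta> powr r) \<le> ennreal (set_dist N x (\<alpha> - {a}) powr r)"
      using fa \<open>0 < r\<close> by (intro ennreal_leI powr_mono2 set_dist_nonneg) auto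
    show ?thesis
    proof (cases "x \<in> strict_cell N \<alpha> a")
      case True
      then show ?thesis using False * by (simp add: add_increasing)
    next
      case xc: False
      then show ?thesis using False * set_dist_outside_strict_cell[OF fa(1) a(2,1) xc] by simp
    qed
  qed
  have "distortion N r P \<alpha> + ennreal (?g * D powr r) * emeasure P W
      \<le> distortion N r P ?\<beta> + ennreal (?g * D powr r) * emeasure P W"
    using le by (intro add_right_mono)
  also have "\<dots> = (\<integral>\<^sup>+x. ennreal (set_dist N x ?\<beta> powr r) + ennreal (?g * D powr r) * indicator W x \<partial>P)"
    unfolding distortion_def by (subst nn_integral_add) (auto simp: nn_integral_cmult_indicator)
  also have "\<dots> \<le> (\<integral>\<^sup>+x. ennreal (set_dist N x \<alpha> powr r) +
        ennreal (set_dist N x (\<alpha> - {a}) powr r) * indicator (strict_cell N \<alpha> a) x \<partial>P)"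
    by (intro nn_integral_mono pointwise)
  also have "\<dots> = distortion N r P \<alpha> + cell_cost N r P \<alpha> a"
    unfolding distortion_def cell_cost_def by (subst nn_integral_add) auto
  finally show ?thesis
    using fin unfolding D_def W_def by (auto simp: ennreal_add_left_cancel_le less_top)
qed

end

section \<open>Gaussian integrals\<close>

text \<open>
  The integral is the product of the one-dimensional integrals along the axes.
\<close>

lemma nn_integral_exp_norm_finite:
  assumes t: "0 < t"
  shows "(\<integral>\<^sup>+x. ennreal (exp (- t * (norm (x :: real ^ 'd))\<^sup>2)) \<partial>lborel) < \<infinity>"
proof -
  define I where "I = (\<integral>\<^sup>+x. ennreal (exp (- t * (x :: real)\<^sup>2)) \<partial>lborel)"
  define \<sigma> where "\<sigma> = 1 / sqrt (2 * t)"
  have \<sigma>: "0 < \<sigma>" "\<sigma>\<^sup>2 = 1 / (2 * t)" using t by (auto simp: \<sigma>_def power_divide)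
  have eq: "exp (- t * x\<^sup>2) = sqrt (2 * pi * \<sigma>\<^sup>2) * normal_density 0 \<sigma> x" for x
    using \<sigma> t by (simp add: normal_density_def)
  have int: "integrable lborel (\<lambda>x. exp (- t * x\<^sup>2))"
    unfolding eq by (intro integrable_mult_right integrable_normal_density \<sigma>(1))
  have "I = ennreal (\<integral>x. exp (- t * x\<^sup>2) \<partial>lborel)"
    unfolding I_def by (rule nn_integral_eq_integral) (use int in simp_all)
  then have I: "I < \<infinity>" by simp
  have "(norm x)\<^sup>2 = (\<Sum>b\<in>Basis. (x \<bullet> b)\<^sup>2)" for x :: "real ^ 'd"
    using euclidean_inner[of x x] by (simp only: power2_norm_eq_inner power2_eq_square[symmetric])
  then have "(\<integral>\<^sup>+x. ennreal (exp (- t * (norm (x :: real ^ 'd))\<^sup>2)) \<partial>lborel)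
    = (\<integral>\<^sup>+x. (\<Prod>b\<in>Basis. ennreal (exp (- t * (x \<bullet> b)\<^sup>2))) \<partial>(lborel :: (real ^ 'd) measure))"
    by (simp add: prod_ennreal exp_sum sum_distrib_left)
  also have "\<dots> = (\<Prod>b\<in>(Basis :: (real ^ 'd) set). I)"
    unfolding I_def by (subst nn_integral_lborel_prod) auto
  also have "\<dots> < \<infinity>" using I by (simp add: power_less_top_ennreal)
  finally show ?thesis .
qed

text \<open>
  These are the properties of \<open>x \<bullet> (M *v x)\<close> for a positive definite \<open>M\<close> that the analysis of the
  density depends on. \<open>q_add\<close> is Young's inequality in a form that needs no associated bilinear form.
\<close>

locale quad_form =
  fixes q :: "real ^ 'd \<Rightarrow> real" and lam Lam :: real
  assumes lam_pos: "0 < lam"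
    and q_lower: "lam * (norm x)\<^sup>2 \<le> q x"
    and q_upper: "q x \<le> Lam * (norm x)\<^sup>2"
    and q_scale: "q (c *\<^sub>R x) = c\<^sup>2 * q x"
    and q_add: "0 < \<epsilon> \<Longrightarrow> q (x + y) \<le> (1 + \<epsilon>) * q x + (1 + 1 / \<epsilon>) * q y"
    and q_cont: "continuous_on UNIV q"
begin

lemma q_nonneg: "0 \<le> q x"
  using q_lower[of x] lam_pos by (meson order_trans mult_nonneg_nonneg less_imp_le zero_le_power2)

lemma q_measurable [measurable]: "q \<in> borel_measurable borel"
  by (rule borel_measurable_continuous_onI) (rule q_cont)

lemma Lam_pos: "0 < Lam"
proof -
  obtain i :: 'd where True by simp
  have "lam * (norm (axis i 1 :: real ^ 'd))\<^sup>2 \<le> Lam * (norm (axis i 1 :: real ^ 'd))\<^sup>2"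
    using q_lower q_upper order_trans by blast
  then show ?thesis using lam_pos by (simp add: norm_axis_1)
qed

lemma norm_sq_le: "(norm x)\<^sup>2 \<le> 2 * (norm m)\<^sup>2 + 2 / lam * q (x - m)"
proof -
  have "(norm x)\<^sup>2 \<le> (norm (x - m) + norm m)\<^sup>2"
    using norm_triangle_ineq[of "x - m" m] by (intro power_mono) auto
  also have "\<dots> \<le> 2 * (norm m)\<^sup>2 + 2 * (norm (x - m))\<^sup>2"
    using sum_squares_bound[of "norm (x - m)" "norm m"] by (simp add: power2_sum)
  also have "(norm (x - m))\<^sup>2 \<le> q (x - m) / lam"
    using q_lower[of "x - m"] lam_pos by (simp add: field_simps)
  finally show ?thesis by simp
qed

lemma nn_integral_exp_q_finite:
  assumes t: "0 < t"
  shows "(\<integral>\<^sup>+x. ennreal (exp (- t * q (x - m))) \<partial>lborel) < \<infinity>"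
proof -
  let ?u = "t * lam / 2"
  have "(\<integral>\<^sup>+x. ennreal (exp (- t * q (x - m))) \<partial>lborel)
      \<le> (\<integral>\<^sup>+x. ennreal (exp (t * lam * (norm m)\<^sup>2)) * ennreal (exp (- ?u * (norm (x :: real ^ 'd))\<^sup>2)) \<partial>lborel)"
  proof (intro nn_integral_mono)
    fix x
    have "?u * (norm x)\<^sup>2 \<le> ?u * (2 * (norm m)\<^sup>2 + 2 / lam * q (x - m))"
      using t lam_pos by (intro mult_left_mono norm_sq_le) auto
    also have "\<dots> = t * lam * (norm m)\<^sup>2 + t * q (x - m)" using lam_pos by (simp add: field_simps)
    finally have "exp (- t * q (x - m)) \<le> exp (t * lam * (norm m)\<^sup>2 + (- ?u * (norm x)\<^sup>2))"
      by (subst exp_le_cancel_iff) (simp add: algebra_simps)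
    then show "ennreal (exp (- t * q (x - m)))
        \<le> ennreal (exp (t * lam * (norm m)\<^sup>2)) * ennreal (exp (- ?u * (norm x)\<^sup>2))"
      by (subst ennreal_mult[symmetric]) (auto simp: exp_add[symmetric] intro!: ennreal_leI)
  qed
  also have "\<dots> = ennreal (exp (t * lam * (norm m)\<^sup>2)) * (\<integral>\<^sup>+x. ennreal (exp (- ?u * (norm (x :: real ^ 'd))\<^sup>2)) \<partial>lborel)"
    by (rule nn_integral_cmult) simp
  also have "\<dots> < \<infinity>"
    using nn_integral_exp_norm_finite[of ?u, where 'd='d] t lam_pos by (simp add: ennreal_mult_less_top)
  finally show ?thesis .
qed

lemma nn_integral_exp_q_pos: "0 < (\<integral>\<^sup>+x. ennreal (exp (- t * q (x - m))) \<partial>lborel)"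
proof (rule ccontr)
  assume "\<not> ?thesis"
  then have "AE x in lborel. ennreal (exp (- t * q (x - m))) = 0"
    by (subst nn_integral_0_iff_AE[symmetric]) auto
  then have "AE x in (lborel :: (real ^ 'd) measure). False" by simp
  then show False by (simp add: AE_iff_null null_sets_def)
qed

text \<open>
  Dilate by \<open>1 / sqrt t\<close> around \<open>m\<close>.
\<close>

lemma nn_integral_exp_q_scale:
  assumes t: "0 < t"
  shows "(\<integral>\<^sup>+x. ennreal (exp (- t * q (x - m))) \<partial>lborel)
    = ennreal (t powr (- real CARD('d) / 2)) * (\<integral>\<^sup>+x. ennreal (exp (- q (x - m))) \<partial>lborel)"
proof -
  have s: "0 < 1 / sqrt t" using t by simp
  have "(1 / sqrt t) ^ CARD('d) = (t powr (- 1 / 2)) powr real CARD('d)"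
    using t by (simp add: powr_minus_divide powr_half_sqrt powr_realpow)
  also have "\<dots> = t powr (- real CARD('d) / 2)" by (simp add: powr_powr)
  finally have p: "(1 / sqrt t) ^ CARD('d) = t powr (- real CARD('d) / 2)" .
  have e: "t * q (m + (1 / sqrt t) *\<^sub>R (x - m) - m) = q (x - m)" for x
    using t q_scale[of "1 / sqrt t" "x - m"] by (simp add: power_divide)
  show ?thesis
    using nn_integral_lborel_dilate[OF s, of "\<lambda>x. ennreal (exp (- t * q (x - m)))" m] e
    unfolding p by simp
qed

text \<open>The polynomial factor is at most a constant times \<open>exp (t / 2 * q (x - m))\<close>.\<close>

lemma nn_integral_poly_exp_q_finite:
  assumes t: "0 < t" and r: "0 < r"
  shows "(\<integral>\<^sup>+x. ennreal (((1 + norm x)\<^sup>2) powr r * exp (- t * q (x - m))) \<partial>lborel) < \<infinity>"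
proof -
  define \<delta> where "\<delta> = min 1 (t * lam / (4 * r))"
  have \<delta>: "0 < \<delta>" "\<delta> \<le> 1" "\<delta> \<le> t * lam / (4 * r)" using t r lam_pos by (auto simp: \<delta>_def)
  define K where "K = (2 / \<delta>) powr r * exp (r * \<delta> * (2 * (norm m)\<^sup>2))"
  have le: "((1 + norm x)\<^sup>2) powr r * exp (- t * q (x - m)) \<le> K * exp (- (t / 2) * q (x - m))" for x
  proof -
    have "(1 + norm x)\<^sup>2 \<le> 2 * (1 + (norm x)\<^sup>2)"
      using sum_squares_bound[of 1 "norm x"] by (simp add: power2_sum)
    also have "\<dots> \<le> 2 * ((1 + \<delta> * (norm x)\<^sup>2) / \<delta>)"
      using \<delta> by (intro mult_left_mono) (auto simp: field_simps)
    also have "\<dots> \<le> 2 * (exp (\<delta> * (norm x)\<^sup>2) / \<delta>)"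
      using \<delta> by (intro mult_left_mono divide_right_mono exp_ge_add_one_self) auto
    finally have "((1 + norm x)\<^sup>2) powr r \<le> ((2 / \<delta>) * exp (\<delta> * (norm x)\<^sup>2)) powr r"
      using r by (intro powr_mono2) auto
    also have "\<dots> = (2 / \<delta>) powr r * exp (r * \<delta> * (norm x)\<^sup>2)"
      using \<delta> by (subst powr_mult) (auto simp: exp_powr_real mult_ac)
    also have "\<dots> \<le> (2 / \<delta>) powr r * exp (r * \<delta> * (2 * (norm m)\<^sup>2) + (t / 2) * q (x - m))"
    proof -
      have "r * \<delta> * (norm x)\<^sup>2 \<le> r * \<delta> * (2 * (norm m)\<^sup>2 + 2 / lam * q (x - m))"
        using r \<delta> by (intro mult_left_mono norm_sq_le) auto
      also have "\<dots> = r * \<delta> * (2 * (norm m)\<^sup>2) + (r * \<delta> * (2 / lam)) * q (x - m)"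
        by (simp add: algebra_simps)
      also have "\<dots> \<le> r * \<delta> * (2 * (norm m)\<^sup>2) + (t / 2) * q (x - m)"
        using \<delta>(3) r lam_pos by (intro add_left_mono mult_right_mono q_nonneg) (simp add: field_simps)
      finally show ?thesis by (intro mult_left_mono) auto
    qed
    finally have "((1 + norm x)\<^sup>2) powr r * exp (- t * q (x - m))
        \<le> (2 / \<delta>) powr r * exp (r * \<delta> * (2 * (norm m)\<^sup>2) + (t / 2) * q (x - m)) * exp (- t * q (x - m))"
      by (rule mult_right_mono) simp
    also have "\<dots> = K * exp (- (t / 2) * q (x - m))"
      unfolding K_def by (simp add: exp_add[symmetric] mult.assoc algebra_simps)
    finally show ?thesis .
  qed
  have K0: "0 \<le> K" by (simp add: K_def)
  have "(\<integral>\<^sup>+x. ennreal (((1 + norm x)\<^sup>2) powr r * exp (- t * q (x - m))) \<partial>lborel)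
      \<le> (\<integral>\<^sup>+x. ennreal K * ennreal (exp (- (t / 2) * q (x - m))) \<partial>lborel)"
    using le K0 by (intro nn_integral_mono) (auto simp: ennreal_mult[symmetric] intro!: ennreal_leI)
  also have "\<dots> = ennreal K * (\<integral>\<^sup>+x. ennreal (exp (- (t / 2) * q (x - m))) \<partial>lborel)"
    by (rule nn_integral_cmult) simp
  also have "\<dots> < \<infinity>"
    using nn_integral_exp_q_finite[of "t / 2" m] t by (simp add: ennreal_mult_less_top)
  finally show ?thesis .
qed

text \<open>
  In the tail the ball of radius \<open>b * D n y\<close> around \<open>y\<close> may have a radius proportional to \<open>2 + norm y\<close>. For
  small \<open>b\<close> the variation of \<open>q\<close> on it is still dominated by \<open>\<epsilon> * q y\<close>, up to a constant.
\<close>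

lemma q_perturb:
  assumes \<epsilon>: "0 < \<epsilon>" and k: "0 < k"
  obtains b K where "0 < b" "b \<le> 1 / 4"
    "\<And>y z. norm (z - y) \<le> b * k * (2 + norm y) \<Longrightarrow> q z \<le> (1 + \<epsilon>) * q y + K"
proof -
  define e where "e = \<epsilon> / 2"
  define M where "M = (1 + 1 / e) * Lam"
  define b where "b = min (1 / 4) (sqrt (e * lam / (2 * M)) / k)"
  have e: "0 < e" using \<epsilon> by (simp add: e_def)
  have M: "0 < M" using e Lam_pos by (simp add: M_def add_pos_pos)
  have b: "0 < b" using e M k lam_pos by (simp add: b_def)
  have b4: "b \<le> 1 / 4" unfolding b_def by (rule min.cobounded1)
  have "b * k \<le> sqrt (e * lam / (2 * M))" 
  proof -
    have "b \<le> sqrt (e * lam / (2 * M)) / k" unfolding b_def by (rule min.cobounded2)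
    then show ?thesis using k by (simp add: pos_le_divide_eq)
  qed
  then have "(b * k)\<^sup>2 \<le> (sqrt (e * lam / (2 * M)))\<^sup>2" using b k by (intro power_mono) auto
  then have bk: "(b * k)\<^sup>2 \<le> e * lam / (2 * M)" using e M lam_pos by simp
  have "q z \<le> (1 + \<epsilon>) * q y + 4 * e * lam" if zy: "norm (z - y) \<le> b * k * (2 + norm y)" for y z
  proof -
    have "(norm (z - y))\<^sup>2 \<le> (b * k * (2 + norm y))\<^sup>2" using zy by (intro power_mono) auto
    also have "\<dots> = (b * k)\<^sup>2 * (2 + norm y)\<^sup>2" by (simp add: power_mult_distrib)
    also have "\<dots> \<le> e * lam / (2 * M) * (8 + 2 * (norm y)\<^sup>2)"
      using sum_squares_bound[of 2 "norm y"] e M lam_pos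
      by (intro mult_mono bk) (auto simp: power2_sum)
    finally have n2: "(norm (z - y))\<^sup>2 \<le> e * lam / (2 * M) * (8 + 2 * (norm y)\<^sup>2)" .
    have "q z = q (y + (z - y))" by simp
    also have "\<dots> \<le> (1 + e) * q y + (1 + 1 / e) * q (z - y)" by (rule q_add[OF e])
    also have "(1 + 1 / e) * q (z - y) \<le> (1 + 1 / e) * (Lam * (norm (z - y))\<^sup>2)"
      using e by (intro mult_left_mono q_upper) auto
    also have "\<dots> = M * (norm (z - y))\<^sup>2" by (simp add: M_def)
    also have "\<dots> \<le> M * (e * lam / (2 * M) * (8 + 2 * (norm y)\<^sup>2))"
      using M by (intro mult_left_mono n2) auto
    also have "\<dots> = 4 * e * lam + e * (lam * (norm y)\<^sup>2)" using M by (simp add: field_simps)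
    also have "\<dots> \<le> 4 * e * lam + e * q y" using e by (intro add_left_mono mult_left_mono q_lower) auto
    finally have "q z \<le> (1 + e) * q y + (4 * e * lam + e * q y)" by simp
    then show ?thesis by (simp add: e_def algebra_simps)
  qed
  with b b4 show thesis by (rule that)
qed

lemma q_locally_uniform:
  obtains \<delta> where "0 < \<delta>" "\<delta> \<le> 1"
    "\<And>x y. norm (y - m) \<le> R \<Longrightarrow> norm (x - y) \<le> \<delta> \<Longrightarrow> \<bar>q (x - m) - q (y - m)\<bar> \<le> 1"
proof -
  have "uniformly_continuous_on (cball 0 (R + 1)) q"
    by (intro compact_uniformly_continuous continuous_on_subset[OF q_cont]) auto
  then obtain \<delta> where \<delta>: "0 < \<delta>"
    "\<And>x y. x \<in> cball 0 (R + 1) \<Longrightarrow> y \<in> cball 0 (R + 1) \<Longrightarrow> dist y x < \<delta> \<Longrightarrow> dist (q y) (q x) < 1"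
    unfolding uniformly_continuous_on_def by (metis zero_less_one)
  have "\<bar>q (x - m) - q (y - m)\<bar> \<le> 1" if "norm (y - m) \<le> R" "norm (x - y) \<le> min 1 (\<delta> / 2)" for x y
  proof -
    have "norm (x - m) \<le> R + 1" using that norm_triangle_ineq[of "x - y" "y - m"] by simp
    then have "dist (q (x - m)) (q (y - m)) < 1"
      using that \<delta>(1) by (intro \<delta>(2)) (auto simp: dist_norm norm_minus_commute)
    then show ?thesis by (simp add: dist_real_def)
  qed
  then show thesis using \<delta>(1) by (intro that[of "min 1 (\<delta> / 2)"]) auto
qed

end

section \<open>Optimal quantizers of a Gaussian density\<close>

lemma powr_add_le:
  fixes x y r :: real
  assumes "0 \<le> x" "0 \<le> y" "0 < r"
  shows "(x + y) powr r \<le> 2 powr r * (x powr r + y powr r)"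
proof -
  have "(x + y) powr r \<le> (2 * max x y) powr r" using assms by (intro powr_mono2) auto
  also have "\<dots> = 2 powr r * max x y powr r" using assms by (subst powr_mult) auto
  also have "max x y powr r \<le> x powr r + y powr r" by (auto simp: max_def)
  finally show ?thesis by simp
qed

text \<open>
  Solves an estimate for \<open>x powr p\<close>, with \<open>p = r + d\<close> in the applications, for \<open>x\<close>.
\<close>

lemma root_bound:
  fixes x h p w M u :: real
  assumes "0 < p" "0 \<le> x" "0 < h" "0 < w" "0 \<le> M"
    and le: "w * exp (- u) * x powr p \<le> M * h powr p"
  shows "x \<le> (M / w) powr (1 / p) * exp (u / p) * h"
proof -
  let ?y = "(M / w) powr (1 / p) * exp (u / p) * h"
  have "?y powr p = ((M / w) powr (1 / p)) powr p * exp (u / p) powr p * h powr p"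
    using assms by (simp add: powr_mult)
  also have "((M / w) powr (1 / p)) powr p = M / w" using assms by (simp add: powr_powr)
  also have "exp (u / p) powr p = exp u" using assms by (simp add: exp_powr_real)
  finally have y: "?y powr p = M / w * exp u * h powr p" .
  have "x powr p = exp u / w * (w * exp (- u) * x powr p)"
    using assms by (simp add: exp_minus field_simps)
  also have "\<dots> \<le> exp u / w * (M * h powr p)" using assms by (intro mult_left_mono le) auto
  also have "\<dots> = ?y powr p" using y by simp
  finally have *: "x powr p \<le> ?y powr p" .
  show ?thesis
  proof (rule ccontr)
    assume "\<not> ?thesis"
    then have "?y powr p < x powr p" using assms by (intro powr_less_mono2) auto
    with * show False by simp
  qed
qed

text \<open>
  \<open>h\<close> is a parameter because the type \<open>nat \<Rightarrow> real\<close> does not determine the dimension.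
\<close>

locale gaussian_quantizers =
  vector_norm N A B + quad_form q lam Lam
  for N :: "real ^ 'd \<Rightarrow> real" and A B :: real
    and q :: "real ^ 'd \<Rightarrow> real" and lam Lam :: real +
  fixes c\<^sub>0 :: real and m :: "real ^ 'd" and P :: "(real ^ 'd) measure" and r :: real
    and \<alpha> :: "nat \<Rightarrow> (real ^ 'd) set" and h :: "nat \<Rightarrow> real"
  defines "h \<equiv> mesh CARD('d)"
  assumes c\<^sub>0_pos: "0 < c\<^sub>0"
    and r_pos: "0 < r"
    and P_eq: "P = density lborel (\<lambda>x. ennreal (c\<^sub>0 * exp (- q (x - m) / 2)))"
    and optimal: "Lr_optimal N r P \<alpha>"
begin

abbreviation f :: "real ^ 'd \<Rightarrow> real" where
  "f x \<equiv> c\<^sub>0 * exp (- q (x - m) / 2)"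

abbreviation D :: "nat \<Rightarrow> real ^ 'd \<Rightarrow> real" where
  "D n x \<equiv> set_dist N x (\<alpha> n)"

lemma V_pos: "0 < ball_vol TYPE('d)"
  using unit_ball_vol_pos[of "real CARD('d)"] by simp

lemma h_pos: "1 \<le> n \<Longrightarrow> 0 < h n"
  by (simp add: h_def mesh_pos)

lemma h_power: "1 \<le> n \<Longrightarrow> h n ^ CARD('d) = 1 / real n"
  by (simp add: h_def mesh_power)

lemma eventually_h_mult_le:
  assumes "0 < \<delta>" shows "\<forall>\<^sub>F n in sequentially. C * h n \<le> \<delta>"
proof -
  have "(\<lambda>n. C * h n) \<longlonglongrightarrow> C * 0" unfolding h_def by (intro tendsto_intros mesh_tendsto) simp
  then show ?thesis using assms
    by (intro eventually_mono[OF order_tendstoD(2)[of _ "C * 0"]]) auto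
qed

lemma quantizer_\<alpha>: "1 \<le> n \<Longrightarrow> quantizer n (\<alpha> n)"
  using optimal by (auto simp: Lr_optimal_def quantizer_seq_def)

lemma \<alpha>_finite [simp]: "1 \<le> n \<Longrightarrow> finite (\<alpha> n)"
  and \<alpha>_nonempty [simp]: "1 \<le> n \<Longrightarrow> \<alpha> n \<noteq> {}"
  and card_\<alpha>: "1 \<le> n \<Longrightarrow> card (\<alpha> n) \<le> n"
  using quantizer_\<alpha> by (auto simp: quantizer_def)

lemma distortion_\<alpha>: "1 \<le> n \<Longrightarrow> distortion N r P (\<alpha> n) = opt_distortion N r P n"
  using optimal by (auto simp: Lr_optimal_def)

lemma D_nonneg: "1 \<le> n \<Longrightarrow> 0 \<le> D n x"
  by (simp add: set_dist_nonneg)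

lemma sets_P [measurable_cong]: "sets P = sets borel"
  by (simp add: P_eq)

lemma nn_integral_P:
  "g \<in> borel_measurable borel \<Longrightarrow> (\<integral>\<^sup>+x. g x \<partial>P) = (\<integral>\<^sup>+x. ennreal (f x) * g x \<partial>lborel)"
  unfolding P_eq by (rule nn_integral_density) auto

lemma emeasure_P:
  "S \<in> sets borel \<Longrightarrow> emeasure P S = (\<integral>\<^sup>+x. ennreal (f x) * indicator S x \<partial>lborel)"
  unfolding P_eq by (rule emeasure_density) auto

lemma emeasure_P_ge:
  assumes S: "S \<in> sets borel" "bounded S" and le: "\<And>x. x \<in> S \<Longrightarrow> c \<le> f x" and c: "0 \<le> c"
  shows "ennreal (c * vol S) \<le> emeasure P S"
proof -
  have "ennreal (c * vol S) = ennreal c * emeasure lborel S"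
    using S c by (subst emeasure_eq_measure2) (auto simp: ennreal_mult intro!: fmeasurable_bounded_borel)
  also have "\<dots> = (\<integral>\<^sup>+x. ennreal c * indicator S x \<partial>lborel)"
    using S by (subst nn_integral_cmult_indicator) auto
  also have "\<dots> \<le> emeasure P S" unfolding emeasure_P[OF S(1)]
    using le by (intro nn_integral_mono) (auto split: split_indicator intro!: ennreal_leI)
  finally show ?thesis .
qed

lemma emeasure_P_le:
  assumes S: "S \<in> sets borel" "bounded S" and le: "\<And>x. x \<in> S \<Longrightarrow> f x \<le> c" and c: "0 \<le> c"
  shows "emeasure P S \<le> ennreal (c * vol S)"
proof -
  have "emeasure P S \<le> (\<integral>\<^sup>+x. ennreal c * indicator S x \<partial>lborel)" unfolding emeasure_P[OF S(1)]
    using le by (intro nn_integral_mono) (auto split: split_indicator intro!: ennreal_leI)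
  also have "\<dots> = ennreal c * emeasure lborel S"
    using S by (subst nn_integral_cmult_indicator) auto
  also have "\<dots> = ennreal (c * vol S)"
    using S c by (subst emeasure_eq_measure2) (auto simp: ennreal_mult intro!: fmeasurable_bounded_borel)
  finally show ?thesis .
qed

lemma f_ge:
  assumes "norm (x - m) \<le> R" shows "c\<^sub>0 * exp (- Lam * R\<^sup>2 / 2) \<le> f x"
proof -
  have "q (x - m) \<le> Lam * (norm (x - m))\<^sup>2" by (rule q_upper)
  also have "\<dots> \<le> Lam * R\<^sup>2" using assms Lam_pos by (intro mult_left_mono power_mono) auto
  finally show ?thesis using c\<^sub>0_pos by simp
qed

lemma emeasure_P_finite: "emeasure P UNIV < \<infinity>"
proof -
  have "emeasure P UNIV = ennreal c\<^sub>0 * (\<integral>\<^sup>+x. ennreal (exp (- (1 / 2) * q (x - m))) \<partial>lborel)"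
    using c\<^sub>0_pos by (subst emeasure_P) (auto simp: ennreal_mult nn_integral_cmult)
  also have "\<dots> < \<infinity>" using nn_integral_exp_q_finite[of "1 / 2" m] by (simp add: ennreal_mult_less_top)
  finally show ?thesis .
qed

subsection \<open>The order of the optimal error\<close>

lemma distortion_upper:
  obtains C where "0 < C" "\<And>n. 1 \<le> n \<Longrightarrow> distortion N r P (\<alpha> n) \<le> ennreal (C * h n powr r)"
proof -
  obtain K where K: "0 < K"
    "\<And>n. 1 \<le> n \<Longrightarrow> \<exists>\<beta>. quantizer n \<beta> \<and> (\<forall>x. set_dist N x \<beta> \<le> K * (1 + norm x)\<^sup>2 * h n)"
    unfolding h_def using grid_quantizer by blast
  define I where "I = (\<integral>\<^sup>+x. ennreal (((1 + norm x)\<^sup>2) powr r * exp (- (1 / 2) * q (x - m))) \<partial>lborel)"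
  have I: "I < \<infinity>" unfolding I_def using r_pos by (intro nn_integral_poly_exp_q_finite) auto
  define C where "C = c\<^sub>0 * K powr r * enn2real I + 1"
  have "distortion N r P (\<alpha> n) \<le> ennreal (C * h n powr r)" if n: "1 \<le> n" for n
  proof -
    obtain \<beta> where \<beta>: "quantizer n \<beta>" "\<And>x. set_dist N x \<beta> \<le> K * (1 + norm x)\<^sup>2 * h n"
      using K(2)[OF n] by blast
    then have fin: "finite \<beta>" "\<beta> \<noteq> {}" by (auto simp: quantizer_def)
    have "distortion N r P (\<alpha> n) \<le> distortion N r P \<beta>"
      unfolding distortion_\<alpha>[OF n] opt_distortion_def using \<beta> by (intro INF_lower) auto
    also have "\<dots> = (\<integral>\<^sup>+x. ennreal (f x) * ennreal (set_dist N x \<beta> powr r) \<partial>lborel)"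
      unfolding distortion_def using fin by (subst nn_integral_P) auto
    also have "\<dots> \<le> (\<integral>\<^sup>+x. ennreal (c\<^sub>0 * K powr r * h n powr r) *
        ennreal (((1 + norm x)\<^sup>2) powr r * exp (- (1 / 2) * q (x - m))) \<partial>lborel)"
    proof (intro nn_integral_mono)
      fix x
      have "set_dist N x \<beta> powr r \<le> (K * (1 + norm x)\<^sup>2 * h n) powr r"
        using r_pos fin by (intro powr_mono2 \<beta>(2) set_dist_nonneg) auto
      also have "\<dots> = K powr r * ((1 + norm x)\<^sup>2) powr r * h n powr r"
        using K h_pos[OF n] by (simp add: powr_mult)
      finally have "f x * set_dist N x \<beta> powr r \<le> f x * (K powr r * ((1 + norm x)\<^sup>2) powr r * h n powr r)"
        using c\<^sub>0_pos by (intro mult_left_mono) auto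
      also have "\<dots> = (c\<^sub>0 * K powr r * h n powr r) * (((1 + norm x)\<^sup>2) powr r * exp (- (1 / 2) * q (x - m)))"
        by simp
      finally show "ennreal (f x) * ennreal (set_dist N x \<beta> powr r) \<le>
        ennreal (c\<^sub>0 * K powr r * h n powr r) * ennreal (((1 + norm x)\<^sup>2) powr r * exp (- (1 / 2) * q (x - m)))"
        using c\<^sub>0_pos by (subst (1 2) ennreal_mult[symmetric]) (auto intro!: ennreal_leI)
    qed
    also have "\<dots> = ennreal (c\<^sub>0 * K powr r * h n powr r) * I"
      unfolding I_def by (rule nn_integral_cmult) simp
    also have "\<dots> = ennreal (c\<^sub>0 * K powr r * h n powr r) * ennreal (enn2real I)"
      using I by (simp add: less_top)
    also have "\<dots> = ennreal (c\<^sub>0 * K powr r * h n powr r * enn2real I)"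
      using c\<^sub>0_pos by (subst ennreal_mult) auto
    also have "\<dots> \<le> ennreal (C * h n powr r)"
      unfolding C_def by (intro ennreal_leI) (simp add: algebra_simps)
    finally show ?thesis .
  qed
  moreover have "0 < C" unfolding C_def using c\<^sub>0_pos by (simp add: add_nonneg_pos)
  ultimately show thesis using that by blast
qed

lemma distortion_finite: "1 \<le> n \<Longrightarrow> distortion N r P (\<alpha> n) < \<infinity>"
  by (rule distortion_upper) (metis ennreal_less_top infinity_ennreal_def le_less_trans)

subsection \<open>A cell that is cheap to remove\<close>

text \<open>
  By \<open>distortion_upper\<close>, at most half of \<open>cball m 1\<close> lies farther than \<open>R * h n\<close> from the quantizer, for a
  suitable \<open>R\<close>. The other half is covered by balls of volume of order \<open>1 / n\<close> around points in \<open>cball m 2\<close>, so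
  there must be at least \<open>c * n\<close> of them.
\<close>

lemma many_points_near_center:
  obtains c where "0 < c" "\<forall>\<^sub>F n in sequentially. c * real n \<le> real (card (\<alpha> n \<inter> cball m 2))"
proof -
  obtain C where C: "0 < C" "\<And>n. 1 \<le> n \<Longrightarrow> distortion N r P (\<alpha> n) \<le> ennreal (C * h n powr r)"
    using distortion_upper by blast
  define f0 where "f0 = c\<^sub>0 * exp (- Lam * 1\<^sup>2 / 2)"
  have f0: "0 < f0" using c\<^sub>0_pos by (simp add: f0_def)
  (* Chosen such that the estimate R powr r * f0 * vol G \<le> C below yields vol G \<le> vol (cball m 1) / 2. *)
  define R where "R = (2 * C / (f0 * ball_vol TYPE('d))) powr (1 / r)"
  have R: "0 < R" using C f0 V_pos unfolding R_def by simp
  have Rr: "R powr r = 2 * C / (f0 * ball_vol TYPE('d))" using C f0 V_pos r_pos unfolding R_def by (simp add: powr_powr)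
  define c where "c = (A / R) ^ CARD('d) / 2"
  have c: "0 < c" using A_pos R by (simp add: c_def)
  have main: "c * real n \<le> real (card (\<alpha> n \<inter> cball m 2))" if n: "1 \<le> n" and small: "R * h n \<le> A" for n
  proof -
    let ?\<rho> = "R * h n"
    let ?T = "\<alpha> n \<inter> cball m 2"
    let ?G = "{x \<in> cball m 1. \<forall>a\<in>?T. ?\<rho> < N (x - a)}"
    have fin: "finite ?T" using n by simp
    have \<rho>: "0 < ?\<rho>" using R h_pos[OF n] by simp
    have eq: "?G = cball m 1 \<inter> \<Inter> ((\<lambda>a. {x. ?\<rho> < N (x - a)}) ` ?T)" by auto
    have G: "?G \<in> sets borel"
    proof (cases "?T = {}")
      case False
      have "{x. ?\<rho> < N (x - a)} \<in> sets borel" for a by measurable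
      then show ?thesis unfolding eq using fin False by (intro sets.Int sets.finite_INT) auto
    qed (auto simp: Collect_conj_eq)
    have bG: "bounded ?G" by (rule bounded_subset[of "cball m 1"]) auto
    have DG: "?\<rho> \<le> D n x" if "x \<in> ?G" for x
    proof (subst set_dist_ge_iff)
      show "\<forall>a\<in>\<alpha> n. ?\<rho> \<le> N (x - a)"
      proof
        fix a assume a: "a \<in> \<alpha> n"
        show "?\<rho> \<le> N (x - a)"
        proof (cases "a \<in> cball m 2")
          case False
          then have "1 \<le> norm (x - a)" using that dist_triangle[of m a x] by (auto simp: dist_norm)
          then have "A * 1 \<le> A * norm (x - a)" using A_pos by (intro mult_left_mono) auto
          then show ?thesis using norm_le_N[of "x - a"] small by simp
        next
          case True
          then have "?\<rho> < N (x - a)" using that a by blast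
          then show ?thesis by simp
        qed
      qed
    qed (use n in auto)
    have "ennreal (?\<rho> powr r * (f0 * vol ?G)) = ennreal (?\<rho> powr r) * ennreal (f0 * vol ?G)"
      using f0 by (intro ennreal_mult) auto
    also have "\<dots> \<le> ennreal (?\<rho> powr r) * emeasure P ?G"
      using f0 by (intro mult_left_mono emeasure_P_ge[OF G bG])
        (auto simp: f0_def dist_norm norm_minus_commute intro!: f_ge[of _ 1, simplified])
    also have "\<dots> \<le> distortion N r P (\<alpha> n)"
      using \<rho> r_pos by (intro distortion_ge[OF sets_P G] DG) auto
    also have "\<dots> \<le> ennreal (C * h n powr r)" by (rule C(2)[OF n])
    finally have "?\<rho> powr r * (f0 * vol ?G) \<le> C * h n powr r"
      using C(1) by (subst (asm) ennreal_le_iff) auto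
    then have "(R powr r * f0 * vol ?G) * h n powr r \<le> C * h n powr r"
      using R h_pos[OF n] by (simp add: powr_mult mult_ac)
    then have "R powr r * f0 * vol ?G \<le> C" using h_pos[OF n] by simp
    then have G_le: "vol ?G \<le> ball_vol TYPE('d) / 2" unfolding Rr using f0 V_pos C(1) by (simp add: field_simps)
    have "vol (cball m 1) - (\<Sum>a\<in>?T. ball_vol TYPE('d) * (?\<rho> / A) ^ CARD('d)) \<le> vol ?G"
      using \<rho> by (intro vol_far_from_finite[OF fin]) auto
    then have "ball_vol TYPE('d) - real (card ?T) * (ball_vol TYPE('d) * (?\<rho> / A) ^ CARD('d)) \<le> ball_vol TYPE('d) / 2"
      using G_le unfolding vol_cball[OF zero_le_one] sum_constant power_one mult_1_right by linarith
    then have "ball_vol TYPE('d) * (1 / 2) \<le> ball_vol TYPE('d) * (real (card ?T) * (?\<rho> / A) ^ CARD('d))"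
      unfolding mult.left_commute[of "real (card ?T)" "ball_vol TYPE('d)"] by linarith
    then have "1 / 2 \<le> real (card ?T) * (?\<rho> / A) ^ CARD('d)" using V_pos by (simp only: mult_le_cancel_left_pos)
    also have "(?\<rho> / A) ^ CARD('d) = 1 / ((A / R) ^ CARD('d) * real n)"
      using n h_power[OF n] by (simp add: power_mult_distrib power_divide)
    finally have "1 / 2 \<le> real (card ?T) / ((A / R) ^ CARD('d) * real n)" by simp
    then show ?thesis using A_pos R n by (simp add: c_def pos_le_divide_eq)
  qed
  have "\<forall>\<^sub>F n in sequentially. c * real n \<le> real (card (\<alpha> n \<inter> cball m 2))"
    using eventually_h_mult_le[OF A_pos, of R] eventually_ge_at_top[of 1]
    by eventually_elim (rule main)
  with c show thesis by (rule that)
qed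

lemma D_near_center:
  "\<forall>\<^sub>F n in sequentially. \<forall>y. D n y \<le> B * (2 + norm (y - m))"
proof -
  obtain c where c: "0 < c" "\<forall>\<^sub>F n in sequentially. c * real n \<le> real (card (\<alpha> n \<inter> cball m 2))"
    using many_points_near_center by blast
  show ?thesis
    using c(2) eventually_ge_at_top[of 1]
  proof eventually_elim
    case (elim n)
    have "0 < c * real n" using c elim by simp
    then have "0 < card (\<alpha> n \<inter> cball m 2)" using elim(1) by linarith
    then obtain a where a: "a \<in> \<alpha> n" "norm (m - a) \<le> 2"
      by (metis card_gt_0_iff disjoint_iff dist_norm mem_cball)
    show ?case
    proof
      fix y
      have "D n y \<le> N (y - a)" using a elim by (intro set_dist_le) auto
      also have "\<dots> \<le> B * norm (y - a)" by (rule N_le_norm)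
      also have "\<dots> \<le> B * (2 + norm (y - m))"
        using B_pos a norm_triangle_ineq[of "y - m" "m - a"] by (intro mult_left_mono) auto
      finally show "D n y \<le> B * (2 + norm (y - m))" .
    qed
  qed
qed

text \<open>
  The cells are disjoint, and in the cell of \<open>a\<close> the distance to the remaining points is at most \<open>D n x + \<eta>\<close>.
  Hence the sum is at most the integral of \<open>(D n x + \<eta>) powr r\<close>.
\<close>

lemma sum_cell_cost_le:
  assumes n: "1 \<le> n" and T: "T \<subseteq> \<alpha> n" and \<eta>: "0 < \<eta>"
    and near: "\<And>a. a \<in> T \<Longrightarrow> \<alpha> n - {a} \<noteq> {} \<and> set_dist N a (\<alpha> n - {a}) \<le> \<eta>"
  shows "(\<Sum>a\<in>T. cell_cost N r P (\<alpha> n) a)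
    \<le> ennreal (2 powr r) * (distortion N r P (\<alpha> n) + ennreal (\<eta> powr r) * emeasure P UNIV)"
proof -
  have fin: "finite T" using T n finite_subset \<alpha>_finite by blast
  let ?u = "\<lambda>a x. ennreal (set_dist N x (\<alpha> n - {a}) powr r) * indicator (strict_cell N (\<alpha> n) a) x"
  have mu: "?u a \<in> borel_measurable P" if "a \<in> T" for a
  proof -
    have [measurable]: "strict_cell N (\<alpha> n) a \<in> sets borel"
      "(\<lambda>x. set_dist N x (\<alpha> n - {a})) \<in> borel_measurable borel"
      using that near n by auto
    show ?thesis by measurable
  qed
  have [measurable]: "(\<lambda>x. D n x) \<in> borel_measurable borel" using n by simp
  have pointwise: "(\<Sum>a\<in>T. ?u a x) \<le> ennreal (2 powr r) * (ennreal (D n x powr r) + ennreal (\<eta> powr r))" for x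
  proof (cases "\<exists>a\<in>T. x \<in> strict_cell N (\<alpha> n) a")
    case True
    then obtain a where a: "a \<in> T" "x \<in> strict_cell N (\<alpha> n) a" by blast
    have "x \<notin> strict_cell N (\<alpha> n) a'" if "a' \<in> T - {a}" for a'
      using strict_cells_disjoint[of "\<alpha> n" a a'] a that T n by auto
    then have "(\<Sum>a\<in>T. ?u a x) = ?u a x"
      using a fin by (subst sum.remove[of T a]) auto
    also have "\<dots> = ennreal (set_dist N x (\<alpha> n - {a}) powr r)" using a by simp
    also have "\<dots> \<le> ennreal (2 powr r * (D n x powr r + \<eta> powr r))"
    proof (rule ennreal_leI)
      have Dx: "D n x = N (x - a)"
        using a T n near by (intro set_dist_strict_cell) auto
      have "set_dist N x (\<alpha> n - {a}) \<le> set_dist N a (\<alpha> n - {a}) + N (x - a)"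
        using a n near by (intro set_dist_lipschitz) auto
      then have "set_dist N x (\<alpha> n - {a}) \<le> D n x + \<eta>" using near[OF a(1)] Dx by simp
      then have "set_dist N x (\<alpha> n - {a}) powr r \<le> (D n x + \<eta>) powr r"
        using r_pos n near[OF a(1)] by (intro powr_mono2 set_dist_nonneg) auto
      also have "\<dots> \<le> 2 powr r * (D n x powr r + \<eta> powr r)"
        using \<eta> r_pos D_nonneg[OF n] by (intro powr_add_le) auto
      finally show "set_dist N x (\<alpha> n - {a}) powr r \<le> 2 powr r * (D n x powr r + \<eta> powr r)" .
    qed
    finally show ?thesis by (simp add: ennreal_mult)
  next
    case False
    then have "(\<Sum>a\<in>T. ?u a x) = 0" by (intro sum.neutral) auto
    then show ?thesis by simp
  qed
  have "(\<Sum>a\<in>T. cell_cost N r P (\<alpha> n) a) = (\<integral>\<^sup>+x. (\<Sum>a\<in>T. ?u a x) \<partial>P)"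
    unfolding cell_cost_def by (rule nn_integral_sum[symmetric]) (rule mu)
  also have "\<dots> \<le> (\<integral>\<^sup>+x. ennreal (2 powr r) * (ennreal (D n x powr r) + ennreal (\<eta> powr r)) \<partial>P)"
    by (intro nn_integral_mono pointwise)
  also have "\<dots> = ennreal (2 powr r) * (\<integral>\<^sup>+x. (ennreal (D n x powr r) + ennreal (\<eta> powr r)) \<partial>P)"
    by (rule nn_integral_cmult) measurable
  also have "(\<integral>\<^sup>+x. (ennreal (D n x powr r) + ennreal (\<eta> powr r)) \<partial>P)
      = distortion N r P (\<alpha> n) + ennreal (\<eta> powr r) * emeasure P UNIV"
    unfolding distortion_def by (subst nn_integral_add) (auto simp: sets_eq_imp_space_eq[OF sets_P])
  finally show ?thesis .
qed

text \<open>
  At least \<open>c * n\<close> points lie near \<open>m\<close>, and by \<open>card_separated_le\<close> at least half of these have a neighbour at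
  distance at most \<open>E * h n\<close>. The costs of these points sum to a multiple of \<open>h n powr r\<close>, so one of them costs
  at most a multiple of \<open>h n powr r / n = h n powr (r + d)\<close>.
\<close>

lemma cheap_cell:
  obtains C where "0 < C"
    "\<forall>\<^sub>F n in sequentially. \<exists>a\<in>\<alpha> n. \<alpha> n - {a} \<noteq> {} \<and>
      cell_cost N r P (\<alpha> n) a \<le> ennreal (C * h n powr (r + real CARD('d)))"
proof -
  obtain C1 where C1: "0 < C1" "\<And>n. 1 \<le> n \<Longrightarrow> distortion N r P (\<alpha> n) \<le> ennreal (C1 * h n powr r)"
    using distortion_upper by blast
  obtain c where c: "0 < c" "\<forall>\<^sub>F n in sequentially. c * real n \<le> real (card (\<alpha> n \<inter> cball m 2))"
    using many_points_near_center by blast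
  define p where "p = enn2real (emeasure P UNIV)"
  have p: "emeasure P UNIV = ennreal p" "0 \<le> p"
    using emeasure_P_finite by (auto simp: p_def less_top)
  (* At most (6 * B / E) ^ d * n = c * n / 2 points can be separated by E * h n. *)
  define E where "E = 6 * B * root CARD('d) (2 / c)"
  have E: "0 < E" using B_pos c by (simp add: E_def)
  have EC: "E ^ CARD('d) = (6 * B) ^ CARD('d) * (2 / c)"
    using c by (simp add: E_def power_mult_distrib)
  (* A factor 2 / c comes from averaging over c * n / 2 points, the other factor 2 makes the
     final contradiction strict. *)
  define C where "C = 4 / c * (2 powr r * (C1 + E powr r * p))"
  have C: "0 < C" using C1 c p by (simp add: C_def add_pos_nonneg)
  have main: "\<exists>a\<in>\<alpha> n. \<alpha> n - {a} \<noteq> {} \<and> cell_cost N r P (\<alpha> n) a \<le> ennreal (C * h n powr (r + real CARD('d)))"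
    if n: "1 \<le> n" and many: "c * real n \<le> real (card (\<alpha> n \<inter> cball m 2))"
      and two: "2 \<le> c * real n" and small: "E * h n \<le> 2 * B" for n
  proof -
    let ?K = "\<alpha> n \<inter> cball m 2"
    let ?\<eta> = "E * h n"
    have \<eta>: "0 < ?\<eta>" using E h_pos[OF n] by simp
    have fK: "finite ?K" using n by simp
    have ne: "\<alpha> n - {a} \<noteq> {}" for a
    proof
      assume "\<alpha> n - {a} = {}"
      then have "card ?K \<le> card {a}" using n by (intro card_mono) auto
      then show False using many two by simp
    qed
    let ?F = "{a \<in> ?K. ?\<eta> < set_dist N a (\<alpha> n - {a})}"
    let ?T = "{a \<in> ?K. set_dist N a (\<alpha> n - {a}) \<le> ?\<eta>}"
    have "real (card ?F) * ?\<eta> ^ CARD('d) \<le> (6 * B) ^ CARD('d)"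
    proof (rule card_separated_le[of _ m])
      fix a a' assume a: "a \<in> ?F" "a' \<in> ?F" "a \<noteq> a'"
      then have "?\<eta> < set_dist N a (\<alpha> n - {a})" by simp
      also have "\<dots> \<le> N (a - a')" using a n by (intro set_dist_le) auto
      finally show "?\<eta> < N (a - a')" .
    next
      show "finite ?F" using fK by (rule finite_subset[rotated]) auto
    qed (use \<eta> small in auto)
    then have "real (card ?F) * (2 / c / real n) * (6 * B) ^ CARD('d) \<le> 1 * (6 * B) ^ CARD('d)"
      using n by (simp add: power_mult_distrib EC h_power mult_ac)
    then have "real (card ?F) * (2 / c / real n) \<le> 1"
      using B_pos by (subst (asm) mult_le_cancel_right_pos) auto
    then have F: "real (card ?F) \<le> c * real n / 2" using c n by (simp add: field_simps)
    have "card ?K = card ?F + card ?T"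
    proof -
      have "finite ?F" "finite ?T" using fK by (auto intro: finite_subset[rotated])
      moreover have "?K = ?F \<union> ?T" "?F \<inter> ?T = {}" by auto
      ultimately show ?thesis by (metis (no_types, lifting) card_Un_disjoint)
    qed
    then have T: "c * real n / 2 \<le> real (card ?T)" using F many by linarith
    let ?Y = "2 powr r * (C1 + E powr r * p) * h n powr r"
    have Ypos: "0 < ?Y" using C1 p h_pos[OF n] by (auto intro!: mult_pos_pos add_pos_nonneg)
    have "(\<Sum>a\<in>?T. cell_cost N r P (\<alpha> n) a)
      \<le> ennreal (2 powr r) * (distortion N r P (\<alpha> n) + ennreal (?\<eta> powr r) * emeasure P UNIV)"
      using n \<eta> ne by (intro sum_cell_cost_le) auto
    also have "\<dots> \<le> ennreal (2 powr r) * (ennreal (C1 * h n powr r) + ennreal (?\<eta> powr r) * ennreal p)"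
      unfolding p(1) by (intro mult_left_mono add_right_mono C1(2) n) auto
    also have "\<dots> = ennreal (2 powr r * (C1 * h n powr r + ?\<eta> powr r * p))"
      using C1 p by (simp add: ennreal_mult ennreal_plus)
    also have "2 powr r * (C1 * h n powr r + ?\<eta> powr r * p) = ?Y"
      using E h_pos[OF n] by (simp add: powr_mult algebra_simps)
    finally have sum_le: "(\<Sum>a\<in>?T. cell_cost N r P (\<alpha> n) a) \<le> ennreal ?Y" .
    have "\<exists>a\<in>?T. cell_cost N r P (\<alpha> n) a \<le> ennreal (C * h n powr (r + real CARD('d)))"
    proof (rule ccontr)
      assume "\<not> ?thesis"
      then have *: "ennreal (C * h n powr (r + real CARD('d))) \<le> cell_cost N r P (\<alpha> n) a" if "a \<in> ?T" for a
        using that by force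
      have hd: "h n powr (r + real CARD('d)) = h n powr r / real n"
        using h_pos[OF n] h_power[OF n] by (simp add: powr_add powr_realpow)
      have "2 * ?Y = c * real n / 2 * (C * h n powr (r + real CARD('d)))"
        using c n unfolding hd C_def by simp
      also have "\<dots> \<le> real (card ?T) * (C * h n powr (r + real CARD('d)))"
        using C T by (intro mult_right_mono) auto
      finally have "ennreal (2 * ?Y) \<le> ennreal (real (card ?T)) * ennreal (C * h n powr (r + real CARD('d)))"
        using C by (subst ennreal_mult[symmetric]) (auto intro!: ennreal_leI)
      also have "\<dots> \<le> (\<Sum>a\<in>?T. cell_cost N r P (\<alpha> n) a)"
        using sum_bounded_below[OF *, of ?T] by (simp add: ennreal_of_nat_eq_real_of_nat)
      also note sum_le
      finally have "2 * ?Y \<le> ?Y" using Ypos by (subst (asm) ennreal_le_iff) auto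
      then show False using Ypos by linarith
    qed
    then show ?thesis using ne by blast
  qed
  have large: "\<forall>\<^sub>F n in sequentially. 2 \<le> c * real n"
    using c by real_asymp
  have E_small: "\<forall>\<^sub>F n in sequentially. E * h n \<le> 2 * B"
    using B_pos by (intro eventually_h_mult_le) simp
  have "\<forall>\<^sub>F n in sequentially. \<exists>a\<in>\<alpha> n. \<alpha> n - {a} \<noteq> {} \<and>
      cell_cost N r P (\<alpha> n) a \<le> ennreal (C * h n powr (r + real CARD('d)))"
    using eventually_ge_at_top[of 1] c(2) large E_small
    by eventually_elim (rule main)
  with C show thesis by (rule that)
qed

text \<open>
  A constant multiple of \<open>f x powr (-1 / (r + d))\<close>: \<open>h n * \<phi> x\<close> is the expected order of \<open>D n x\<close>.
\<close>

abbreviation \<phi> :: "real ^ 'd \<Rightarrow> real" where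
  "\<phi> x \<equiv> exp (q (x - m) / (2 * (r + real CARD('d))))"

lemma p_pos: "0 < r + real CARD('d)"
  using r_pos by simp

lemma exp_gain_pos: "0 < b \<Longrightarrow> b \<le> 1 / 4 \<Longrightarrow> 0 < (1 - b) powr r - b powr r"
  using powr_less_mono2[of r b "1 - b"] r_pos by simp

lemma h_powr_p: "1 \<le> n \<Longrightarrow> h n powr (r + real CARD('d)) = h n powr r * h n ^ CARD('d)"
  using h_pos[of n] by (simp add: powr_add powr_realpow)

subsection \<open>Pointwise upper bounds for the quantization error\<close>

text \<open>
  \<open>exchange_inequality\<close> with the cheap point of \<open>cheap_cell\<close> and an arbitrary \<open>y\<close>. The parameters \<open>b\<close> and \<open>w\<close>
  stay free: in the tail \<open>b\<close> has to be small, on bounded sets \<open>b = 1 / 4\<close> is good enough.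
\<close>

lemma D_powr_bound:
  obtains C where "0 < C"
    "\<forall>\<^sub>F n in sequentially. \<forall>y b w. 0 < b \<longrightarrow> b \<le> 1 / 4 \<longrightarrow> 0 \<le> w \<longrightarrow>
      (\<forall>x. norm (x - y) \<le> b * D n y / A \<longrightarrow> w \<le> f x) \<longrightarrow>
      ((1 - b) powr r - b powr r) * ball_vol TYPE('d) * (b / B) ^ CARD('d) * w * D n y powr (r + real CARD('d))
        \<le> C * h n powr (r + real CARD('d))"
proof -
  obtain C where C: "0 < C"
    "\<forall>\<^sub>F n in sequentially. \<exists>a\<in>\<alpha> n. \<alpha> n - {a} \<noteq> {} \<and>
      cell_cost N r P (\<alpha> n) a \<le> ennreal (C * h n powr (r + real CARD('d)))"
    using cheap_cell by blast
  have main: "((1 - b) powr r - b powr r) * ball_vol TYPE('d) * (b / B) ^ CARD('d) * w * D n y powr (r + real CARD('d))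
        \<le> C * h n powr (r + real CARD('d))"
    if n: "1 \<le> n" and a: "a \<in> \<alpha> n" "\<alpha> n - {a} \<noteq> {}"
      and cost: "cell_cost N r P (\<alpha> n) a \<le> ennreal (C * h n powr (r + real CARD('d)))"
      and b: "0 < b" "b \<le> 1 / 4" and w: "0 \<le> w"
      and le: "\<And>x. norm (x - y) \<le> b * D n y / A \<Longrightarrow> w \<le> f x"
    for n a y b w
  proof -
    let ?g = "(1 - b) powr r - b powr r"
    let ?D = "D n y"
    have g: "0 < ?g" using b by (rule exp_gain_pos)
    have D0: "0 \<le> ?D" using n by (rule D_nonneg)
    let ?S = "cball y (b * ?D / B)"
    have S: "x \<in> ?S \<Longrightarrow> N (x - y) \<le> b * ?D" for x
    proof -
      assume "x \<in> ?S"
      then have "B * norm (x - y) \<le> B * (b * ?D / B)"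
        using B_pos by (intro mult_left_mono) (auto simp: dist_norm norm_minus_commute)
      then show ?thesis using N_le_norm[of "x - y"] B_pos by simp
    qed
    have "ennreal (?g * ?D powr r * (w * vol ?S)) = ennreal (?g * ?D powr r) * ennreal (w * vol ?S)"
      using g w by (intro ennreal_mult) auto
    also have "\<dots> \<le> ennreal (?g * ?D powr r) * emeasure P ?S"
    proof (intro mult_left_mono emeasure_P_ge w le)
      fix x assume "x \<in> ?S"
      then have "N (x - y) / A \<le> b * ?D / A" using A_pos by (intro divide_right_mono S) auto
      then show "norm (x - y) \<le> b * ?D / A" using norm_le_N_div[of "x - y"] by simp
    qed auto
    also have "\<dots> \<le> ennreal (?g * ?D powr r) * emeasure P {x. N (x - y) \<le> b * ?D}"
    proof (intro mult_left_mono emeasure_mono)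
      show "{x. N (x - y) \<le> b * ?D} \<in> sets P" by measurable
    qed (use S in auto)
    also have "\<dots> \<le> cell_cost N r P (\<alpha> n) a"
      using b by (intro exchange_inequality[OF sets_P r_pos quantizer_\<alpha>[OF n] distortion_\<alpha>[OF n]
            distortion_finite[OF n] a]) auto
    also note cost
    finally have "?g * ?D powr r * (w * vol ?S) \<le> C * h n powr (r + real CARD('d))"
      using C by (subst (asm) ennreal_le_iff) auto
    moreover have "vol ?S = ball_vol TYPE('d) * ((b / B) ^ CARD('d) * ?D ^ CARD('d))"
      using D0 b B_pos by (subst vol_cball) (auto simp: power_mult_distrib power_divide)
    moreover have "?D powr (r + real CARD('d)) = ?D powr r * ?D ^ CARD('d)"
      using D0 by (cases "?D = 0") (simp_all add: powr_add powr_realpow)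
    ultimately show ?thesis by (simp add: mult_ac)
  qed
  have "\<forall>\<^sub>F n in sequentially. \<forall>y b w. 0 < b \<longrightarrow> b \<le> 1 / 4 \<longrightarrow> 0 \<le> w \<longrightarrow>
      (\<forall>x. norm (x - y) \<le> b * D n y / A \<longrightarrow> w \<le> f x) \<longrightarrow>
      ((1 - b) powr r - b powr r) * ball_vol TYPE('d) * (b / B) ^ CARD('d) * w * D n y powr (r + real CARD('d))
        \<le> C * h n powr (r + real CARD('d))"
    using C(2) eventually_ge_at_top[of 1] by eventually_elim (blast intro: main)
  with C(1) show thesis by (rule that)
qed

text \<open>
  By \<open>D_near_center\<close>, \<open>D n y\<close> grows at most linearly in \<open>y\<close>, so \<open>q_perturb\<close> controls the density on the ball of
  radius \<open>b * D n y\<close> around \<open>y\<close>.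
\<close>

lemma D_global_bound:
  assumes \<epsilon>: "0 < \<epsilon>"
  obtains C where "0 < C"
    "\<forall>\<^sub>F n in sequentially. \<forall>y. D n y \<le> C * exp ((1 + \<epsilon>) * q (y - m) / 2 / (r + real CARD('d))) * h n"
proof -
  let ?p = "r + real CARD('d)"
  obtain C where C: "0 < C"
    "\<forall>\<^sub>F n in sequentially. \<forall>y b w. 0 < b \<longrightarrow> b \<le> 1 / 4 \<longrightarrow> 0 \<le> w \<longrightarrow>
      (\<forall>x. norm (x - y) \<le> b * D n y / A \<longrightarrow> w \<le> f x) \<longrightarrow>
      ((1 - b) powr r - b powr r) * ball_vol TYPE('d) * (b / B) ^ CARD('d) * w * D n y powr ?p
        \<le> C * h n powr ?p"
    using D_powr_bound by blast
  have "0 < B / A" using A_pos B_pos by simp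
  then obtain b K where b: "0 < b" "b \<le> 1 / 4"
    and bK: "\<And>y z. norm (z - y) \<le> b * (B / A) * (2 + norm y) \<Longrightarrow> q z \<le> (1 + \<epsilon>) * q y + K"
    using q_perturb[OF \<epsilon>] by blast
  define g where "g = ((1 - b) powr r - b powr r) * ball_vol TYPE('d) * (b / B) ^ CARD('d) * (c\<^sub>0 * exp (- K / 2))"
  have g: "0 < g" unfolding g_def using exp_gain_pos[OF b] V_pos b B_pos c\<^sub>0_pos by simp
  have "\<forall>\<^sub>F n in sequentially. \<forall>y. D n y \<le> (C / g) powr (1 / ?p) * exp ((1 + \<epsilon>) * q (y - m) / 2 / ?p) * h n"
    using C(2) eventually_ge_at_top[of 1] D_near_center
  proof eventually_elim
    case (elim n)
    show ?case
    proof
      fix y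
      let ?w = "c\<^sub>0 * exp (- K / 2) * exp (- ((1 + \<epsilon>) * q (y - m) / 2))"
      have w: "?w \<le> f x" if x: "norm (x - y) \<le> b * D n y / A" for x
      proof -
        have "b * D n y / A \<le> b * (B * (2 + norm (y - m))) / A"
          using elim(3) b A_pos by (intro divide_right_mono mult_left_mono) auto
        then have "norm ((x - m) - (y - m)) \<le> b * (B / A) * (2 + norm (y - m))" using x by simp
        then have "q (x - m) \<le> (1 + \<epsilon>) * q (y - m) + K" by (rule bK)
        then have "exp (- K / 2 + - ((1 + \<epsilon>) * q (y - m) / 2)) \<le> exp (- q (x - m) / 2)" by simp
        then show ?thesis using c\<^sub>0_pos unfolding exp_add by (simp add: mult.assoc)
      qed
      have "0 \<le> ?w" using c\<^sub>0_pos by simp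
      with elim(1) b w have "((1 - b) powr r - b powr r) * ball_vol TYPE('d) * (b / B) ^ CARD('d) * ?w * D n y powr ?p
        \<le> C * h n powr ?p" by blast
      then have "g * exp (- ((1 + \<epsilon>) * q (y - m) / 2)) * D n y powr ?p \<le> C * h n powr ?p"
        unfolding g_def by (simp only: mult.assoc)
      then show "D n y \<le> (C / g) powr (1 / ?p) * exp ((1 + \<epsilon>) * q (y - m) / 2 / ?p) * h n"
        using p_pos D_nonneg[OF elim(2)] h_pos[OF elim(2)] g C(1) by (intro root_bound) auto
    qed
  qed
  moreover have "0 < (C / g) powr (1 / ?p)" using C g by simp
  ultimately show thesis using that by blast
qed

lemma q_le_radius: "norm (y - m) \<le> R \<Longrightarrow> q (y - m) \<le> Lam * R\<^sup>2"
  using q_upper[of "y - m"] Lam_pos by (meson mult_left_mono norm_ge_zero order_trans power_mono less_imp_le)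

lemma D_uniformly_small:
  assumes \<delta>: "0 < \<delta>"
  shows "\<forall>\<^sub>F n in sequentially. \<forall>y. norm (y - m) \<le> R \<longrightarrow> D n y \<le> \<delta>"
proof -
  let ?p = "r + real CARD('d)"
  obtain C where C: "0 < C"
    "\<forall>\<^sub>F n in sequentially. \<forall>y. D n y \<le> C * exp ((1 + 1) * q (y - m) / 2 / ?p) * h n"
    using D_global_bound[of 1] by auto
  show ?thesis
    using C(2) eventually_h_mult_le[OF \<delta>, of "C * exp (Lam * R\<^sup>2 / ?p)"] eventually_ge_at_top[of 1]
  proof eventually_elim
    case (elim n)
    show ?case
    proof (intro allI impI)
      fix y assume y: "norm (y - m) \<le> R"
      have "D n y \<le> C * exp (q (y - m) / ?p) * h n" using elim(1)[rule_format, of y] by simp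
      also have "\<dots> \<le> C * exp (Lam * R\<^sup>2 / ?p) * h n"
        using C(1) h_pos[OF elim(3)] q_le_radius[OF y] p_pos
        by (intro mult_right_mono mult_left_mono) (auto intro: divide_right_mono)
      finally show "D n y \<le> \<delta>" using elim(2) by simp
    qed
  qed
qed

text \<open>
  The constant does not depend on \<open>R\<close>: by \<open>D_uniformly_small\<close>, the ball on which the density has to be
  bounded below shrinks to its centre, uniformly on \<open>cball m R\<close>.
\<close>

lemma D_local_bound:
  obtains C where "0 < C"
    "\<And>R. \<forall>\<^sub>F n in sequentially. \<forall>y. norm (y - m) \<le> R \<longrightarrow> D n y \<le> C * \<phi> y * h n"
proof -
  let ?p = "r + real CARD('d)"
  obtain C where C: "0 < C"
    "\<forall>\<^sub>F n in sequentially. \<forall>y b w. 0 < b \<longrightarrow> b \<le> 1 / 4 \<longrightarrow> 0 \<le> w \<longrightarrow>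
      (\<forall>x. norm (x - y) \<le> b * D n y / A \<longrightarrow> w \<le> f x) \<longrightarrow>
      ((1 - b) powr r - b powr r) * ball_vol TYPE('d) * (b / B) ^ CARD('d) * w * D n y powr ?p
        \<le> C * h n powr ?p"
    using D_powr_bound by blast
  define b :: real where "b = 1 / 4"
  have b: "0 < b" "b \<le> 1 / 4" by (auto simp: b_def)
  define g where "g = ((1 - b) powr r - b powr r) * ball_vol TYPE('d) * (b / B) ^ CARD('d) * (c\<^sub>0 * exp (- 1 / 2))"
  have g: "0 < g" unfolding g_def using exp_gain_pos[OF b] V_pos b B_pos c\<^sub>0_pos by simp
  have "\<forall>\<^sub>F n in sequentially. \<forall>y. norm (y - m) \<le> R \<longrightarrow> D n y \<le> (C / g) powr (1 / ?p) * \<phi> y * h n" for R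
  proof -
    obtain \<delta> where \<delta>: "0 < \<delta>" "\<delta> \<le> 1"
      "\<And>x y. norm (y - m) \<le> R \<Longrightarrow> norm (x - y) \<le> \<delta> \<Longrightarrow> \<bar>q (x - m) - q (y - m)\<bar> \<le> 1"
      using q_locally_uniform by blast
    have "0 < A * \<delta>" using \<delta> A_pos by simp
    from C(2) eventually_ge_at_top[of 1] D_uniformly_small[OF this, of R] show ?thesis
    proof eventually_elim
      case (elim n)
      show ?case
      proof (intro allI impI)
        fix y assume y: "norm (y - m) \<le> R"
        let ?w = "c\<^sub>0 * exp (- 1 / 2) * exp (- (q (y - m) / 2))"
        have w: "?w \<le> f x" if x: "norm (x - y) \<le> b * D n y / A" for x
        proof -
          have "b * D n y / A \<le> 1 * (A * \<delta>) / A"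
            using elim(3) y b A_pos \<delta> D_nonneg[OF elim(2)] by (intro divide_right_mono mult_mono) auto
          then have "norm (x - y) \<le> \<delta>" using x A_pos by simp
          then have "\<bar>q (x - m) - q (y - m)\<bar> \<le> 1" by (intro \<delta>(3) y)
          then have "exp (- 1 / 2 + - (q (y - m) / 2)) \<le> exp (- q (x - m) / 2)" by simp
          then show ?thesis using c\<^sub>0_pos unfolding exp_add by (simp add: mult.assoc)
        qed
        have "0 \<le> ?w" using c\<^sub>0_pos by simp
        with elim(1) b w have "((1 - b) powr r - b powr r) * ball_vol TYPE('d) * (b / B) ^ CARD('d) * ?w * D n y powr ?p
          \<le> C * h n powr ?p" by blast
        then have "g * exp (- (q (y - m) / 2)) * D n y powr ?p \<le> C * h n powr ?p"
          unfolding g_def by (simp only: mult.assoc)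
        then have "D n y \<le> (C / g) powr (1 / ?p) * exp (q (y - m) / 2 / ?p) * h n"
          using p_pos D_nonneg[OF elim(2)] h_pos[OF elim(2)] g C(1) by (intro root_bound) auto
        then show "D n y \<le> (C / g) powr (1 / ?p) * \<phi> y * h n" by simp
      qed
    qed
  qed
  moreover have "0 < (C / g) powr (1 / ?p)" using C g by simp
  ultimately show thesis using that by blast
qed

subsection \<open>Rate optimality of dilatations\<close>

lemma distortion_dilate:
  assumes n: "1 \<le> n" and \<theta>: "0 < \<theta>"
  shows "distortion N s P (dilate \<theta> m (\<alpha> n)) =
    ennreal (\<theta> ^ CARD('d) * \<theta> powr s) *
    (\<integral>\<^sup>+y. ennreal (c\<^sub>0 * exp (- \<theta>\<^sup>2 * q (y - m) / 2) * D n y powr s) \<partial>lborel)"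
proof -
  have fin: "finite (dilate \<theta> m (\<alpha> n))" "dilate \<theta> m (\<alpha> n) \<noteq> {}" using n by (auto simp: dilate_def)
  have [measurable]: "(\<lambda>x. set_dist N x (dilate \<theta> m (\<alpha> n))) \<in> borel_measurable borel"
    "(\<lambda>x. D n x) \<in> borel_measurable borel" using fin n by auto
  have "distortion N s P (dilate \<theta> m (\<alpha> n)) =
      (\<integral>\<^sup>+x. ennreal (f x) * ennreal (set_dist N x (dilate \<theta> m (\<alpha> n)) powr s) \<partial>lborel)"
    unfolding distortion_def by (rule nn_integral_P) measurable
  also have "\<dots> = ennreal (\<theta> ^ CARD('d)) * (\<integral>\<^sup>+y. ennreal (f (m + \<theta> *\<^sub>R (y - m))) *
      ennreal (set_dist N (m + \<theta> *\<^sub>R (y - m)) (dilate \<theta> m (\<alpha> n)) powr s) \<partial>lborel)"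
    using \<theta> by (intro nn_integral_lborel_dilate) measurable
  also have "(\<lambda>y. ennreal (f (m + \<theta> *\<^sub>R (y - m))) * ennreal (set_dist N (m + \<theta> *\<^sub>R (y - m)) (dilate \<theta> m (\<alpha> n)) powr s))
     = (\<lambda>y. ennreal (\<theta> powr s) * ennreal (c\<^sub>0 * exp (- \<theta>\<^sup>2 * q (y - m) / 2) * D n y powr s))"
  proof
    fix y
    have "f (m + \<theta> *\<^sub>R (y - m)) = c\<^sub>0 * exp (- \<theta>\<^sup>2 * q (y - m) / 2)" by (simp add: q_scale)
    moreover have "set_dist N (m + \<theta> *\<^sub>R (y - m)) (dilate \<theta> m (\<alpha> n)) powr s = \<theta> powr s * D n y powr s"
      using n \<theta> D_nonneg[OF n] by (simp add: set_dist_dilate powr_mult)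
    ultimately show "ennreal (f (m + \<theta> *\<^sub>R (y - m))) * ennreal (set_dist N (m + \<theta> *\<^sub>R (y - m)) (dilate \<theta> m (\<alpha> n)) powr s)
     = ennreal (\<theta> powr s) * ennreal (c\<^sub>0 * exp (- \<theta>\<^sup>2 * q (y - m) / 2) * D n y powr s)"
      using c\<^sub>0_pos by (simp add: ennreal_mult[symmetric] mult_ac)
  qed
  also have "(\<integral>\<^sup>+y. ennreal (\<theta> powr s) * ennreal (c\<^sub>0 * exp (- \<theta>\<^sup>2 * q (y - m) / 2) * D n y powr s) \<partial>lborel)
     = ennreal (\<theta> powr s) * (\<integral>\<^sup>+y. ennreal (c\<^sub>0 * exp (- \<theta>\<^sup>2 * q (y - m) / 2) * D n y powr s) \<partial>lborel)"
    by (rule nn_integral_cmult) measurable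
  finally show ?thesis using \<theta> by (simp add: ennreal_mult mult.assoc)
qed

lemma normalized_distortion_dilate:
  assumes n: "1 \<le> n" and \<theta>: "0 < \<theta>"
  shows "ennreal (real n powr (s / real CARD('d))) * distortion N s P (dilate \<theta> m (\<alpha> n)) =
    ennreal (\<theta> ^ CARD('d) * \<theta> powr s * h n powr - s) *
    (\<integral>\<^sup>+y. ennreal (c\<^sub>0 * exp (- \<theta>\<^sup>2 * q (y - m) / 2) * D n y powr s) \<partial>lborel)"
  using n \<theta> unfolding distortion_dilate[OF n \<theta>] h_def
  by (subst powr_mesh) (auto simp: ennreal_mult mult_ac)

text \<open>
  The strict inequality leaves room for the factor \<open>1 + \<epsilon>\<close> of \<open>D_global_bound\<close>, which then provides an
  integrable bound.
\<close>

theorem dilatation_rate_optimal: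
  assumes s: "0 < s" and \<theta>: "0 < \<theta>" and large: "s < \<theta>\<^sup>2 * (r + real CARD('d))"
  shows "Ls_rate_optimal N s P (\<lambda>n. dilate \<theta> m (\<alpha> n))"
proof -
  let ?p = "r + real CARD('d)"
  (* Makes s * (1 + \<epsilon>) the midpoint of s and \<theta>\<^sup>2 * ?p. *)
  define \<epsilon> where "\<epsilon> = (\<theta>\<^sup>2 * ?p / s - 1) / 2"
  have \<epsilon>: "0 < \<epsilon>" using s large by (simp add: \<epsilon>_def field_simps)
  have "s * (1 + \<epsilon>) = (s + \<theta>\<^sup>2 * ?p) / 2" using s by (simp add: \<epsilon>_def field_simps)
  moreover have "(s + X) / 2 < X" if "s < X" for X :: real using that by simp
  ultimately have "s * (1 + \<epsilon>) < \<theta>\<^sup>2 * ?p" using large by metis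
  define t where "t = (\<theta>\<^sup>2 - s * (1 + \<epsilon>) / ?p) / 2"
  have t: "0 < t" using \<open>s * (1 + \<epsilon>) < \<theta>\<^sup>2 * ?p\<close> p_pos by (simp add: t_def field_simps)
  obtain C where C: "0 < C"
    "\<forall>\<^sub>F n in sequentially. \<forall>y. D n y \<le> C * exp ((1 + \<epsilon>) * q (y - m) / 2 / ?p) * h n"
    using D_global_bound[OF \<epsilon>] by blast
  define I where "I = (\<integral>\<^sup>+y. ennreal (exp (- t * q (y - m))) \<partial>lborel)"
  have I: "I < \<infinity>" unfolding I_def using t by (rule nn_integral_exp_q_finite)
  have "limsup (\<lambda>n. ennreal (real n powr (s / real CARD('d))) * distortion N s P (dilate \<theta> m (\<alpha> n)))
      \<le> ennreal (\<theta> ^ CARD('d) * \<theta> powr s * (c\<^sub>0 * C powr s)) * I"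
  proof (rule Limsup_bounded)
    show "\<forall>\<^sub>F n in sequentially. ennreal (real n powr (s / real CARD('d))) * distortion N s P (dilate \<theta> m (\<alpha> n))
      \<le> ennreal (\<theta> ^ CARD('d) * \<theta> powr s * (c\<^sub>0 * C powr s)) * I"
      using C(2) eventually_ge_at_top[of 1]
    proof eventually_elim
      case (elim n)
      have hn: "0 < h n" by (rule h_pos[OF elim(2)])
      have "(\<integral>\<^sup>+y. ennreal (c\<^sub>0 * exp (- \<theta>\<^sup>2 * q (y - m) / 2) * D n y powr s) \<partial>lborel)
        \<le> (\<integral>\<^sup>+y. ennreal (c\<^sub>0 * C powr s * h n powr s) * ennreal (exp (- t * q (y - m))) \<partial>lborel)"
      proof (intro nn_integral_mono)
        fix y
        have "D n y powr s \<le> (C * exp ((1 + \<epsilon>) * q (y - m) / 2 / ?p) * h n) powr s"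
          using elim(1) s D_nonneg[OF elim(2)] by (intro powr_mono2) auto
        also have "\<dots> = C powr s * exp (s * ((1 + \<epsilon>) * q (y - m) / 2 / ?p)) * h n powr s"
          using C hn by (simp add: powr_mult exp_powr_real mult_ac)
        finally have "c\<^sub>0 * exp (- \<theta>\<^sup>2 * q (y - m) / 2) * D n y powr s
          \<le> c\<^sub>0 * exp (- \<theta>\<^sup>2 * q (y - m) / 2) * (C powr s * exp (s * ((1 + \<epsilon>) * q (y - m) / 2 / ?p)) * h n powr s)"
          using c\<^sub>0_pos by (intro mult_left_mono) auto
        also have "\<dots> = c\<^sub>0 * C powr s * h n powr s * (exp (- \<theta>\<^sup>2 * q (y - m) / 2) * exp (s * ((1 + \<epsilon>) * q (y - m) / 2 / ?p)))"
          by (simp add: mult_ac)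
        also have "exp (- \<theta>\<^sup>2 * q (y - m) / 2) * exp (s * ((1 + \<epsilon>) * q (y - m) / 2 / ?p)) = exp (- t * q (y - m))"
          unfolding exp_add[symmetric] t_def using p_pos by (simp add: field_simps)
        finally show "ennreal (c\<^sub>0 * exp (- \<theta>\<^sup>2 * q (y - m) / 2) * D n y powr s)
          \<le> ennreal (c\<^sub>0 * C powr s * h n powr s) * ennreal (exp (- t * q (y - m)))"
          using c\<^sub>0_pos by (subst ennreal_mult[symmetric]) (auto intro!: ennreal_leI)
      qed
      also have "\<dots> = ennreal (c\<^sub>0 * C powr s * h n powr s) * I"
        unfolding I_def by (rule nn_integral_cmult) measurable
      finally have "ennreal (\<theta> ^ CARD('d) * \<theta> powr s * h n powr - s) *
          (\<integral>\<^sup>+y. ennreal (c\<^sub>0 * exp (- \<theta>\<^sup>2 * q (y - m) / 2) * D n y powr s) \<partial>lborel)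
        \<le> ennreal (\<theta> ^ CARD('d) * \<theta> powr s * h n powr - s) * (ennreal (c\<^sub>0 * C powr s * h n powr s) * I)"
        by (rule mult_left_mono) simp
      also have "\<dots> = ennreal ((\<theta> ^ CARD('d) * \<theta> powr s * h n powr - s) * (c\<^sub>0 * C powr s * h n powr s)) * I"
        using c\<^sub>0_pos \<theta> by (subst ennreal_mult) (auto simp: mult_ac)
      also have "(\<theta> ^ CARD('d) * \<theta> powr s * h n powr - s) * (c\<^sub>0 * C powr s * h n powr s)
          = \<theta> ^ CARD('d) * \<theta> powr s * (c\<^sub>0 * C powr s)"
        using hn by (simp add: powr_minus field_simps)
      finally show ?case unfolding normalized_distortion_dilate[OF elim(2) \<theta>] .
    qed
  qed
  also have "\<dots> < \<infinity>" using I by (simp add: ennreal_mult_less_top)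
  finally show ?thesis unfolding Ls_rate_optimal_def .
qed

subsection \<open>Size of the Voronoi cells\<close>

text \<open>
  The \<open>n\<close> Euclidean balls of radius \<open>h n / 2\<close> cannot cover \<open>cball m 1\<close>. Moving any point \<open>a\<close> to an uncovered \<open>y\<close> would gain
  at least \<open>c * h n powr (r + d)\<close>.
\<close>

lemma every_cell_cost:
  obtains c where "0 < c"
    "\<And>n a. 1 \<le> n \<Longrightarrow> a \<in> \<alpha> n \<Longrightarrow> \<alpha> n - {a} \<noteq> {} \<Longrightarrow>
      ennreal (c * h n powr (r + real CARD('d))) \<le> cell_cost N r P (\<alpha> n) a"
proof -
  define b :: real where "b = 1 / 4"
  have b: "0 < b" "b \<le> 1 / 4" "b < 1 / 2" by (auto simp: b_def)
  define g where "g = (1 - b) powr r - b powr r"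
  have g: "0 < g" unfolding g_def using b by (intro exp_gain_pos) auto
  define f0 where "f0 = c\<^sub>0 * exp (- Lam * 2\<^sup>2 / 2)"
  have f0: "0 < f0" using c\<^sub>0_pos by (simp add: f0_def)
  define c where "c = g * (A / 2) powr r * (f0 * (ball_vol TYPE('d) * (b * (A / 2) / B) ^ CARD('d)))"
  have c: "0 < c" unfolding c_def using g A_pos B_pos f0 V_pos b by simp
  have "ennreal (c * h n powr (r + real CARD('d))) \<le> cell_cost N r P (\<alpha> n) a"
    if n: "1 \<le> n" and a: "a \<in> \<alpha> n" "\<alpha> n - {a} \<noteq> {}" for n a
  proof -
    have hn: "0 < h n" using n by (rule h_pos)
    have h1: "h n \<le> 1" using n unfolding h_def mesh_def
      by (simp add: powr_minus_divide ge_one_powr_ge_zero)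
    let ?\<rho> = "A / 2 * h n"
    have \<rho>: "0 < ?\<rho>" using A_pos hn by simp
    let ?G = "{x \<in> cball m 1. \<forall>a\<in>\<alpha> n. ?\<rho> < N (x - a)}"
    have "(\<Sum>a\<in>\<alpha> n. ball_vol TYPE('d) * (?\<rho> / A) ^ CARD('d))
        = ball_vol TYPE('d) * ((1 / 2) ^ CARD('d) * (real (card (\<alpha> n)) * h n ^ CARD('d)))"
      using A_pos by (simp add: power_mult_distrib power_divide)
    also have "\<dots> \<le> ball_vol TYPE('d) * ((1 / 2) ^ CARD('d) * 1)"
      using V_pos card_\<alpha>[OF n] n by (intro mult_left_mono) (auto simp: h_power)
    also have "\<dots> < ball_vol TYPE('d) * 1"
      using V_pos by (intro mult_strict_left_mono) (auto simp: power_less_one_iff)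
    also have "\<dots> = vol (cball m 1)" by (simp add: vol_cball)
    finally have "0 < vol (cball m 1) - (\<Sum>a\<in>\<alpha> n. ball_vol TYPE('d) * (?\<rho> / A) ^ CARD('d))" by simp
    also have "\<dots> \<le> vol ?G" using n \<rho> by (intro vol_far_from_finite) auto
    finally have "?G \<noteq> {}" by (metis measure_empty less_irrefl)
    then obtain y where y: "norm (y - m) \<le> 1" "\<forall>a\<in>\<alpha> n. ?\<rho> < N (y - a)"
      by (auto simp: dist_norm norm_minus_commute)
    have Dy: "?\<rho> \<le> D n y" using y n by (subst set_dist_ge_iff) (auto intro: less_imp_le)
    let ?S = "cball y (b * ?\<rho> / B)"
    have r0: "0 \<le> b * ?\<rho> / B" using b \<rho> B_pos by simp
    have r1: "b * ?\<rho> / B \<le> 1"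
    proof -
      have "b * ?\<rho> \<le> 1 * (A * 1)" using b h1 hn A_pos by (intro mult_mono) auto
      also have "\<dots> \<le> B" using A_le_B by simp
      finally show ?thesis using B_pos by simp
    qed
    have "ennreal (c * h n powr (r + real CARD('d))) = ennreal (g * ?\<rho> powr r * (f0 * vol ?S))"
    proof -
      have "vol ?S = ball_vol TYPE('d) * ((b * (A / 2) / B) ^ CARD('d) * h n ^ CARD('d))"
        using r0 by (subst vol_cball) (auto simp: power_mult_distrib power_divide)
      moreover have "?\<rho> powr r = (A / 2) powr r * h n powr r" by (rule powr_mult)
      ultimately show ?thesis unfolding c_def h_powr_p[OF n] by (simp add: mult_ac)
    qed
    also have "\<dots> = ennreal (g * ?\<rho> powr r) * ennreal (f0 * vol ?S)"
      using g f0 by (intro ennreal_mult) auto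
    also have "\<dots> \<le> ennreal (g * D n y powr r) * emeasure P {x. N (x - y) \<le> b * D n y}"
    proof (rule mult_mono)
      show "ennreal (g * ?\<rho> powr r) \<le> ennreal (g * D n y powr r)"
        using g Dy \<rho> r_pos by (intro ennreal_leI mult_left_mono powr_mono2) auto
      have "ennreal (f0 * vol ?S) \<le> emeasure P ?S"
      proof (rule emeasure_P_ge)
        fix x assume "x \<in> ?S"
        then have "norm (x - y) \<le> 1" using r1 by (simp add: dist_norm norm_minus_commute)
        then have "norm (x - m) \<le> 2" using y(1) norm_triangle_ineq[of "x - y" "y - m"] by simp
        then show "f0 \<le> f x" unfolding f0_def by (rule f_ge)
      qed (use f0 in auto)
      also have "\<dots> \<le> emeasure P {x. N (x - y) \<le> b * D n y}"
      proof (rule emeasure_mono)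
        show "?S \<subseteq> {x. N (x - y) \<le> b * D n y}"
        proof
          fix x assume "x \<in> ?S"
          then have "B * norm (x - y) \<le> B * (b * ?\<rho> / B)"
            using B_pos by (intro mult_left_mono) (auto simp: dist_norm norm_minus_commute)
          also have "\<dots> = b * ?\<rho>" using B_pos by simp
          also have "\<dots> \<le> b * D n y" using b Dy by (intro mult_left_mono) auto
          finally show "x \<in> {x. N (x - y) \<le> b * D n y}" using N_le_norm[of "x - y"] by simp
        qed
        show "{x. N (x - y) \<le> b * D n y} \<in> sets P" by measurable
      qed
      finally show "ennreal (f0 * vol ?S) \<le> emeasure P {x. N (x - y) \<le> b * D n y}" .
    qed auto
    also have "\<dots> \<le> cell_cost N r P (\<alpha> n) a"
      unfolding g_def using b
      by (intro exchange_inequality[OF sets_P r_pos quantizer_\<alpha>[OF n] distortion_\<alpha>[OF n] distortion_finite[OF n] a])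
    finally show ?thesis .
  qed
  with c show thesis by (rule that)
qed

text \<open>
  Near \<open>a\<close> the distance to \<open>\<alpha> n\<close> is at most \<open>H\<close>, a multiple of \<open>h n * \<phi> a\<close>. A point at distance \<open>2 * H\<close> from \<open>a\<close>
  is therefore closer to another point of the quantizer. It follows that \<open>a\<close> has a neighbour within \<open>3 * H\<close> and, by
  star-shapedness, that its cell lies within \<open>2 * H\<close> of \<open>a\<close>. So the cost of the cell is at most \<open>(5 * H) powr r\<close>
  times its probability, and \<open>every_cell_cost\<close> bounds its volume from below.
\<close>

lemma cell_volume:
  obtains c where "0 < c"
    "\<And>R. \<forall>\<^sub>F n in sequentially. \<forall>a\<in>\<alpha> n. norm (a - m) \<le> R \<longrightarrow>
      \<alpha> n - {a} \<noteq> {} \<and> strict_cell N (\<alpha> n) a \<subseteq> cball a 1 \<and>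
      c * (h n * \<phi> a) ^ CARD('d) \<le> vol (strict_cell N (\<alpha> n) a)"
proof -
  let ?p = "r + real CARD('d)"
  obtain c where c: "0 < c"
    "\<And>n a. 1 \<le> n \<Longrightarrow> a \<in> \<alpha> n \<Longrightarrow> \<alpha> n - {a} \<noteq> {} \<Longrightarrow>
      ennreal (c * h n powr ?p) \<le> cell_cost N r P (\<alpha> n) a"
    using every_cell_cost by blast
  obtain C where C: "0 < C"
    "\<And>R. \<forall>\<^sub>F n in sequentially. \<forall>y. norm (y - m) \<le> R \<longrightarrow> D n y \<le> C * \<phi> y * h n"
    using D_local_bound by blast
  define C' where "C' = C * exp (1 / (2 * ?p))"
  have C': "0 < C'" using C by (simp add: C'_def)
  define k where "k = c / ((5 * C') powr r * (c\<^sub>0 * exp (1 / 2)))"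
  have k: "0 < k" using c C' c\<^sub>0_pos by (simp add: k_def)
  have "\<forall>\<^sub>F n in sequentially. \<forall>a\<in>\<alpha> n. norm (a - m) \<le> R \<longrightarrow>
      \<alpha> n - {a} \<noteq> {} \<and> strict_cell N (\<alpha> n) a \<subseteq> cball a 1 \<and>
      k * (h n * \<phi> a) ^ CARD('d) \<le> vol (strict_cell N (\<alpha> n) a)" for R
  proof -
    obtain \<delta> where \<delta>: "0 < \<delta>" "\<delta> \<le> 1"
      "\<And>x y. norm (y - m) \<le> R \<Longrightarrow> norm (x - y) \<le> \<delta> \<Longrightarrow> \<bar>q (x - m) - q (y - m)\<bar> \<le> 1"
      using q_locally_uniform by blast
    have A\<delta>: "0 < A * \<delta>" using A_pos \<delta> by simp
    from C(2)[of "R + 1"] eventually_h_mult_le[OF A\<delta>, of "2 * C' * exp (Lam * R\<^sup>2 / (2 * ?p))"]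
      eventually_ge_at_top[of 1]
    show ?thesis
    proof eventually_elim
      case (elim n)
      have n: "1 \<le> n" and hn: "0 < h n" using elim(3) by (auto intro: h_pos)
      show ?case
      proof (intro ballI impI)
        fix a assume a: "a \<in> \<alpha> n" and aR: "norm (a - m) \<le> R"
        let ?H = "C' * \<phi> a * h n"
        have H: "0 < ?H" using C' hn by simp
        have "2 * ?H \<le> 2 * C' * exp (Lam * R\<^sup>2 / (2 * ?p)) * h n"
        proof -
          have "\<phi> a \<le> exp (Lam * R\<^sup>2 / (2 * ?p))"
            using q_le_radius[OF aR] p_pos by (simp add: divide_right_mono)
          then have "(2 * C' * h n) * \<phi> a \<le> (2 * C' * h n) * exp (Lam * R\<^sup>2 / (2 * ?p))"
            using C' hn by (intro mult_left_mono) auto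
          then show ?thesis by (simp add: mult_ac)
        qed
        also have "\<dots> \<le> A * \<delta>" by (rule elim(2))
        finally have H\<delta>: "2 * ?H \<le> A * \<delta>" .
        have close: "norm (y - a) \<le> \<delta>" if "N (y - a) \<le> 2 * ?H" for y
        proof -
          have "A * norm (y - a) \<le> A * \<delta>" using norm_le_N[of "y - a"] that H\<delta> by linarith
          then show ?thesis using A_pos by simp
        qed
        have DH: "D n y \<le> ?H" if "N (y - a) \<le> 2 * ?H" for y
        proof -
          have ya: "norm (y - a) \<le> \<delta>" using that by (rule close)
          have "norm (y - m) \<le> R + 1"
            using norm_triangle_ineq[of "y - a" "a - m"] ya aR \<delta>(2) by simp
          then have "D n y \<le> C * \<phi> y * h n" using elim(1) by blast
          also have "\<phi> y \<le> exp (1 / (2 * ?p)) * \<phi> a"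
            unfolding exp_add[symmetric] add_divide_distrib[symmetric]
            using \<delta>(3)[OF aR ya] p_pos by (simp add: divide_right_mono)
          finally show ?thesis using C hn by (simp add: C'_def mult_ac)
        qed
        obtain a' where a': "a' \<in> \<alpha> n" "a' \<noteq> a" "N (a - a') \<le> 3 * ?H"
        proof -
          obtain i :: 'd where True by simp
          let ?u = "axis i 1 :: real ^ 'd"
          have "0 < A * norm ?u" using A_pos by (simp add: norm_axis_1)
          then have u: "0 < N ?u" using norm_le_N[of ?u] by linarith
          define y where "y = a + (2 * ?H / N ?u) *\<^sub>R ?u"
          have ya: "N (y - a) = 2 * ?H" using u H unfolding y_def by (simp add: N_scale)
          obtain a' where a': "a' \<in> \<alpha> n" "D n y = N (y - a')"
            using set_dist_attained[OF \<alpha>_finite[OF n] \<alpha>_nonempty[OF n]] by blast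
          have "N (y - a') \<le> ?H" using DH[of y] ya a' by simp
          then have "a' \<noteq> a" using ya H by (metis mult_2 add_le_same_cancel1 not_le)
          moreover have "N (a - a') \<le> 3 * ?H"
            using N_triangle_diff[of a a' y] N_minus_commute[of a y] ya \<open>N (y - a') \<le> ?H\<close> by simp
          ultimately show thesis using a' that by blast
        qed
        have ne: "\<alpha> n - {a} \<noteq> {}" using a' by blast
        have neighbour: "set_dist N a (\<alpha> n - {a}) \<le> 3 * ?H"
          using set_dist_le[of "\<alpha> n - {a}" a' a] a' n by simp
        let ?U = "strict_cell N (\<alpha> n) a"
        have U: "N (x - a) \<le> 2 * ?H" if x: "x \<in> ?U" for x
        proof (rule ccontr)
          assume *: "\<not> ?thesis"
          let ?t = "2 * ?H / N (x - a)"
          let ?z = "a + ?t *\<^sub>R (x - a)"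
          have "0 \<le> ?t" "?t \<le> 1" using * H by auto
          then have z: "?z \<in> ?U" using x n ne by (intro strict_cell_star_shaped) auto
          have zN: "N (?z - a) = 2 * ?H" using * H by (simp add: N_scale)
          have "D n ?z = N (?z - a)" using z n ne a by (intro set_dist_strict_cell) auto
          then show False using DH[of ?z] zN H by linarith
        qed
        have Um: "?U \<in> sets borel" using n ne by simp
        have U1: "?U \<subseteq> cball a 1" using close U \<delta>(2) by (force simp: dist_norm norm_minus_commute)
        have bU: "bounded ?U" using U1 by (rule bounded_subset[rotated]) simp
        let ?c = "c\<^sub>0 * exp (1 / 2) * exp (- (q (a - m) / 2))"
        have "ennreal (c * h n powr ?p) \<le> cell_cost N r P (\<alpha> n) a" using n a ne by (rule c(2))
        also have "\<dots> \<le> (\<integral>\<^sup>+x. ennreal ((5 * ?H) powr r) * indicator ?U x \<partial>P)"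
          unfolding cell_cost_def
        proof (intro nn_integral_mono)
          fix x
          have "set_dist N x (\<alpha> n - {a}) \<le> 5 * ?H" if "x \<in> ?U"
            using set_dist_lipschitz[of "\<alpha> n - {a}" x a] ne n neighbour U[OF that] by simp
          then show "ennreal (set_dist N x (\<alpha> n - {a}) powr r) * indicator ?U x
              \<le> ennreal ((5 * ?H) powr r) * indicator ?U x"
            using r_pos n ne
            by (auto split: split_indicator intro!: ennreal_leI powr_mono2 set_dist_nonneg)
        qed
        also have "\<dots> = ennreal ((5 * ?H) powr r) * emeasure P ?U"
          using Um sets_P by (subst nn_integral_cmult_indicator) auto
        also have "\<dots> \<le> ennreal ((5 * ?H) powr r) * ennreal (?c * vol ?U)"
        proof (intro mult_left_mono emeasure_P_le Um bU)
          fix x assume "x \<in> ?U"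
          then have "\<bar>q (x - m) - q (a - m)\<bar> \<le> 1" by (intro \<delta>(3) aR close U)
          then have "exp (- q (x - m) / 2) \<le> exp (1 / 2 + - (q (a - m) / 2))" by simp
          then show "f x \<le> ?c" using c\<^sub>0_pos unfolding exp_add by (simp add: mult.assoc)
        qed (use c\<^sub>0_pos in auto)
        also have "\<dots> = ennreal ((5 * ?H) powr r * (?c * vol ?U))"
          using c\<^sub>0_pos by (intro ennreal_mult[symmetric]) auto
        finally have "c * h n powr ?p \<le> (5 * ?H) powr r * (?c * vol ?U)"
          using c\<^sub>0_pos by (subst (asm) ennreal_le_iff) auto
        also have "(5 * ?H) powr r = (5 * C') powr r * \<phi> a powr r * h n powr r"
          using C' hn by (simp add: powr_mult)
        finally have "h n powr r * (c * h n ^ CARD('d))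
            \<le> h n powr r * ((5 * C') powr r * \<phi> a powr r * (?c * vol ?U))"
          unfolding h_powr_p[OF n] by (simp add: mult_ac)
        then have "c * h n ^ CARD('d) \<le> (5 * C') powr r * \<phi> a powr r * (?c * vol ?U)"
          using hn by (subst (asm) mult_le_cancel_left_pos) auto
        also have "\<dots> = (5 * C') powr r * (c\<^sub>0 * exp (1 / 2)) * vol ?U * (\<phi> a powr r * exp (- (q (a - m) / 2)))"
          by (simp only: mult_ac)
        also have "\<phi> a powr r * exp (- (q (a - m) / 2)) = 1 / \<phi> a ^ CARD('d)"
        proof -
          have "\<phi> a powr r * exp (- (q (a - m) / 2)) * \<phi> a ^ CARD('d)
            = exp (r * (q (a - m) / (2 * ?p)) + - (q (a - m) / 2) + real CARD('d) * (q (a - m) / (2 * ?p)))"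
          proof -
            have "\<phi> a powr r = exp (r * (q (a - m) / (2 * ?p)))"
              unfolding exp_powr_real by (simp only: mult.commute)
            then show ?thesis unfolding exp_add exp_of_nat_mult by (simp only:)
          qed
          also have "r * (q (a - m) / (2 * ?p)) + - (q (a - m) / 2) + real CARD('d) * (q (a - m) / (2 * ?p)) = 0"
            using p_pos by (simp add: field_simps)
          finally show ?thesis by (simp add: field_simps)
        qed
        finally have "c * h n ^ CARD('d) * \<phi> a ^ CARD('d)
          \<le> (5 * C') powr r * (c\<^sub>0 * exp (1 / 2)) * vol ?U"
          by (simp add: field_simps)
        then have "k * (h n * \<phi> a) ^ CARD('d) \<le> vol ?U"
          unfolding k_def power_mult_distrib using C' c\<^sub>0_pos by (simp add: field_simps)
        then show "\<alpha> n - {a} \<noteq> {} \<and> ?U \<subseteq> cball a 1 \<and> k * (h n * \<phi> a) ^ CARD('d) \<le> vol ?U"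
          using ne U1 by blast
      qed
    qed
  qed
  with k show thesis by (rule that)
qed

text \<open>
  The cells of the points in \<open>cball m (R + 1)\<close> are disjoint and have volume at least \<open>c * (h n * \<phi> a) ^ d\<close>. Balls of
  radius \<open>\<kappa> * h n * \<phi> a\<close> around these points thus have a total volume of at most half that of \<open>cball m R\<close> if \<open>\<kappa>\<close> is
  small. Neither \<open>\<kappa>\<close> nor \<open>k\<close> depends on \<open>R\<close>.
\<close>

lemma far_points_volume:
  obtains k where "0 < k"
    "\<And>R. 1 \<le> R \<Longrightarrow> \<forall>\<^sub>F n in sequentially.
      \<exists>G\<in>sets borel. bounded G \<and> ball_vol TYPE('d) * R ^ CARD('d) / 2 \<le> vol G \<and> (\<forall>x\<in>G. k * \<phi> x * h n \<le> D n x)"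
proof -
  let ?p = "r + real CARD('d)"
  let ?V = "ball_vol TYPE('d)"
  obtain c where c: "0 < c"
    "\<And>R. \<forall>\<^sub>F n in sequentially. \<forall>a\<in>\<alpha> n. norm (a - m) \<le> R \<longrightarrow>
      \<alpha> n - {a} \<noteq> {} \<and> strict_cell N (\<alpha> n) a \<subseteq> cball a 1 \<and>
      c * (h n * \<phi> a) ^ CARD('d) \<le> vol (strict_cell N (\<alpha> n) a)"
    using cell_volume by blast
  define \<kappa> where "\<kappa> = A * root CARD('d) (c / (2 * 3 ^ CARD('d) * ?V))"
  have \<kappa>: "0 < \<kappa>" using A_pos c V_pos by (simp add: \<kappa>_def)
  have \<kappa>_eq: "?V * (\<kappa> / A) ^ CARD('d) = c / (2 * 3 ^ CARD('d))"
    using A_pos c V_pos by (simp add: \<kappa>_def field_simps)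
  define k where "k = \<kappa> * exp (- 1 / (2 * ?p))"
  have k: "0 < k" using \<kappa> by (simp add: k_def)
  have "\<forall>\<^sub>F n in sequentially. \<exists>G\<in>sets borel. bounded G \<and> ?V * R ^ CARD('d) / 2 \<le> vol G \<and> (\<forall>x\<in>G. k * \<phi> x * h n \<le> D n x)"
    if R: "1 \<le> R" for R
  proof -
    obtain \<delta> where \<delta>: "0 < \<delta>" "\<delta> \<le> 1"
      "\<And>x y. norm (y - m) \<le> R \<Longrightarrow> norm (x - y) \<le> \<delta> \<Longrightarrow> \<bar>q (x - m) - q (y - m)\<bar> \<le> 1"
      using q_locally_uniform by blast
    have A\<delta>: "0 < A * \<delta>" using A_pos \<delta> by simp
    from c(2)[of "R + 1"] D_uniformly_small[OF A\<delta>, of R] eventually_ge_at_top[of 1]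
    show ?thesis
    proof eventually_elim
      case (elim n)
      have n: "1 \<le> n" and hn: "0 < h n" using elim(3) by (auto intro: h_pos)
      let ?T = "\<alpha> n \<inter> cball m (R + 1)"
      have fT: "finite ?T" using n by simp
      have T: "a \<in> \<alpha> n" "\<alpha> n - {a} \<noteq> {}" "strict_cell N (\<alpha> n) a \<subseteq> cball a 1"
        "c * (h n * \<phi> a) ^ CARD('d) \<le> vol (strict_cell N (\<alpha> n) a)" if "a \<in> ?T" for a
        using elim(1) that by (auto simp: dist_norm norm_minus_commute)
      let ?\<tau> = "\<lambda>a. \<kappa> * (h n * \<phi> a)"
      have \<tau>: "0 \<le> ?\<tau> a" for a using \<kappa> hn by simp
      let ?G = "{x \<in> cball m R. \<forall>a\<in>?T. ?\<tau> a < N (x - a)}"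
      have eq: "?G = cball m R \<inter> \<Inter> ((\<lambda>a. {x. ?\<tau> a < N (x - a)}) ` ?T)" by auto
      have G: "?G \<in> sets borel"
      proof (cases "?T = {}")
        case False
        have "{x. ?\<tau> a < N (x - a)} \<in> sets borel" for a by measurable
        then show ?thesis unfolding eq using fT False by (intro sets.Int sets.finite_INT) auto
      qed (auto simp: Collect_conj_eq)
      have bG: "bounded ?G" by (rule bounded_subset[of "cball m R"]) auto
      have "c * (\<Sum>a\<in>?T. (h n * \<phi> a) ^ CARD('d)) \<le> (\<Sum>a\<in>?T. vol (strict_cell N (\<alpha> n) a))"
        unfolding sum_distrib_left by (intro sum_mono T(4))
      also have "\<dots> \<le> vol (cball m (R + 2))"
      proof (rule sum_vol_disjoint_le[OF fT])
        show "disjoint_family_on (strict_cell N (\<alpha> n)) ?T"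
          unfolding disjoint_family_on_def using strict_cells_disjoint[OF \<alpha>_finite[OF n]] by blast
        show "strict_cell N (\<alpha> n) a \<in> sets borel" if "a \<in> ?T" for a using n T(2)[OF that] by simp
        show "strict_cell N (\<alpha> n) a \<subseteq> cball m (R + 2)" if a: "a \<in> ?T" for a
        proof
          fix x assume "x \<in> strict_cell N (\<alpha> n) a"
          then have "dist a x \<le> 1" using T(3)[OF a] by auto
          moreover have "dist m a \<le> R + 1" using a by simp
          ultimately show "x \<in> cball m (R + 2)" using dist_triangle[of m x a] by simp
        qed
      qed auto
      also have "\<dots> = ?V * (R + 2) ^ CARD('d)" using R by (intro vol_cball) simp
      also have "\<dots> \<le> ?V * (3 * R) ^ CARD('d)" using R V_pos by (intro mult_left_mono power_mono) auto
      finally have sum_le: "c * (\<Sum>a\<in>?T. (h n * \<phi> a) ^ CARD('d)) \<le> ?V * (3 ^ CARD('d) * R ^ CARD('d))"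
        by (simp add: power_mult_distrib)
      have "(\<Sum>a\<in>?T. ?V * (?\<tau> a / A) ^ CARD('d)) = (\<Sum>a\<in>?T. ?V * (\<kappa> / A) ^ CARD('d) * (h n * \<phi> a) ^ CARD('d))"
        by (intro sum.cong) (simp_all add: power_mult_distrib power_divide)
      also have "\<dots> = ?V * (\<kappa> / A) ^ CARD('d) * (\<Sum>a\<in>?T. (h n * \<phi> a) ^ CARD('d))"
        by (simp only: sum_distrib_left)
      also have "\<dots> = (c * (\<Sum>a\<in>?T. (h n * \<phi> a) ^ CARD('d))) / (2 * 3 ^ CARD('d))"
        unfolding \<kappa>_eq by simp
      also have "\<dots> \<le> ?V * (3 ^ CARD('d) * R ^ CARD('d)) / (2 * 3 ^ CARD('d))"
        by (intro divide_right_mono sum_le) simp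
      also have "\<dots> = ?V * R ^ CARD('d) / 2" by (simp add: field_simps)
      finally have "vol (cball m R) - ?V * R ^ CARD('d) / 2 \<le> vol ?G"
        using vol_far_from_finite[OF fT, of "cball m R" ?\<tau>] \<tau> by simp
      then have volG: "?V * R ^ CARD('d) / 2 \<le> vol ?G"
        using R vol_cball[of R m] by linarith
      have "k * \<phi> x * h n \<le> D n x" if x: "x \<in> ?G" for x
      proof -
        obtain a where a: "a \<in> \<alpha> n" "D n x = N (x - a)"
          using set_dist_attained[OF \<alpha>_finite[OF n] \<alpha>_nonempty[OF n]] by blast
        have xR: "norm (x - m) \<le> R" using x by (simp add: dist_norm norm_minus_commute)
        have "A * norm (x - a) \<le> A * \<delta>"
          using norm_le_N[of "x - a"] elim(2) xR a(2) by (metis order_trans)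
        then have ax: "norm (a - x) \<le> \<delta>" using A_pos by (simp add: norm_minus_commute)
        have "norm (a - m) \<le> R + 1"
          using norm_triangle_ineq[of "a - x" "x - m"] ax xR \<delta>(2) by simp
        then have "a \<in> ?T" using a by (simp add: dist_norm norm_minus_commute)
        then have "?\<tau> a < D n x" using x a by auto
        moreover have "exp (- 1 / (2 * ?p)) * \<phi> x \<le> \<phi> a"
          unfolding exp_add[symmetric] add_divide_distrib[symmetric]
          using \<delta>(3)[OF xR ax] p_pos by (simp add: divide_right_mono)
        then have "(\<kappa> * h n) * (exp (- 1 / (2 * ?p)) * \<phi> x) \<le> (\<kappa> * h n) * \<phi> a"
          using \<kappa> hn by (intro mult_left_mono) auto
        ultimately show ?thesis unfolding k_def by (simp add: mult_ac)
      qed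
      with G bG volG show ?case by blast
    qed
  qed
  with k show thesis by (rule that)
qed

text \<open>
  For these \<open>\<theta>\<close> the factor \<open>exp (- \<theta>\<^sup>2 * q (y - m) / 2)\<close> does not compensate \<open>\<phi> y powr s\<close>, so on the set of
  \<open>far_points_volume\<close> the normalized integrand is bounded below by a constant independent of \<open>R\<close>, whereas
  the volume of that set grows like \<open>R\<^sup>d\<close>.
\<close>

theorem dilatation_not_rate_optimal:
  assumes s: "0 < s" and \<theta>: "0 < \<theta>" and small: "\<theta>\<^sup>2 * (r + real CARD('d)) \<le> s"
  shows "\<not> Ls_rate_optimal N s P (\<lambda>n. dilate \<theta> m (\<alpha> n))"
proof
  let ?p = "r + real CARD('d)"
  let ?V = "ball_vol TYPE('d)"
  let ?X = "\<lambda>n. ennreal (real n powr (s / real CARD('d))) * distortion N s P (dilate \<theta> m (\<alpha> n))"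
  assume "Ls_rate_optimal N s P (\<lambda>n. dilate \<theta> m (\<alpha> n))"
  then have "limsup ?X < \<infinity>" unfolding Ls_rate_optimal_def .
  then obtain M :: nat where "limsup ?X < of_nat M" using ennreal_Ex_less_of_nat by auto
  then have M: "\<forall>\<^sub>F n in sequentially. ?X n < of_nat M" by (rule Limsup_lessD)
  obtain k where k: "0 < k"
    "\<And>R. 1 \<le> R \<Longrightarrow> \<forall>\<^sub>F n in sequentially.
      \<exists>G\<in>sets borel. bounded G \<and> ?V * R ^ CARD('d) / 2 \<le> vol G \<and> (\<forall>x\<in>G. k * \<phi> x * h n \<le> D n x)"
    using far_points_volume by blast
  define K where "K = \<theta> ^ CARD('d) * \<theta> powr s * (c\<^sub>0 * k powr s) * (?V / 2)"
  have K: "0 < K" using \<theta> c\<^sub>0_pos k V_pos by (simp add: K_def)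
  define R where "R = max 1 (real M / K)"
  have R: "1 \<le> R" by (simp add: R_def)
  have "real M \<le> K * R" using K by (simp add: R_def max_def field_simps)
  also have "\<dots> \<le> K * R ^ CARD('d)" using K R by (intro mult_left_mono self_le_power) auto
  finally have MK: "real M \<le> K * R ^ CARD('d)" .
  have "\<forall>\<^sub>F n in sequentially. False"
    using M k(2)[OF R] eventually_ge_at_top[of 1]
  proof eventually_elim
    case (elim n)
    then have hn: "0 < h n" by (intro h_pos)
    obtain G where G: "G \<in> sets borel" "bounded G" "?V * R ^ CARD('d) / 2 \<le> vol G"
      "\<And>x. x \<in> G \<Longrightarrow> k * \<phi> x * h n \<le> D n x" using elim(2) by blast
    let ?c = "c\<^sub>0 * k powr s * h n powr s"
    have c: "0 \<le> ?c" using c\<^sub>0_pos by simp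
    have "ennreal (?c * (?V * R ^ CARD('d) / 2)) \<le> ennreal (?c * vol G)"
      using c by (intro ennreal_leI mult_left_mono G(3))
    also have "\<dots> = ennreal ?c * emeasure lborel G"
      using c G(1,2) by (subst emeasure_eq_measure2) (auto simp: ennreal_mult intro!: fmeasurable_bounded_borel)
    also have "\<dots> = (\<integral>\<^sup>+y. ennreal ?c * indicator G y \<partial>lborel)"
      using G by (subst nn_integral_cmult_indicator) auto
    also have "\<dots> \<le> (\<integral>\<^sup>+y. ennreal (c\<^sub>0 * exp (- \<theta>\<^sup>2 * q (y - m) / 2) * D n y powr s) \<partial>lborel)"
    proof (intro nn_integral_mono)
      fix y
      have "?c \<le> c\<^sub>0 * exp (- \<theta>\<^sup>2 * q (y - m) / 2) * D n y powr s" if y: "y \<in> G"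
      proof -
        have "\<theta>\<^sup>2 \<le> s / ?p" using small p_pos by (simp add: field_simps)
        then have "\<theta>\<^sup>2 * (q (y - m) / 2) \<le> s / ?p * (q (y - m) / 2)"
          using q_nonneg by (intro mult_right_mono) auto
        then have "1 \<le> exp (- \<theta>\<^sup>2 * q (y - m) / 2 + s * (q (y - m) / (2 * ?p)))"
          by (simp add: mult_ac)
        then have "?c * 1 \<le> ?c * (exp (- \<theta>\<^sup>2 * q (y - m) / 2) * exp (s * (q (y - m) / (2 * ?p))))"
          unfolding exp_add using c by (intro mult_left_mono)
        also have "\<dots> = c\<^sub>0 * exp (- \<theta>\<^sup>2 * q (y - m) / 2) * (k * \<phi> y * h n) powr s"
          using k hn by (simp add: powr_mult exp_powr_real mult_ac)
        also have "\<dots> \<le> c\<^sub>0 * exp (- \<theta>\<^sup>2 * q (y - m) / 2) * D n y powr s"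
          using G(4)[OF y] c\<^sub>0_pos k hn s by (intro mult_left_mono powr_mono2) auto
        finally show ?thesis by simp
      qed
      then show "ennreal ?c * indicator G y \<le> ennreal (c\<^sub>0 * exp (- \<theta>\<^sup>2 * q (y - m) / 2) * D n y powr s)"
        by (auto split: split_indicator intro!: ennreal_leI)
    qed
    finally have "ennreal (\<theta> ^ CARD('d) * \<theta> powr s * h n powr - s) * ennreal (?c * (?V * R ^ CARD('d) / 2)) \<le> ?X n"
      unfolding normalized_distortion_dilate[OF elim(3) \<theta>] by (intro mult_left_mono) auto
    also have "ennreal (\<theta> ^ CARD('d) * \<theta> powr s * h n powr - s) * ennreal (?c * (?V * R ^ CARD('d) / 2))
      = ennreal ((\<theta> ^ CARD('d) * \<theta> powr s * h n powr - s) * (?c * (?V * R ^ CARD('d) / 2)))"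
      using \<theta> c V_pos R by (intro ennreal_mult[symmetric]) auto
    also have "(\<theta> ^ CARD('d) * \<theta> powr s * h n powr - s) * (?c * (?V * R ^ CARD('d) / 2)) = K * R ^ CARD('d)"
      using hn by (simp add: K_def powr_minus field_simps)
    finally have "ennreal (K * R ^ CARD('d)) < of_nat M" using elim(1) by (rule le_less_trans)
    then have "K * R ^ CARD('d) < real M"
    proof -
      have "0 \<le> K * R ^ CARD('d)" using K R by (intro mult_nonneg_nonneg zero_le_power) auto
      then show ?thesis using \<open>ennreal (K * R ^ CARD('d)) < of_nat M\<close>
        by (simp only: ennreal_of_nat_eq_real_of_nat ennreal_less_iff)
    qed
    then show False using MK by simp
  qed
  then show False by simp
qed

end

section \<open>Positive definite matrices\<close>

text \<open>
  \<open>lam\<close> and \<open>Lam\<close> are the extreme values on the unit sphere; \<open>q_add\<close> expands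
  \<open>0 \<le> q (sqrt \<epsilon> *\<^sub>R x - (1 / sqrt \<epsilon>) *\<^sub>R y)\<close>.
\<close>

lemma quad_form_matrix:
  fixes M :: "real ^ 'd ^ 'd"
  assumes pos: "\<And>x. x \<noteq> 0 \<Longrightarrow> 0 < x \<bullet> (M *v x)"
  obtains lam Lam where "quad_form (\<lambda>x. x \<bullet> (M *v x)) lam Lam"
proof -
  let ?q = "\<lambda>x. x \<bullet> (M *v x)"
  have cont: "continuous_on S ?q" for S
    by (intro continuous_intros linear_continuous_on linear_conv_bounded_linear[THEN iffD1]
        matrix_vector_mul_linear)
  have scale: "?q (c *\<^sub>R x) = c\<^sup>2 * ?q x" for c x
    by (simp add: matrix_vector_mult_scaleR power2_eq_square)
  have nonneg: "0 \<le> ?q x" for x using pos[of x] by (cases "x = 0") (auto intro: less_imp_le)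
  have sphere: "compact (sphere 0 1 :: (real ^ 'd) set)" "sphere 0 1 \<noteq> ({} :: (real ^ 'd) set)"
    by simp_all
  obtain z where z: "z \<in> sphere 0 1" "\<And>y. y \<in> sphere 0 1 \<Longrightarrow> ?q z \<le> ?q y"
    using continuous_attains_inf[OF sphere cont] by blast
  obtain Z where Z: "Z \<in> sphere 0 1" "\<And>y. y \<in> sphere 0 1 \<Longrightarrow> ?q y \<le> ?q Z"
    using continuous_attains_sup[OF sphere cont] by blast
  have "?q z * (norm x)\<^sup>2 \<le> ?q x \<and> ?q x \<le> ?q Z * (norm x)\<^sup>2" for x
  proof (cases "x = 0")
    case False
    let ?u = "(1 / norm x) *\<^sub>R x"
    have u: "?u \<in> sphere 0 1" using False by simp
    have "?q ?u = ?q x / (norm x)\<^sup>2" unfolding scale by (simp add: power_divide)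
    then have "?q z \<le> ?q x / (norm x)\<^sup>2" "?q x / (norm x)\<^sup>2 \<le> ?q Z" using z(2)[OF u] Z(2)[OF u] by auto
    then show ?thesis using False by (simp add: pos_le_divide_eq pos_divide_le_eq)
  qed simp
  moreover have "?q (x + y) \<le> (1 + \<epsilon>) * ?q x + (1 + 1 / \<epsilon>) * ?q y" if \<epsilon>: "0 < \<epsilon>" for \<epsilon> x y
  proof -
    let ?c = "sqrt \<epsilon>"
    have c: "0 < ?c" "?c * ?c = \<epsilon>" using \<epsilon> by auto
    have "0 \<le> ?q (?c *\<^sub>R x - (1 / ?c) *\<^sub>R y)" by (rule nonneg)
    also have "\<dots> = ?c * ?c * ?q x + 1 / (?c * ?c) * ?q y - (x \<bullet> (M *v y) + y \<bullet> (M *v x))"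
      using c(1) by (simp add: matrix_vector_mult_diff_distrib matrix_vector_mult_scaleR inner_diff_left
          inner_diff_right algebra_simps)
    finally have "x \<bullet> (M *v y) + y \<bullet> (M *v x) \<le> \<epsilon> * ?q x + 1 / \<epsilon> * ?q y" unfolding c(2) by linarith
    then show ?thesis
      by (simp add: matrix_vector_right_distrib inner_add_left inner_add_right algebra_simps)
  qed
  moreover have "0 < ?q z" using z(1) by (intro pos) auto
  ultimately have "quad_form ?q (?q z) (?q Z)"
    using cont scale by unfold_locales auto
  then show thesis by (rule that)
qed

lemma pos_def_matrix_invertible:
  fixes S :: "real ^ 'd ^ 'd"
  assumes "pos_def_matrix S"
  shows "invertible S"
proof -
  have "S *v x = 0 \<Longrightarrow> x = 0" for x
    using assms unfolding pos_def_matrix_def by (metis inner_zero_right less_irrefl)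
  then show ?thesis
    using matrix_left_invertible_ker[of S] invertible_left_inverse[of S] by blast
qed

lemma pos_def_matrix_inv_pos:
  fixes S :: "real ^ 'd ^ 'd"
  assumes S: "pos_def_matrix S" and x: "x \<noteq> 0"
  shows "0 < x \<bullet> (matrix_inv S *v x)"
proof -
  let ?y = "matrix_inv S *v x"
  have Sy: "S *v ?y = x"
  proof -
    have "S ** matrix_inv S = mat 1"
      using pos_def_matrix_invertible[OF S] someI_ex[of "\<lambda>T. S ** T = mat 1 \<and> T ** S = mat 1"]
      unfolding invertible_def matrix_inv_def by blast
    then show ?thesis by (simp add: matrix_vector_mul_assoc)
  qed
  then have "?y \<noteq> 0" using x by auto
  then have "0 < ?y \<bullet> (S *v ?y)" using S unfolding pos_def_matrix_def by blast
  then show ?thesis unfolding Sy by (simp add: inner_commute)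
qed

text \<open>The segment from the identity matrix to \<open>S\<close> consists of positive definite, hence invertible,
  matrices, so the determinant cannot change sign along it.\<close>

lemma pos_def_matrix_det_pos:
  fixes S :: "real ^ 'd ^ 'd"
  assumes S: "pos_def_matrix S"
  shows "0 < det S"
proof (rule ccontr)
  assume "\<not> 0 < det S"
  define g where "g t = det ((1 - t) *\<^sub>R mat 1 + t *\<^sub>R S)" for t :: real
  have g: "g 0 = 1" "g 1 = det S" by (simp_all add: g_def)
  have "continuous_on {0..1} g" unfolding g_def det_def by (intro continuous_intros)
  moreover have "g 1 \<le> 0" "0 \<le> g 0" using \<open>\<not> 0 < det S\<close> g by auto
  ultimately obtain t where t: "0 \<le> t" "t \<le> 1" "g t = 0"
    using IVT2'[of g 1 0 0] by auto
  let ?M = "(1 - t) *\<^sub>R mat 1 + t *\<^sub>R S"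
  have "?M *v x = 0 \<Longrightarrow> x = 0" for x
  proof (rule ccontr)
    assume M: "?M *v x = 0" and x: "x \<noteq> 0"
    have "x \<bullet> (?M *v x) = (1 - t) * (x \<bullet> x) + t * (x \<bullet> (S *v x))"
      by (simp add: matrix_vector_mult_add_rdistrib scaleR_matrix_vector_assoc[symmetric] inner_add_right)
    moreover have "0 < x \<bullet> x" "0 < x \<bullet> (S *v x)" using x S by (auto simp: pos_def_matrix_def)
    then have "0 < (1 - t) * (x \<bullet> x) + t * (x \<bullet> (S *v x))"
      using t by (cases "t = 0") (auto intro: add_nonneg_pos)
    ultimately show False using M by simp
  qed
  then have "invertible ?M"
    using matrix_left_invertible_ker[of ?M] invertible_left_inverse[of ?M] by blast
  then show False using t(3) unfolding g_def invertible_det_nz by simp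
qed

section \<open>The upper bound as a function of the dilatation factor\<close>

lemma sqrt_less_iff_less_square: "0 < y \<Longrightarrow> sqrt x < y \<longleftrightarrow> x < y\<^sup>2"
  using real_sqrt_less_iff[of x "y\<^sup>2"] by simp

lemma ln_less_minus_one: "0 < x \<Longrightarrow> x \<noteq> 1 \<Longrightarrow> ln x < x - (1 :: real)"
  using ln_le_minus_one[of x] ln_eq_minus_one[of x] by linarith

definition profile :: "real \<Rightarrow> real \<Rightarrow> real \<Rightarrow> real \<Rightarrow> real" where
  "profile a \<sigma> \<kappa> \<theta> = \<theta> powr a * (\<theta>\<^sup>2 - \<sigma>) powr - \<kappa>"

text \<open>
  In the variable \<open>w = \<sigma> / x\<^sup>2\<close> the logarithm is \<open>- (a / 2 - \<kappa>) * ln w - \<kappa> * ln (1 - w)\<close> up to a constant. The inequality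
  \<open>ln z < z - 1\<close>, applied to the ratios \<open>w / w'\<close> and \<open>(1 - w) / (1 - w')\<close>, compares it with its value at \<open>w'\<close>; the linear
  terms cancel because \<open>w' = (a - 2 * \<kappa>) / a\<close> is the critical point.
\<close>

lemma profile_strict_min:
  assumes \<sigma>: "0 < \<sigma>" and \<kappa>: "0 < \<kappa>" "2 * \<kappa> < a"
    and \<theta>: "sqrt \<sigma> < \<theta>" and \<tau>: "0 < \<tau>" "\<tau>\<^sup>2 = a * \<sigma> / (a - 2 * \<kappa>)" and ne: "\<theta> \<noteq> \<tau>"
  shows "profile a \<sigma> \<kappa> \<tau> < profile a \<sigma> \<kappa> \<theta>"
proof -
  have a: "0 < a" using \<kappa> by simp
  have \<theta>0: "0 < \<theta>" using \<theta> \<sigma> by (meson less_trans real_sqrt_gt_zero)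
  have \<sigma>\<theta>: "\<sigma> < \<theta>\<^sup>2" using \<theta> \<sigma> \<theta>0 by (simp add: sqrt_less_iff_less_square)
  have \<sigma>\<tau>: "\<sigma> < \<tau>\<^sup>2" unfolding \<tau> using \<sigma> \<kappa> a by (simp add: pos_less_divide_eq algebra_simps)
  have ln_profile: "ln (profile a \<sigma> \<kappa> x) = (a / 2 - \<kappa>) * (ln \<sigma> - ln (\<sigma> / x\<^sup>2)) - \<kappa> * ln (1 - \<sigma> / x\<^sup>2)"
    if x: "0 < x" "\<sigma> < x\<^sup>2" for x
  proof -
    have "x\<^sup>2 - \<sigma> = x\<^sup>2 * (1 - \<sigma> / x\<^sup>2)" using x by (simp add: field_simps)
    moreover have "0 < 1 - \<sigma> / x\<^sup>2" using x by simp
    ultimately have "ln (x\<^sup>2 - \<sigma>) = ln (x\<^sup>2) + ln (1 - \<sigma> / x\<^sup>2)" using x by (simp add: ln_mult)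
    moreover have "ln (profile a \<sigma> \<kappa> x) = a * ln x - \<kappa> * ln (x\<^sup>2 - \<sigma>)"
      using x by (simp add: profile_def ln_mult ln_powr)
    moreover have "ln (\<sigma> / x\<^sup>2) = ln \<sigma> - ln (x\<^sup>2)" using x \<sigma> by (simp add: ln_div)
    moreover have "ln (x\<^sup>2) = 2 * ln x" using x by (simp add: ln_realpow)
    ultimately have "ln \<sigma> - ln (\<sigma> / x\<^sup>2) = 2 * ln x"
      "ln (profile a \<sigma> \<kappa> x) = a * ln x - \<kappa> * (2 * ln x + ln (1 - \<sigma> / x\<^sup>2))" by simp_all
    then show ?thesis by (simp add: algebra_simps)
  qed
  define w where "w = \<sigma> / \<theta>\<^sup>2"
  define w' where "w' = \<sigma> / \<tau>\<^sup>2"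
  have w: "0 < w" "w < 1" using \<sigma> \<sigma>\<theta> \<theta>0 by (auto simp: w_def)
  have w': "0 < w'" "w' < 1" using \<sigma> \<sigma>\<tau> \<tau>(1) by (auto simp: w'_def)
  have w'_eq: "w' = (a - 2 * \<kappa>) / a" unfolding w'_def \<tau>(2) using \<sigma> by simp
  have "\<theta>\<^sup>2 \<noteq> \<tau>\<^sup>2" using ne \<theta>0 \<tau>(1) by (simp add: power2_eq_iff_nonneg)
  then have "w \<noteq> w'" unfolding w_def w'_def using \<sigma> by simp
  then have "ln (w / w') < w / w' - 1" using w w' by (intro ln_less_minus_one) auto
  then have "(a / 2 - \<kappa>) * ln (w / w') < (a / 2 - \<kappa>) * (w / w' - 1)"
    using \<kappa> by (intro mult_strict_left_mono) auto
  moreover have "\<kappa> * ln ((1 - w) / (1 - w')) \<le> \<kappa> * ((1 - w) / (1 - w') - 1)"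
    using \<kappa> w w' by (intro mult_left_mono ln_le_minus_one) auto
  moreover have "(a / 2 - \<kappa>) * (w / w' - 1) + \<kappa> * ((1 - w) / (1 - w') - 1) = 0"
  proof -
    have "(a / 2 - \<kappa>) * (w / w' - 1) = (a / 2 - \<kappa>) / w' * (w - w')" using w' by (simp add: field_simps)
    also have "(a / 2 - \<kappa>) / w' = a / 2" unfolding w'_eq using \<kappa> a by (simp add: field_simps)
    finally have 1: "(a / 2 - \<kappa>) * (w / w' - 1) = a / 2 * (w - w')" .
    have "\<kappa> * ((1 - w) / (1 - w') - 1) = \<kappa> / (1 - w') * (w' - w)" using w' by (simp add: field_simps)
    also have "\<kappa> / (1 - w') = a / 2"
    proof -
      have "1 - w' = 2 * \<kappa> / a" unfolding w'_eq using a by (simp add: field_simps)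
      then show ?thesis using \<kappa> a by simp
    qed
    finally have 2: "\<kappa> * ((1 - w) / (1 - w') - 1) = a / 2 * (w' - w)" .
    show ?thesis unfolding 1 2 distrib_left[symmetric] by simp
  qed
  moreover have "ln (w / w') = ln w - ln w'" "ln ((1 - w) / (1 - w')) = ln (1 - w) - ln (1 - w')"
    using w w' by (simp_all add: ln_div)
  ultimately have "(a / 2 - \<kappa>) * (ln w - ln w') + \<kappa> * (ln (1 - w) - ln (1 - w')) < 0" by simp
  then have "ln (profile a \<sigma> \<kappa> \<tau>) < ln (profile a \<sigma> \<kappa> \<theta>)"
    unfolding ln_profile[OF \<tau>(1) \<sigma>\<tau>] ln_profile[OF \<theta>0 \<sigma>\<theta>] w_def[symmetric] w'_def[symmetric]
    by (simp only: right_diff_distrib)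
  moreover have "0 < profile a \<sigma> \<kappa> \<theta>" "0 < profile a \<sigma> \<kappa> \<tau>"
    using \<theta>0 \<tau>(1) \<sigma>\<theta> \<sigma>\<tau> by (auto simp: profile_def)
  ultimately show ?thesis by simp
qed

lemma is_arg_min_profile_iff:
  assumes \<sigma>: "0 < \<sigma>" and \<kappa>: "0 < \<kappa>" "2 * \<kappa> < a" and K: "0 < K"
    and F: "\<And>\<theta>. sqrt \<sigma> < \<theta> \<Longrightarrow> F \<theta> = ennreal (K * profile a \<sigma> \<kappa> \<theta>)"
    and \<tau>: "0 < \<tau>" "\<tau>\<^sup>2 = a * \<sigma> / (a - 2 * \<kappa>)"
  shows "is_arg_min F (\<lambda>t. t \<in> {sqrt \<sigma><..}) \<theta> \<longleftrightarrow> \<theta> = \<tau>"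
proof -
  have "\<sigma> < \<tau>\<^sup>2" unfolding \<tau> using \<sigma> \<kappa> by (simp add: pos_less_divide_eq algebra_simps)
  then have \<tau>_dom: "sqrt \<sigma> < \<tau>" using \<tau>(1) by (simp add: sqrt_less_iff_less_square)
  have less: "F \<tau> < F \<theta>" if "sqrt \<sigma> < \<theta>" "\<theta> \<noteq> \<tau>" for \<theta>
  proof -
    have "K * profile a \<sigma> \<kappa> \<tau> < K * profile a \<sigma> \<kappa> \<theta>"
      using profile_strict_min[OF \<sigma> \<kappa> that(1) \<tau> that(2)] K by simp
    moreover have "0 \<le> K * profile a \<sigma> \<kappa> \<tau>" using K by (simp add: profile_def)
    ultimately show ?thesis unfolding F[OF that(1)] F[OF \<tau>_dom] by (simp add: ennreal_less_iff)
  qed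
  show ?thesis
  proof
    assume "is_arg_min F (\<lambda>t. t \<in> {sqrt \<sigma><..}) \<theta>"
    then show "\<theta> = \<tau>" using less[of \<theta>] \<tau>_dom unfolding is_arg_min_def by auto
  next
    assume "\<theta> = \<tau>"
    then show "is_arg_min F (\<lambda>t. t \<in> {sqrt \<sigma><..}) \<theta>"
      using less \<tau>_dom unfolding is_arg_min_def by (metis greaterThan_iff less_asym less_irrefl)
  qed
qed

lemma ennpowr_ennreal: "0 \<le> x \<Longrightarrow> ennpowr (ennreal x) p = ennreal (x powr p)"
  by (simp add: ennpowr_def)

context quad_form
begin

lemma nn_integral_exp_q_eq:
  obtains i where "0 < i"
    "\<And>c t. 0 \<le> c \<Longrightarrow> 0 < t \<Longrightarrow>
      (\<integral>\<^sup>+x. ennreal (c * exp (- t * q (x - m))) \<partial>lborel) = ennreal (c * t powr (- real CARD('d) / 2) * i)"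
proof -
  define I where "I = (\<integral>\<^sup>+x. ennreal (exp (- q (x - m))) \<partial>lborel)"
  have "I < \<infinity>" "0 < I" using nn_integral_exp_q_finite[of 1 m] nn_integral_exp_q_pos[of 1 m] by (auto simp: I_def)
  then obtain i where i: "I = ennreal i" "0 < i" by (cases I) auto
  have "(\<integral>\<^sup>+x. ennreal (c * exp (- t * q (x - m))) \<partial>lborel) = ennreal (c * t powr (- real CARD('d) / 2) * i)"
    if "0 \<le> c" "0 < t" for c t
  proof -
    have "(\<integral>\<^sup>+x. ennreal (c * exp (- t * q (x - m))) \<partial>lborel)
        = (\<integral>\<^sup>+x. ennreal c * ennreal (exp (- t * q (x - m))) \<partial>lborel)"
      using that by (simp add: ennreal_mult)
    also have "\<dots> = ennreal c * (\<integral>\<^sup>+x. ennreal (exp (- t * q (x - m))) \<partial>lborel)"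
      by (rule nn_integral_cmult) measurable
    also have "\<dots> = ennreal (c * t powr (- real CARD('d) / 2) * i)"
      unfolding nn_integral_exp_q_scale[OF that(2)] I_def[symmetric] i(1)
      using that i(2) by (simp add: ennreal_mult mult.assoc)
    finally show ?thesis .
  qed
  with i(2) show thesis by (rule that)
qed

context
  fixes N :: "real ^ 'd \<Rightarrow> real" and A B c\<^sub>0 :: real and m :: "real ^ 'd" and f :: "real ^ 'd \<Rightarrow> real"
  assumes N: "vector_norm N A B" and c\<^sub>0: "0 < c\<^sub>0"
    and f: "\<And>x. f x = c\<^sub>0 * exp (- q (x - m) / 2)"
begin

lemma f_pos: "0 < f x"
  using c\<^sub>0 by (simp add: f)

lemma f_powr: "f x powr u = c\<^sub>0 powr u * exp (- (u / 2) * q (x - m))"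
  using c\<^sub>0 by (simp add: f powr_mult exp_powr_real mult_ac)

lemma dilate_density_powr:
  "dilate_density \<theta> m f x powr u = c\<^sub>0 powr u * exp (- (\<theta>\<^sup>2 * u / 2) * q (x - m))"
  unfolding dilate_density_def f_powr by (simp add: q_scale mult_ac)

lemma Q_const_pos_finite:
  assumes r: "0 < r"
  obtains Q where "0 < Q" "Q_const N r f = ennreal Q"
proof -
  let ?d = "real CARD('d)"
  let ?u = "?d / (?d + r)"
  interpret vector_norm N A B by (rule N)
  obtain i where i: "0 < i"
    "\<And>c t. 0 \<le> c \<Longrightarrow> 0 < t \<Longrightarrow>
      (\<integral>\<^sup>+x. ennreal (c * exp (- t * q (x - m))) \<partial>lborel) = ennreal (c * t powr (- ?d / 2) * i)"
    using nn_integral_exp_q_eq by blast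
  have u: "0 < ?u / 2" using r by (simp add: add_pos_pos)
  let ?X = "c\<^sub>0 powr ?u * (?u / 2) powr (- ?d / 2) * i"
  have X: "0 < ?X" using c\<^sub>0 u i(1)     by (intro mult_pos_pos powr_gt_zero[THEN iffD2] i(1) less_imp_neq[OF c\<^sub>0, symmetric]
        less_imp_neq[OF u, symmetric])
  have "(\<integral>\<^sup>+x. ennreal (f x powr ?u) \<partial>lborel) = ennreal ?X"
    unfolding f_powr using u by (intro i(2)) auto
  moreover obtain J where J: "J_const N r = ennreal J" "0 < J"
    using J_const_pos_finite[OF r] by (cases "J_const N r") auto
  ultimately have "Q_const N r f = ennreal (J * ?X powr ((?d + r) / ?d))"
    using X by (simp add: Q_const_def Let_def ennpowr_ennreal ennreal_mult)
  moreover have "0 < J * ?X powr ((?d + r) / ?d)"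
    by (intro mult_pos_pos J(2) powr_gt_zero[THEN iffD2] less_imp_neq[OF X, symmetric])
  ultimately show thesis using that by blast
qed

text \<open>
  The exponents of the two densities differ by \<open>1\<close>, so the integrand is \<open>c\<^sub>0 * exp (- t * q (x - m))\<close>, where \<open>t\<close> is
  \<open>\<theta>\<^sup>2 - s / r\<close> up to a positive factor.
\<close>

lemma Q_sup_profile_if_less:
  assumes s: "0 < s" "s < r"
  obtains K where "0 < K"
    "\<And>\<theta>. sqrt (s / r) < \<theta> \<Longrightarrow>
      Q_sup N r s C f m \<theta> = ennreal (K * profile (s + real CARD('d)) (s / r) (real CARD('d) / 2 * (1 - s / r)) \<theta>)"
proof -
  let ?d = "real CARD('d)"
  obtain i where i: "0 < i"
    "\<And>c t. 0 \<le> c \<Longrightarrow> 0 < t \<Longrightarrow>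
      (\<integral>\<^sup>+x. ennreal (c * exp (- t * q (x - m))) \<partial>lborel) = ennreal (c * t powr (- ?d / 2) * i)"
    using nn_integral_exp_q_eq by blast
  obtain Q where Q: "0 < Q" "Q_const N r f = ennreal Q" using Q_const_pos_finite[of r] s by auto
  define v where "v = r / (2 * (r - s))"
  have v: "0 < v" using s by (simp add: v_def)
  define K where "K = Q powr (s / r) * (c\<^sub>0 * v powr (- ?d / 2) * i) powr (1 - s / r)"
  have K: "0 < K" using Q c\<^sub>0 v i by (simp add: K_def)
  have "Q_sup N r s C f m \<theta> = ennreal (K * profile (s + ?d) (s / r) (?d / 2 * (1 - s / r)) \<theta>)"
    if \<theta>: "sqrt (s / r) < \<theta>" for \<theta>
  proof -
    have "0 < sqrt (s / r)" using s by simp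
    then have \<theta>0: "0 < \<theta>" using \<theta> by linarith
    have z: "0 < \<theta>\<^sup>2 - s / r" using \<theta> \<theta>0 by (simp add: sqrt_less_iff_less_square)
    let ?t = "v * (\<theta>\<^sup>2 - s / r)"
    have t: "0 < ?t" using v z by simp
    have t_eq: "?t = \<theta>\<^sup>2 * (r / (r - s)) / 2 - s / (r - s) / 2"
    proof -
      have "v * (s / r) = s / (r - s) / 2" "v * \<theta>\<^sup>2 = \<theta>\<^sup>2 * (r / (r - s)) / 2"
        using s by (simp_all add: v_def mult_ac)
      then show ?thesis by (simp only: right_diff_distrib)
    qed
    have one: "r / (r - s) - s / (r - s) = 1" using s by (simp add: diff_divide_distrib[symmetric])
    have integrand: "ennreal (dilate_density \<theta> m f x powr (r / (r - s))) / ennreal (f x powr (s / (r - s)))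
        = ennreal (c\<^sub>0 * exp (- ?t * q (x - m)))" for x
    proof -
      have "dilate_density \<theta> m f x powr (r / (r - s)) / f x powr (s / (r - s))
        = c\<^sub>0 powr (r / (r - s) - s / (r - s)) *
          exp (- (\<theta>\<^sup>2 * (r / (r - s)) / 2) * q (x - m) - (- (s / (r - s) / 2) * q (x - m)))"
        unfolding dilate_density_powr f_powr powr_diff exp_diff by simp
      also have "- (\<theta>\<^sup>2 * (r / (r - s)) / 2) * q (x - m) - (- (s / (r - s) / 2) * q (x - m)) = - ?t * q (x - m)"
        unfolding t_eq by (simp add: algebra_simps)
      also have "c\<^sub>0 powr (r / (r - s) - s / (r - s)) = c\<^sub>0" unfolding one using c\<^sub>0 by simp
      finally show ?thesis using f_pos[of x] by (subst divide_ennreal) auto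
    qed
    have "(\<integral>\<^sup>+x\<in>{x. 0 < f x}. ennreal (dilate_density \<theta> m f x powr (r / (r - s))) /
        ennreal (f x powr (s / (r - s))) \<partial>lborel) = ennreal (c\<^sub>0 * ?t powr (- ?d / 2) * i)"
      unfolding integrand using f_pos i(2)[of c\<^sub>0 ?t] c\<^sub>0 t by simp
    then have "Q_sup N r s C f m \<theta> =
        ennreal (\<theta> powr (s + ?d)) * ennreal (Q powr (s / r)) * ennreal ((c\<^sub>0 * ?t powr (- ?d / 2) * i) powr (1 - s / r))"
      using s Q c\<^sub>0 i by (simp add: Q_sup_def Let_def ennpowr_ennreal)
    also have "\<dots> = ennreal (\<theta> powr (s + ?d) * Q powr (s / r) * (c\<^sub>0 * ?t powr (- ?d / 2) * i) powr (1 - s / r))"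
      by (simp add: ennreal_mult)
    also have "(c\<^sub>0 * ?t powr (- ?d / 2) * i) powr (1 - s / r)
      = (c\<^sub>0 * v powr (- ?d / 2) * i) powr (1 - s / r) * (\<theta>\<^sup>2 - s / r) powr (- (?d / 2 * (1 - s / r)))"
    proof -
      have "c\<^sub>0 * ?t powr (- ?d / 2) * i = (c\<^sub>0 * v powr (- ?d / 2) * i) * (\<theta>\<^sup>2 - s / r) powr (- ?d / 2)"
        using v z by (simp add: powr_mult mult_ac)
      then show ?thesis using c\<^sub>0 v i z by (simp only: powr_mult powr_powr) (simp add: mult_ac)
    qed
    finally show ?thesis by (simp add: K_def profile_def mult_ac)
  qed
  with K show thesis by (rule that)
qed

lemma Q_sup_profile_if_greater:
  assumes r: "0 < r" and s: "r < s" and C: "0 < C"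
  obtains K where "0 < K"
    "\<And>\<theta>. sqrt (s / (real CARD('d) + r)) < \<theta> \<Longrightarrow>
      Q_sup N r s C f m \<theta> = ennreal (K * profile (s + real CARD('d)) (s / (real CARD('d) + r)) (real CARD('d) / 2) \<theta>)"
proof -
  let ?d = "real CARD('d)"
  let ?\<sigma> = "s / (?d + r)"
  obtain i where i: "0 < i"
    "\<And>c t. 0 \<le> c \<Longrightarrow> 0 < t \<Longrightarrow>
      (\<integral>\<^sup>+x. ennreal (c * exp (- t * q (x - m))) \<partial>lborel) = ennreal (c * t powr (- ?d / 2) * i)"
    using nn_integral_exp_q_eq by blast
  define K where "K = C * (c\<^sub>0 powr (1 - ?\<sigma>) * (1 / 2) powr (- ?d / 2) * i)"
  have K: "0 < K" using C c\<^sub>0 i by (simp add: K_def)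
  have "Q_sup N r s C f m \<theta> = ennreal (K * profile (s + ?d) ?\<sigma> (?d / 2) \<theta>)"
    if \<theta>: "sqrt ?\<sigma> < \<theta>" for \<theta>
  proof -
    have \<sigma>: "0 < ?\<sigma>" using r s by simp
    then have "0 < sqrt ?\<sigma>" by simp
    then have \<theta>0: "0 < \<theta>" using \<theta> by linarith
    have z: "0 < \<theta>\<^sup>2 - ?\<sigma>" using \<theta> \<theta>0 by (simp add: sqrt_less_iff_less_square)
    let ?t = "1 / 2 * (\<theta>\<^sup>2 - ?\<sigma>)"
    have t: "0 < ?t" using z by simp
    have integrand: "ennreal (dilate_density \<theta> m f x) / ennreal (f x powr ?\<sigma>)
        = ennreal (c\<^sub>0 powr (1 - ?\<sigma>) * exp (- ?t * q (x - m)))" for x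
    proof -
      have "0 < dilate_density \<theta> m f x" by (simp add: dilate_density_def f_pos)
      then have "dilate_density \<theta> m f x / f x powr ?\<sigma> = dilate_density \<theta> m f x powr 1 / f x powr ?\<sigma>" by simp
      also have "\<dots> = c\<^sub>0 powr (1 - ?\<sigma>) *
          exp (- (\<theta>\<^sup>2 * 1 / 2) * q (x - m) - (- (?\<sigma> / 2) * q (x - m)))"
        unfolding dilate_density_powr f_powr powr_diff exp_diff by simp
      also have "- (\<theta>\<^sup>2 * 1 / 2) * q (x - m) - (- (?\<sigma> / 2) * q (x - m)) = - ?t * q (x - m)"
        by (simp add: algebra_simps)
      finally show ?thesis using f_pos[of x] \<open>0 < dilate_density \<theta> m f x\<close> by (subst divide_ennreal) auto
    qed
    have "(\<integral>\<^sup>+x. ennreal (dilate_density \<theta> m f x) / ennreal (f x powr ?\<sigma>) \<partial>lborel)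
      = ennreal (c\<^sub>0 powr (1 - ?\<sigma>) * ?t powr (- ?d / 2) * i)"
      unfolding integrand using i(2)[of "c\<^sub>0 powr (1 - ?\<sigma>)" ?t] t by simp
    then have "Q_sup N r s C f m \<theta> =
        ennreal (\<theta> powr (s + ?d)) * ennreal C * ennreal (c\<^sub>0 powr (1 - ?\<sigma>) * ?t powr (- ?d / 2) * i)"
      using s by (simp add: Q_sup_def Let_def)
    also have "\<dots> = ennreal (\<theta> powr (s + ?d) * C * (c\<^sub>0 powr (1 - ?\<sigma>) * ?t powr (- ?d / 2) * i))"
      using C i by (simp add: ennreal_mult)
    also have "?t powr (- ?d / 2) = (1 / 2) powr (- ?d / 2) * (\<theta>\<^sup>2 - ?\<sigma>) powr (- (?d / 2))"
      using z by (subst powr_mult) auto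
    finally show ?thesis by (simp add: K_def profile_def mult_ac)
  qed
  with K show thesis by (rule that)
qed

end

end

section \<open>Dilatations of optimal quantizers of a normal distribution\<close>

theorem proposition5p1:
  fixes N :: "real ^ 'd \<Rightarrow> real"
    and m :: "real ^ 'd"
    and \<Sigma> :: "real ^ 'd ^ 'd"
    and \<alpha> :: "nat \<Rightarrow> (real ^ 'd) set"
    and r s C d :: real
  defines "d \<equiv> real CARD('d)"
  assumes "is_norm N"
    and "r > 0" and "s > 0" and "C > 0"
    and "pos_def_matrix \<Sigma>"
    and "Lr_optimal N r (gaussian m \<Sigma>) \<alpha>"
  shows
    "(s \<in> {r<..<r + d} \<union> {r + d<..} \<longrightarrow>
        (\<forall>\<theta>>0. Ls_rate_optimal N s (gaussian m \<Sigma>) (\<lambda>n. dilate \<theta> m (\<alpha> n))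
                 \<longleftrightarrow> \<theta> \<in> {sqrt (s / (d + r))<..}) \<and>
        sqrt ((s + d) / (r + d)) \<in> {1<..} \<and>
        (\<forall>\<theta>. is_arg_min (Q_sup N r s C (gaussian_density m \<Sigma>) m)
                        (\<lambda>t. t \<in> {sqrt (s / (d + r))<..}) \<theta>
              \<longleftrightarrow> \<theta> = sqrt ((s + d) / (r + d))))
     \<and>
     (s \<in> {0<..<r} \<longrightarrow>
        (\<forall>\<theta>\<in>{sqrt (s / r)<..}.
            Ls_rate_optimal N s (gaussian m \<Sigma>) (\<lambda>n. dilate \<theta> m (\<alpha> n))) \<and>
        sqrt ((s + d) / (r + d)) \<in> {0<..<1} \<and>
        (\<forall>\<theta>. is_arg_min (Q_sup N r s C (gaussian_density m \<Sigma>) m)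
                        (\<lambda>t. t \<in> {sqrt (s / r)<..}) \<theta>
              \<longleftrightarrow> \<theta> = sqrt ((s + d) / (r + d))))"
proof -
  note S = \<open>pos_def_matrix \<Sigma>\<close>
  have d: "0 < d" by (simp add: d_def)
  define q where "q x = x \<bullet> (matrix_inv \<Sigma> *v x)" for x
  define c\<^sub>0 where "c\<^sub>0 = 1 / sqrt ((2 * pi) ^ CARD('d) * det \<Sigma>)"
  have c\<^sub>0: "0 < c\<^sub>0" using pos_def_matrix_det_pos[OF S] by (simp add: c\<^sub>0_def)
  have density: "gaussian_density m \<Sigma> x = c\<^sub>0 * exp (- q (x - m) / 2)" for x
    by (simp add: gaussian_density_def q_def c\<^sub>0_def)
  obtain A B where N: "vector_norm N A B" using is_norm_vector_norm[OF \<open>is_norm N\<close>] .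
  obtain lam Lam where q: "quad_form q lam Lam"
    using quad_form_matrix[of "matrix_inv \<Sigma>"] pos_def_matrix_inv_pos[OF S] unfolding q_def by blast
  interpret gaussian_quantizers N A B q lam Lam c\<^sub>0 m "gaussian m \<Sigma>" r \<alpha> "mesh CARD('d)"
    using N q c\<^sub>0 \<open>r > 0\<close> \<open>Lr_optimal N r (gaussian m \<Sigma>) \<alpha>\<close>
    by (intro gaussian_quantizers.intro gaussian_quantizers_axioms.intro)
       (auto simp: gaussian_def density)
  let ?\<tau> = "sqrt ((s + d) / (r + d))"
  have \<tau>: "0 < ?\<tau>" "?\<tau>\<^sup>2 = (s + d) / (r + d)" using d \<open>r > 0\<close> \<open>s > 0\<close> by auto
  show ?thesis
  proof (intro conjI impI)
    assume "s \<in> {r<..<r + d} \<union> {r + d<..}"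
    then have sr: "r < s" using d by auto
    show "\<forall>\<theta>>0. Ls_rate_optimal N s (gaussian m \<Sigma>) (\<lambda>n. dilate \<theta> m (\<alpha> n))
        \<longleftrightarrow> \<theta> \<in> {sqrt (s / (d + r))<..}"
    proof (intro allI impI)
      fix \<theta> :: real assume \<theta>: "0 < \<theta>"
      have "\<theta> \<in> {sqrt (s / (d + r))<..} \<longleftrightarrow> s < \<theta>\<^sup>2 * (r + real CARD('d))"
        using d \<open>r > 0\<close> by (simp add: sqrt_less_iff_less_square[OF \<theta>] pos_divide_less_eq d_def add.commute)
      then show "Ls_rate_optimal N s (gaussian m \<Sigma>) (\<lambda>n. dilate \<theta> m (\<alpha> n))
          \<longleftrightarrow> \<theta> \<in> {sqrt (s / (d + r))<..}"
        using dilatation_rate_optimal[OF \<open>s > 0\<close> \<theta>] dilatation_not_rate_optimal[OF \<open>s > 0\<close> \<theta>]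
        by (metis not_less)
    qed
    show "?\<tau> \<in> {1<..}" using sr d \<open>r > 0\<close> by simp
    obtain K where K: "0 < K" "\<And>\<theta>. sqrt (s / (d + r)) < \<theta> \<Longrightarrow>
      Q_sup N r s C (gaussian_density m \<Sigma>) m \<theta> = ennreal (K * profile (s + d) (s / (d + r)) (d / 2) \<theta>)"
      using quad_form.Q_sup_profile_if_greater[OF q N c\<^sub>0 density \<open>r > 0\<close> sr \<open>C > 0\<close>] unfolding d_def by blast
    show "\<forall>\<theta>. is_arg_min (Q_sup N r s C (gaussian_density m \<Sigma>) m)
        (\<lambda>t. t \<in> {sqrt (s / (d + r))<..}) \<theta> \<longleftrightarrow> \<theta> = ?\<tau>"
    proof (intro allI is_arg_min_profile_iff[OF _ _ _ K \<tau>(1)])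
      show "?\<tau>\<^sup>2 = (s + d) * (s / (d + r)) / (s + d - 2 * (d / 2))"
        unfolding \<tau>(2) using d \<open>r > 0\<close> \<open>s > 0\<close> by (simp add: add.commute)
    qed (use d \<open>r > 0\<close> \<open>s > 0\<close> in auto)
  next
    assume "s \<in> {0<..<r}"
    then have sr: "s < r" by auto
    show "\<forall>\<theta>\<in>{sqrt (s / r)<..}. Ls_rate_optimal N s (gaussian m \<Sigma>) (\<lambda>n. dilate \<theta> m (\<alpha> n))"
    proof
      fix \<theta> assume "\<theta> \<in> {sqrt (s / r)<..}"
      then have less: "sqrt (s / r) < \<theta>" by simp
      have "0 < sqrt (s / r)" using \<open>r > 0\<close> \<open>s > 0\<close> by simp
      then have \<theta>: "0 < \<theta>" using less by linarith
      have "s < \<theta>\<^sup>2 * r" using less \<open>r > 0\<close> by (simp add: sqrt_less_iff_less_square[OF \<theta>] pos_divide_less_eq)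
      also have "\<dots> \<le> \<theta>\<^sup>2 * (r + real CARD('d))" by (intro mult_left_mono) auto
      finally show "Ls_rate_optimal N s (gaussian m \<Sigma>) (\<lambda>n. dilate \<theta> m (\<alpha> n))"
        by (intro dilatation_rate_optimal \<open>s > 0\<close> \<theta>)
    qed
    show "?\<tau> \<in> {0<..<1}" using sr d \<open>r > 0\<close> \<open>s > 0\<close> by simp
    obtain K where K: "0 < K" "\<And>\<theta>. sqrt (s / r) < \<theta> \<Longrightarrow>
      Q_sup N r s C (gaussian_density m \<Sigma>) m \<theta> = ennreal (K * profile (s + d) (s / r) (d / 2 * (1 - s / r)) \<theta>)"
      using quad_form.Q_sup_profile_if_less[OF q N c\<^sub>0 density \<open>s > 0\<close> sr] unfolding d_def by blast
    show "\<forall>\<theta>. is_arg_min (Q_sup N r s C (gaussian_density m \<Sigma>) m)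
        (\<lambda>t. t \<in> {sqrt (s / r)<..}) \<theta> \<longleftrightarrow> \<theta> = ?\<tau>"
    proof (intro allI is_arg_min_profile_iff[OF _ _ _ K \<tau>(1)])
      have eq: "s + d - 2 * (d / 2 * (1 - s / r)) = s / r * (r + d)"
        using \<open>r > 0\<close> by (simp add: field_simps)
      show "2 * (d / 2 * (1 - s / r)) < s + d"
        using eq d \<open>r > 0\<close> \<open>s > 0\<close> by (smt (verit) mult_pos_pos divide_pos_pos)
      show "?\<tau>\<^sup>2 = (s + d) * (s / r) / (s + d - 2 * (d / 2 * (1 - s / r)))"
        unfolding \<tau>(2) eq using d \<open>r > 0\<close> \<open>s > 0\<close> by simp
    qed (use d sr \<open>r > 0\<close> \<open>s > 0\<close> in auto)
  qed
qed

end
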